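(* Let $\ell\ge 0$ and let $(X_i)_{i\ge 1}$ be a sequence of independent random vectors in $\mathbb{R}^d$, where $X_i$ has law $\nu_i\in\mathcal{P}_\ell(\mathbb{R}^d)$. Set $\mu_N:=\frac1N\sum_{i=1}^N\delta_{X_i}$ and $\bar\nu_N:=\frac1N\sum_{i=1}^N\nu_i$. Let $\mu\in\mathcal{P}_\ell(\mathbb{R}^d)$ and $U:\mathcal{P}_\ell(\mathbb{R}^d)\to\mathbb{R}$. Assume: 1. $W_\ell\left(\frac1N\sum_{i=1}^N\nu_i(dx)\nu_i(dy),\,\eta(dx,dy)\right)\to 0$ as $N\to\infty$ for some $\eta\in\mathcal{P}_\ell(\mathbb{R}^d\times\mathbb{R}^d)$ with $\mu(\cdot)=\eta(\mathbb{R}^d\times\cdot)=\eta(\cdot\times\mathbb{R}^d)$. 2. $\left\|\sqrt N(\bar\nu_N-\mu)-\sigma\right\|_\ell\to 0$ as $N\to\infty$ for some signed measure $\sigma\in\mathcal{M}_\ell(\mathbb{R}^d)$. 3. (Tails) There exists $\beta\in(0,1)$ such that $\sum_{i=1}^\infty\frac1i\,\mathbb{E}\left[\left(|X_i|^\ell-i^\beta\right)1_{\{|X_i|^\ell>i^\beta\}}\right]<\infty$. 4. (Regularity of $U$) There exists $r>0$ such that, with $B(\mu,r)$ the ball centered at $\mu$ with radius $r$ for the metric $W_\ell$: (a) $U$ admits a linear functional derivative $\frac{\delta U}{\delta m}(\tilde\mu,\cdot)$ at every $\tilde\mu\in B(\mu,r)$; (b) there is $C<\infty$ such that $\left|\frac{\delta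 U}{\delta m}(\tilde\mu,x)\right|\le C(1+|x|^{\ell/2})$ for all $(\tilde\mu,x)\in B(\mu,r)\times\mathbb{R}^d$; (c) $\sup_{x\in\mathbb{R}^d}\frac{\left|\frac{\delta U}{\delta m}(\tilde\mu,x)-\frac{\delta U}{\delta m}(\mu,x)\right|}{1+|x|^{\ell/2}}\to 0$ when $W_\ell(\tilde\mu,\mu)\to 0$; (d) $x\mapsto\frac{\delta U}{\delta m}(\mu,x)$ is continuous $\mu$-almost everywhere; (e) there are $\alpha\in(\frac12,1]$ and $C<\infty$ such that for all $\mu_1,\mu_2\in B(\mu,r)$ and all $x\in\mathbb{R}^d$, $$\left|\frac{\delta U}{\delta m}(\mu_2,x)-\frac{\delta U}{\delta m}(\mu_1,x)\right|\le C\left((1+|x|^\ell)\|\mu_2-\mu_1\|_0^\alpha+(1+|x|^{\ell(1-\alpha)})\left(\int_{\mathbb{R}^d}|y|^\ell\,|\mu_2-\mu_1|(dy)\right)^\alpha\right).$$ Then, as $N\to\infty$, $\sqrt N\left(U(\mu_N)-U(\mu)\right)$ converges in distribution to the Gaussian law $$\mathcal{N}\left(\int_{\mathbb{R}^d}\frac{\delta U}{\delta m}(\mu,x)\,\sigma(dx),\ \int_{\mathbb{R}^d}\left(\frac{\delta U}{\delta m}(\mu,x)\right)^2\mu(dx)-\int_{\mathbb{R}^d\times\mathbb{R}^d}\frac{\delta U}{\delta m}(\mu,x)\frac{\delta U}{\delta m}(\mu,y)\,\eta(dx,dy)\right).$$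
   Context: For $\ell\ge0$ and an integer $k\ge 1$, $\mathcal{P}_\ell(\mathbb{R}^k)$ is the set of Borel probability measures $m$ on $\mathbb{R}^k$ with $\int|x|^\ell m(dx)<\infty$, and $\mathcal{M}_\ell(\mathbb{R}^k)$ is the space of signed measures $\tau$ with $\int|x|^\ell|\tau|(dx)<\infty$, where $|\tau|$ is the total variation measure of $\tau$. The convention $|x|^0=1$ is used. For $\ell>0$, $W_\ell(\mu_1,\mu_2)=\inf_\rho\left(\int|x-y|^\ell\rho(dx,dy)\right)^{1/(\ell\vee1)}$, and for $\ell=0$, $W_0(\mu_1,\mu_2)=\inf_\rho\int(1\wedge|x-y|)\rho(dx,dy)$, where the infima are over all couplings $\rho$ of $\mu_1$ and $\mu_2$ (probability measures with first marginal $\mu_1$ and second marginal $\mu_2$). For $\tau\in\mathcal{M}_\ell(\mathbb{R}^d)$, $\|\tau\|_\ell=\sup\left\{\int f\,d\tau:\ f \text{ measurable},\ |f(x)|\le1+|x|^\ell\ \forall x\right\}$; for $\ell=0$ and probability measures $\mu_1,\mu_2$ the convention is $\|\mu_1-\mu_2\|_0=|\mu_1-\mu_2|(\mathbb{R}^d)=\sup_{\|f\|_\infty\le 1}\left|\int f\,d(\mu_1-\mu_2)\right|$ (twice the total variation distance). Linear functional derivative: $U:\mathcal{P}_\ell(\mathbb{R}^d)\to\mathbb{R}$ admits a linear functional derivative at $m\in\mathcal{P}_\ell(\mathbb{R}^d)$ if there is a measurable function $y\mapsto\frac{\delta U}{\delta m}(m,y)$ with $\sup_y\frac{|\frac{\delta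 U}{\delta m}(m,y)|}{1+|y|^\ell}<\infty$ such that for all $\nu\in\mathcal{P}_\ell(\mathbb{R}^d)$, $\frac{d}{d\epsilon}\big|_{\epsilon=0^+}U(m+\epsilon(\nu-m))=\int_{\mathbb{R}^d}\frac{\delta U}{\delta m}(m,y)(\nu-m)(dy)$. The hypotheses refer to a fixed choice of such functions $\frac{\delta U}{\delta m}(m,\cdot)$, $m\in B(\mu,r)$. A Gaussian law with variance $0$ is understood as a Dirac mass.
   Formalization: The functional U is additionally assumed to be Borel measurable on P_ℓ(R^d); without this, U(μ_N) need not be a random variable and its convergence in distribution is not defined. *)

theory Defs
  imports "HOL-Probability.Probability"
begin

text \<open>\<open>R\<^sup>d\<close> is an arbitrary Euclidean space \<open>'a\<close>; the product type carries the Euclidean norm.\<close>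

text \<open>\<open>0 powr 0 = 0\<close> in the library, whereas here \<open>|x|\<^sup>0 = 1\<close> for all \<open>x\<close>, including \<open>x = 0\<close>.\<close>

definition norm_pow :: "real \<Rightarrow> 'a::real_normed_vector \<Rightarrow> real" where
  "norm_pow l x = (if l = 0 then 1 else norm x powr l)"

definition prob_moment :: "real \<Rightarrow> 'a::euclidean_space measure set" where
  "prob_moment l = {m. prob_space m \<and> sets m = sets borel \<and> integrable m (norm_pow l)}"

text \<open>The Borel measure with a given set function as values; only meaningful when the set
  function is nonnegative and countably additive on the Borel sets.\<close>

definition borel_measure :: "('a::topological_space set \<Rightarrow> real) \<Rightarrow> 'a measure" where
  "borel_measure f = measure_of UNIV (sets borel) (\<lambda>A. ennreal (f A))"

definition average_measure :: "nat \<Rightarrow> (nat \<Rightarrow> 'a::topological_space measure) \<Rightarrow> 'a measure" where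
  "average_measure N M = borel_measure (\<lambda>A. (\<Sum>i=1..N. measure (M i) A) / real N)"

text \<open>The measure \<open>m + e (n - m)\<close>, for \<open>e\<close> between 0 and 1.\<close>

definition mix_measure :: "real \<Rightarrow> 'a::topological_space measure \<Rightarrow> 'a measure \<Rightarrow> 'a measure" where
  "mix_measure e m n = borel_measure (\<lambda>A. measure m A + e * (measure n A - measure m A))"


text \<open>A (finite) signed Borel measure is a real set function that is countably additive on the
  Borel sets. Its values on other sets are irrelevant below.\<close>

definition signed_measure :: "('a::topological_space set \<Rightarrow> real) \<Rightarrow> bool" where
  "signed_measure \<tau> \<longleftrightarrow>
     \<tau> {} = 0 \<and>
     (\<forall>A :: nat \<Rightarrow> 'a set. range A \<subseteq> sets borel \<longrightarrow> disjoint_family A \<longrightarrow>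
        (\<lambda>n. \<tau> (A n)) sums \<tau> (\<Union>n. A n))"

definition measure_diff :: "'a measure \<Rightarrow> 'a measure \<Rightarrow> 'a set \<Rightarrow> real" where
  "measure_diff m n A = measure m A - measure n A"

text \<open>Jordan decomposition: \<open>\<tau>\<^sup>+ A = sup {\<tau> B | B \<subseteq> A}\<close> and \<open>\<tau>\<^sup>- = (- \<tau>)\<^sup>+\<close>. The suprema are
  finite, a signed measure being bounded.\<close>

definition pos_variation :: "('a::topological_space set \<Rightarrow> real) \<Rightarrow> 'a measure" where
  "pos_variation \<tau> = borel_measure (\<lambda>A. SUP B\<in>{B \<in> sets borel. B \<subseteq> A}. \<tau> B)"

definition neg_variation :: "('a::topological_space set \<Rightarrow> real) \<Rightarrow> 'a measure" where
  "neg_variation \<tau> = pos_variation (\<lambda>A. - \<tau> A)"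

definition total_variation :: "('a::topological_space set \<Rightarrow> real) \<Rightarrow> 'a measure" where
  "total_variation \<tau> =
     borel_measure (\<lambda>A. measure (pos_variation \<tau>) A + measure (neg_variation \<tau>) A)"

definition signed_integral ::
    "('a::topological_space set \<Rightarrow> real) \<Rightarrow> ('a \<Rightarrow> real) \<Rightarrow> real" where
  "signed_integral \<tau> f = (LINT x|pos_variation \<tau>. f x) - (LINT x|neg_variation \<tau>. f x)"

definition signed_moment :: "real \<Rightarrow> ('a::euclidean_space set \<Rightarrow> real) set" where
  "signed_moment l = {\<tau>. signed_measure \<tau> \<and> integrable (total_variation \<tau>) (norm_pow l)}"

text \<open>The supremum is that of a nonempty bounded set whenever \<open>\<tau> \<in> signed_moment l\<close>.\<close>

definition weighted_norm :: "real \<Rightarrow> ('a::euclidean_space set \<Rightarrow> real) \<Rightarrow> real" where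
  "weighted_norm l \<tau> =
     (SUP f\<in>{f \<in> borel_measurable borel. \<forall>x. \<bar>f x\<bar> \<le> 1 + norm_pow l x}. signed_integral \<tau> f)"

text \<open>For differences of probability measures the norm with index 0 is, by convention, the total
  mass of the total variation measure, i.e. half of what \<open>weighted_norm 0\<close> gives.\<close>

definition tv_norm :: "('a::topological_space set \<Rightarrow> real) \<Rightarrow> real" where
  "tv_norm \<tau> = measure (total_variation \<tau>) UNIV"


definition couplings ::
    "'a::euclidean_space measure \<Rightarrow> 'a measure \<Rightarrow> ('a \<times> 'a) measure set" where
  "couplings m n =
     {\<rho>. prob_space \<rho> \<and> sets \<rho> = sets borel \<and> distr \<rho> borel fst = m \<and> distr \<rho> borel snd = n}"

text \<open>For \<open>m, n \<in> prob_moment l\<close> the set of couplings is nonempty and all integrals are finite.\<close>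

definition wasserstein ::
    "real \<Rightarrow> 'a::euclidean_space measure \<Rightarrow> 'a measure \<Rightarrow> real" where
  "wasserstein l m n =
     (if l = 0 then INF \<rho>\<in>couplings m n. LINT z|\<rho>. min 1 (norm (fst z - snd z))
      else INF \<rho>\<in>couplings m n.
             (LINT z|\<rho>. norm (fst z - snd z) powr l) powr (1 / max l 1))"

definition wasserstein_ball ::
    "real \<Rightarrow> 'a::euclidean_space measure \<Rightarrow> real \<Rightarrow> 'a measure set" where
  "wasserstein_ball l \<mu> r = {m \<in> prob_moment l. wasserstein l m \<mu> < r}"

text \<open>The set \<open>prob_moment l\<close> as a measurable space. The sigma-algebra generated by the maps
  \<open>m \<mapsto> m A\<close> is the Borel sigma-algebra of the Wasserstein metric. It is used to say that a
  functional \<open>U\<close> is measurable, so that \<open>U\<close> of an empirical measure is a random variable. This does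
  not follow from regularity of the linear functional derivative: for arbitrary \<open>h\<close> with values in
  \<open>[0, 1]\<close>, \<open>U m = (\<Sum>x. h x * (m {x})\<^sup>2)\<close> has the derivative \<open>2 * h x * m {x}\<close>, which vanishes
  outside a countable set.\<close>

definition prob_moment_space :: "real \<Rightarrow> 'a::euclidean_space measure measure" where
  "prob_moment_space l = restrict_space (prob_algebra borel) (prob_moment l)"


definition has_linear_functional_derivative ::
    "real \<Rightarrow> ('a::euclidean_space measure \<Rightarrow> real) \<Rightarrow> ('a \<Rightarrow> real) \<Rightarrow> 'a measure \<Rightarrow> bool" where
  "has_linear_functional_derivative l U g m \<longleftrightarrow>
     g \<in> borel_measurable borel \<and>
     bdd_above (range (\<lambda>y. \<bar>g y\<bar> / (1 + norm_pow l y))) \<and>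
     (\<forall>\<nu>\<in>prob_moment l.
        ((\<lambda>e. U (mix_measure e m \<nu>)) has_real_derivative signed_integral (measure_diff \<nu> m) g)
          (at_right 0))"

definition gaussian_law :: "real \<Rightarrow> real \<Rightarrow> real measure" where
  "gaussian_law a v =
     (if v = 0 then return borel a
      else density lborel (\<lambda>x. ennreal (normal_density a (sqrt v) x)))"

end

theory Submission
  imports Defs "HOL-Real_Asymp.Real_Asymp"
begin

text \<open>
  Write \<open>f\<close> for the derivative at \<open>\<mu>\<close> and replace, one index \<open>i\<close> at a time, the law \<open>\<nu>\<^sub>i\<close> in the
  average of the laws by the Dirac mass at \<open>X\<^sub>i\<close>. The mean value theorem along the segment joining two
  consecutive measures and the Hoelder condition (with \<open>\<alpha> > 1/2\<close>) give, up to an error that is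
  negligible after summation, an increment \<open>g(X\<^sub>i) - \<integral> g d\<nu>\<^sub>i\<close> of order \<open>1/N\<close>, where \<open>g\<close> is the
  derivative at a measure depending on \<open>X\<^sub>1, \<dots>, X\<^sub>i\<^sub>-\<^sub>1\<close> only. Once \<open>f\<close> is subtracted from \<open>g\<close>, these are
  orthogonal increments whose second moments are small on the event that all intermediate measures
  are close to \<open>\<mu>\<close>, and what remains is a sum of independent variables, to which Lindeberg's argument
  applies. Closeness in the Wasserstein distance follows from closeness of the masses of finitely many
  small cells and smallness of one tail integral, so that Hoeffding's inequality and Markov's
  inequality show that the event has probability close to 1. The passage from the average of the laws
  to \<open>\<mu>\<close> yields the mean of the limit.
\<close>

text \<open>The measure at which the mean value theorem evaluates the derivative depends on the
  sample point just inserted, so the increment is not centred given the past. The Hoelder condition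
  moves the evaluation back to the measure before the insertion. The two measures differ by at most
  \<open>2 / N\<close> in total variation, which costs order N to the power - 1 - \<alpha> per step
  in mean; with N steps and the factor \<open>sqrt N\<close> in front this makes N to the power 1/2
  - \<alpha>, hence \<alpha> > 1/2. Regularity of \<open>D\<close> is available only near \<mu>,
  while the intermediate measures are near \<mu> only with large probability. The increments are
  therefore set to 0 whenever the measure before the step is not close; this is decided by the past,
  so orthogonality survives. Closeness is expressed by masses of cells and a tail integral because
  these are linear in the measure: they pass to segments, depend measurably on the sample, and their
  means converge even for discontinuous integrands, the convergence to \<sigma> being uniform over
  all measurable functions of growth \<open>l\<close>.\<close>

section \<open>Weighted sums of Borel measures\<close>

text \<open>Averages, mixtures, total variations and scaled point masses are all instances, so that
  masses and integrals are computed only once. The weights enter through \<open>ennreal\<close>,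
  which makes the set function countably additive for any real \<open>c\<close>; the real-valued
  formulas below ask for nonnegative weights.\<close>

definition weighted_sum_measure ::
    "'i set \<Rightarrow> ('i \<Rightarrow> real) \<Rightarrow> ('i \<Rightarrow> 'a::topological_space measure) \<Rightarrow> 'a measure" where
  "weighted_sum_measure I c M =
     measure_of UNIV (sets borel) (\<lambda>A. \<Sum>i\<in>I. ennreal (c i) * emeasure (M i) A)"

lemma sets_weighted_sum_measure [simp, measurable_cong]:
  "sets (weighted_sum_measure I c M) = sets borel"
  by (simp add: weighted_sum_measure_def sets.sigma_sets_eq[of borel, simplified space_borel])

lemma space_weighted_sum_measure [simp]: "space (weighted_sum_measure I c M) = UNIV"
  by (simp add: weighted_sum_measure_def)

lemma emeasure_weighted_sum_measure:
  assumes "\<And>i. i \<in> I \<Longrightarrow> sets (M i) = sets borel" "A \<in> sets borel"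
  shows "emeasure (weighted_sum_measure I c M) A = (\<Sum>i\<in>I. ennreal (c i) * emeasure (M i) A)"
proof (rule emeasure_measure_of[OF weighted_sum_measure_def])
  show "positive (sets (weighted_sum_measure I c M)) (\<lambda>A. \<Sum>i\<in>I. ennreal (c i) * emeasure (M i) A)"
    by (simp add: positive_def)
  show "countably_additive (sets (weighted_sum_measure I c M))
      (\<lambda>A. \<Sum>i\<in>I. ennreal (c i) * emeasure (M i) A)"
  proof (rule countably_additiveI)
    fix F :: "nat \<Rightarrow> 'b set"
    assume F: "range F \<subseteq> sets (weighted_sum_measure I c M)" "disjoint_family F"
    have "(\<Sum>n. \<Sum>i\<in>I. ennreal (c i) * emeasure (M i) (F n))
        = (\<Sum>i\<in>I. \<Sum>n. ennreal (c i) * emeasure (M i) (F n))"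
      by (intro suminf_sum summableI)
    also have "\<dots> = (\<Sum>i\<in>I. ennreal (c i) * emeasure (M i) (\<Union>n. F n))"
      using F assms(1) by (intro sum.cong refl) (simp add: suminf_emeasure ennreal_suminf_cmult)
    finally show "(\<Sum>n. \<Sum>i\<in>I. ennreal (c i) * emeasure (M i) (F n))
        = (\<Sum>i\<in>I. ennreal (c i) * emeasure (M i) (\<Union>n. F n))" .
  qed
qed (use assms in auto)

lemma nn_integral_weighted_sum_measure:
  assumes M: "\<And>i. i \<in> I \<Longrightarrow> sets (M i) = sets borel" and g: "g \<in> borel_measurable borel"
  shows "(\<integral>\<^sup>+x. g x \<partial>weighted_sum_measure I c M) = (\<Sum>i\<in>I. ennreal (c i) * (\<integral>\<^sup>+x. g x \<partial>M i))"
  using g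
proof induct
  case (cong f g)
  have "(\<integral>\<^sup>+x. f x \<partial>M i) = (\<integral>\<^sup>+x. g x \<partial>M i)" if "i \<in> I" for i
    using cong by (intro nn_integral_cong) auto
  then show ?case using cong(4) cong(3) by simp
next
  case (set A)
  then show ?case using M by (simp add: emeasure_weighted_sum_measure)
next
  case (mult u d)
  have "u \<in> borel_measurable (M i)" if "i \<in> I" for i
    using mult M[OF that] by (simp cong: measurable_cong_sets)
  moreover have "u \<in> borel_measurable (weighted_sum_measure I c M)"
    using mult by (simp cong: measurable_cong_sets)
  ultimately show ?case
    using mult by (simp add: nn_integral_cmult sum_distrib_left mult_ac)
next
  case (add u v)
  have "u \<in> borel_measurable (M i)" "v \<in> borel_measurable (M i)" if "i \<in> I" for i
    using add M[OF that] by (simp_all cong: measurable_cong_sets)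
  moreover have "u \<in> borel_measurable (weighted_sum_measure I c M)"
    "v \<in> borel_measurable (weighted_sum_measure I c M)"
    using add by (simp_all cong: measurable_cong_sets)
  ultimately show ?case
    using add by (simp add: nn_integral_add sum.distrib algebra_simps)
next
  case (seq U)
  have m: "U n \<in> borel_measurable (M i)" if "i \<in> I" for i n
    using seq M[OF that] by (simp cong: measurable_cong_sets)
  have m': "U n \<in> borel_measurable (weighted_sum_measure I c M)" for n
    using seq by (simp cong: measurable_cong_sets)
  have "(\<integral>\<^sup>+x. (SUP n. U n) x \<partial>weighted_sum_measure I c M)
      = (SUP n. \<integral>\<^sup>+x. U n x \<partial>weighted_sum_measure I c M)"
    by (simp only: SUP_apply nn_integral_monotone_convergence_SUP[OF \<open>incseq U\<close> m'])
  also have "\<dots> = (SUP n. \<Sum>i\<in>I. ennreal (c i) * (\<integral>\<^sup>+x. U n x \<partial>M i))"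
    by (simp only: seq)
  also have "\<dots> = (\<Sum>i\<in>I. SUP n. ennreal (c i) * (\<integral>\<^sup>+x. U n x \<partial>M i))"
    using \<open>incseq U\<close> by (intro ennreal_SUP_sum)
      (auto simp: incseq_def le_fun_def intro!: mult_left_mono nn_integral_mono)
  also have "\<dots> = (\<Sum>i\<in>I. ennreal (c i) * (\<integral>\<^sup>+x. (SUP n. U n) x \<partial>M i))"
    by (intro sum.cong refl)
       (simp only: SUP_apply SUP_mult_left_ennreal nn_integral_monotone_convergence_SUP[OF \<open>incseq U\<close> m])
  finally show ?case .
qed

lemma
  fixes g :: "'a::topological_space \<Rightarrow> real"
  assumes M: "\<And>i. i \<in> I \<Longrightarrow> sets (M i) = sets borel"
    and c: "\<And>i. i \<in> I \<Longrightarrow> 0 \<le> c i"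
    and g: "\<And>i. i \<in> I \<Longrightarrow> integrable (M i) g" and gm: "g \<in> borel_measurable borel"
  shows integrable_weighted_sum_measure: "integrable (weighted_sum_measure I c M) g"
    and integral_weighted_sum_measure:
      "(LINT x|weighted_sum_measure I c M. g x) = (\<Sum>i\<in>I. c i * (LINT x|M i. g x))"
proof -
  let ?W = "weighted_sum_measure I c M"
  have gW: "g \<in> borel_measurable ?W"
    using gm by (simp cong: measurable_cong_sets)
  \<comment> \<open>One formula serves \<open>\<bar>g\<bar>\<close>, \<open>g\<close> and
    \<open>- g\<close>: \<open>ennreal\<close> cuts off negative values, so it suffices that
    \<open>h\<close> is at most \<open>\<bar>g\<bar>\<close>.\<close>
  have fin: "(\<integral>\<^sup>+x. ennreal (h x) \<partial>?W) = ennreal (\<Sum>i\<in>I. c i * enn2real (\<integral>\<^sup>+x. ennreal (h x) \<partial>M i))"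
    if h: "h \<in> borel_measurable borel" and hg: "\<And>x. h x \<le> \<bar>g x\<bar>" for h
  proof -
    have "(\<integral>\<^sup>+x. ennreal (h x) \<partial>?W) = (\<Sum>i\<in>I. ennreal (c i) * (\<integral>\<^sup>+x. ennreal (h x) \<partial>M i))"
      using M h by (intro nn_integral_weighted_sum_measure) auto
    also have "\<dots> = (\<Sum>i\<in>I. ennreal (c i * enn2real (\<integral>\<^sup>+x. ennreal (h x) \<partial>M i)))"
    proof (intro sum.cong refl)
      fix i assume i: "i \<in> I"
      have "(\<integral>\<^sup>+x. ennreal (h x) \<partial>M i) \<le> (\<integral>\<^sup>+x. ennreal (norm (g x)) \<partial>M i)"
        using hg by (intro nn_integral_mono ennreal_leI) auto
      also have "\<dots> < \<infinity>"
        using g[OF i] by (simp add: integrable_iff_bounded)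
      finally show "ennreal (c i) * (\<integral>\<^sup>+x. ennreal (h x) \<partial>M i)
          = ennreal (c i * enn2real (\<integral>\<^sup>+x. ennreal (h x) \<partial>M i))"
        using c[OF i] by (simp add: ennreal_mult)
    qed
    also have "\<dots> = ennreal (\<Sum>i\<in>I. c i * enn2real (\<integral>\<^sup>+x. ennreal (h x) \<partial>M i))"
      using c by (intro sum_ennreal) simp
    finally show ?thesis .
  qed
  show int: "integrable ?W g"
    using gW fin[of "\<lambda>x. \<bar>g x\<bar>"] gm by (intro integrableI_bounded) auto
  have nn: "0 \<le> (\<Sum>i\<in>I. c i * enn2real (\<integral>\<^sup>+x. ennreal (h x) \<partial>M i))" for h
    using c by (intro sum_nonneg) simp
  have "(LINT x|?W. g x) = (\<Sum>i\<in>I. c i * enn2real (\<integral>\<^sup>+x. ennreal (g x) \<partial>M i))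
      - (\<Sum>i\<in>I. c i * enn2real (\<integral>\<^sup>+x. ennreal (- g x) \<partial>M i))"
    using gm by (subst real_lebesgue_integral_def[OF int]) (simp add: fin nn)
  also have "\<dots> = (\<Sum>i\<in>I. c i * (LINT x|M i. g x))"
    using g by (simp add: real_lebesgue_integral_def sum_subtractf[symmetric] right_diff_distrib)
  finally show "(LINT x|?W. g x) = (\<Sum>i\<in>I. c i * (LINT x|M i. g x))" .
qed

lemma sum_bool: "(\<Sum>b\<in>UNIV. h b) = h False + h True" for h :: "bool \<Rightarrow> 'b::comm_monoid_add"
  by (simp add: UNIV_bool)

text \<open>\<open>borel_measure\<close> can be evaluated only when its argument is known to be
  countably additive. For averages, mixtures and total variations this is inherited from a finite
  measure \<open>K\<close> with the same values.\<close>

lemma borel_measure_eqI: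
  assumes "sets K = sets borel" "finite_measure K" "\<And>A. A \<in> sets borel \<Longrightarrow> f A = measure K A"
  shows "borel_measure f = K"
proof -
  interpret finite_measure K by fact
  have sp: "space K = UNIV"
    using assms(1) by (metis sets_eq_imp_space_eq space_borel)
  have "borel_measure f = measure_of UNIV (sets borel) (emeasure K)"
    unfolding borel_measure_def
    using assms(3) by (intro measure_of_eq)
      (auto simp: emeasure_eq_measure sets.sigma_sets_eq[of borel, simplified space_borel])
  also have "\<dots> = K"
    using measure_of_of_measure[of K] assms(1) sp by simp
  finally show ?thesis .
qed

lemma finite_weighted_sum_measure:
  assumes "\<And>i. i \<in> I \<Longrightarrow> sets (M i) = sets borel" "\<And>i. i \<in> I \<Longrightarrow> finite_measure (M i)"
  shows "finite_measure (weighted_sum_measure I c M)"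
proof (rule finite_measureI)
  have "emeasure (weighted_sum_measure I c M) UNIV = (\<Sum>i\<in>I. ennreal (c i) * emeasure (M i) UNIV)"
    using assms by (intro emeasure_weighted_sum_measure) auto
  moreover have "emeasure (M i) UNIV \<noteq> \<infinity>" if "i \<in> I" for i
  proof -
    interpret finite_measure "M i" using assms that by auto
    show ?thesis by simp
  qed
  then have "(\<Sum>i\<in>I. ennreal (c i) * emeasure (M i) UNIV) < top"
    by (cases "finite I") (auto simp: ennreal_mult_less_top less_top)
  ultimately show "emeasure (weighted_sum_measure I c M) (space (weighted_sum_measure I c M)) \<noteq> \<infinity>"
    by simp
qed

lemma measure_weighted_sum_measure:
  assumes M: "\<And>i. i \<in> I \<Longrightarrow> sets (M i) = sets borel" "\<And>i. i \<in> I \<Longrightarrow> finite_measure (M i)"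
    and c: "\<And>i. i \<in> I \<Longrightarrow> 0 \<le> c i" and A: "A \<in> sets borel"
  shows "measure (weighted_sum_measure I c M) A = (\<Sum>i\<in>I. c i * measure (M i) A)"
proof -
  have *: "ennreal (c i) * emeasure (M i) A = ennreal (c i * measure (M i) A)" if "i \<in> I" for i
  proof -
    interpret finite_measure "M i" using M that by auto
    show ?thesis using c[OF that] by (simp add: emeasure_eq_measure ennreal_mult)
  qed
  have "emeasure (weighted_sum_measure I c M) A = ennreal (\<Sum>i\<in>I. c i * measure (M i) A)"
    using c by (subst emeasure_weighted_sum_measure) (auto simp: M A * intro!: sum_ennreal)
  then show ?thesis
    using c by (intro measure_eq_emeasure_eq_ennreal sum_nonneg) auto
qed

lemma average_measure_eq:
  assumes "\<And>i. i \<in> {1..N} \<Longrightarrow> sets (M i) = sets borel" "\<And>i. i \<in> {1..N} \<Longrightarrow> finite_measure (M i)"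
  shows "average_measure N M = weighted_sum_measure {1..N} (\<lambda>_. 1 / real N) M"
  unfolding average_measure_def
proof (intro borel_measure_eqI finite_weighted_sum_measure sets_weighted_sum_measure)
  fix A :: "'a set"
  assume A: "A \<in> sets borel"
  show "(\<Sum>i=1..N. measure (M i) A) / real N
      = measure (weighted_sum_measure {1..N} (\<lambda>_. 1 / real N) M) A"
    using assms A by (subst measure_weighted_sum_measure) (auto simp: sum_divide_distrib)
qed (use assms in auto)

lemma mix_measure_eq:
  assumes "sets m = sets borel" "finite_measure m" "sets n = sets borel" "finite_measure n"
    and "0 \<le> e" "e \<le> 1"
  shows "mix_measure e m n = weighted_sum_measure UNIV
    (\<lambda>b. if b then e else 1 - e) (\<lambda>b. if b then n else m)"
  unfolding mix_measure_def using assms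
  by (intro borel_measure_eqI finite_weighted_sum_measure)
     (auto simp: measure_weighted_sum_measure sum_bool algebra_simps)

section \<open>Probability measures with moments\<close>

lemma norm_pow_nonneg [simp]: "0 \<le> norm_pow l x"
  by (simp add: norm_pow_def)

lemma norm_pow_measurable [measurable]:
  "norm_pow l \<in> borel_measurable (borel :: 'a::euclidean_space measure)"
  unfolding norm_pow_def[abs_def] by (cases "l = 0") simp_all

lemma prob_momentD:
  assumes "m \<in> prob_moment l"
  shows "prob_space m" "sets m = sets borel" "space m = UNIV" "integrable m (norm_pow l)"
    "finite_measure m"
  using assms
  by (auto simp: prob_moment_def prob_space_def dest: sets_eq_imp_space_eq)

lemma measure_prob_moment_UNIV: "m \<in> prob_moment l \<Longrightarrow> measure m UNIV = 1"
  using prob_space.prob_space[OF prob_momentD(1)] prob_momentD(3) by metis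

lemma integrable_growth:
  assumes "finite_measure m" "sets m = sets borel" "integrable m (norm_pow l)"
    "g \<in> borel_measurable borel" and g: "\<And>x. \<bar>g x\<bar> \<le> K * (1 + norm_pow l x)"
  shows "integrable m (g :: 'a::euclidean_space \<Rightarrow> real)"
proof (rule Bochner_Integration.integrable_bound)
  interpret finite_measure m by fact
  show "integrable m (\<lambda>x. K * (1 + norm_pow l x))"
    using assms by simp
  show "g \<in> borel_measurable m"
    using assms by (simp cong: measurable_cong_sets)
  show "AE x in m. norm (g x) \<le> norm (K * (1 + norm_pow l x))"
    using g by (intro AE_I2) (simp add: order_trans[OF _ abs_ge_self])
qed

lemma prob_moment_integrable:
  assumes "m \<in> prob_moment l" "g \<in> borel_measurable borel" "\<And>x. \<bar>g x\<bar> \<le> K * (1 + norm_pow l x)"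
  shows "integrable m g"
  using integrable_growth[of m l g K] assms by (simp add: prob_momentD)

lemma average_measure_prob_moment:
  fixes M :: "nat \<Rightarrow> 'a::euclidean_space measure"
  assumes "\<And>i. i \<in> {1..N} \<Longrightarrow> M i \<in> prob_moment l" "0 < N"
  shows "average_measure N M \<in> prob_moment l"
proof -
  have eq: "average_measure N M = weighted_sum_measure {1..N} (\<lambda>_. 1 / real N) M"
    using assms by (intro average_measure_eq) (auto dest: prob_momentD)
  have "finite_measure (average_measure N M)"
    unfolding eq using assms by (intro finite_weighted_sum_measure) (auto dest: prob_momentD)
  then interpret finite_measure "average_measure N M" .
  have "measure (average_measure N M) UNIV = (\<Sum>i=1..N. 1 / real N * measure (M i) UNIV)"
    unfolding eq using assms by (intro measure_weighted_sum_measure) (auto dest: prob_momentD)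
  also have "\<dots> = (\<Sum>i=1..N. 1 / real N)"
    by (intro sum.cong refl) (simp add: measure_prob_moment_UNIV[OF assms(1)])
  also have "\<dots> = 1" using assms by simp
  finally have "prob_space (average_measure N M)"
    by (intro prob_spaceI) (metis eq space_weighted_sum_measure emeasure_eq_measure ennreal_1)
  moreover have "integrable (average_measure N M) (norm_pow l)"
    unfolding eq using assms by (intro integrable_weighted_sum_measure) (auto dest: prob_momentD)
  ultimately show ?thesis
    by (simp add: prob_moment_def eq)
qed

lemma integral_average_measure:
  fixes M :: "nat \<Rightarrow> 'a::euclidean_space measure"
  assumes "\<And>i. i \<in> {1..N} \<Longrightarrow> M i \<in> prob_moment l"
    "g \<in> borel_measurable borel" "\<And>x. \<bar>g x\<bar> \<le> K * (1 + norm_pow l x)"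
  shows "(LINT x|average_measure N M. g x) = (\<Sum>i=1..N. LINT x|M i. g x) / real N"
proof -
  have eq: "average_measure N M = weighted_sum_measure {1..N} (\<lambda>_. 1 / real N) M"
    using assms by (intro average_measure_eq) (auto dest: prob_momentD)
  show ?thesis
    unfolding eq using assms prob_moment_integrable[OF _ assms(2,3)]
    by (subst integral_weighted_sum_measure) (auto dest: prob_momentD simp: sum_divide_distrib)
qed

lemma measure_average_measure:
  fixes M :: "nat \<Rightarrow> 'a::euclidean_space measure"
  assumes "\<And>i. i \<in> {1..N} \<Longrightarrow> M i \<in> prob_moment l" "A \<in> sets borel"
  shows "measure (average_measure N M) A = (\<Sum>i=1..N. measure (M i) A) / real N"
proof -
  have eq: "average_measure N M = weighted_sum_measure {1..N} (\<lambda>_. 1 / real N) M"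
    using assms by (intro average_measure_eq) (auto dest: prob_momentD)
  show ?thesis
    unfolding eq using assms
    by (subst measure_weighted_sum_measure) (auto dest: prob_momentD simp: sum_divide_distrib)
qed

lemma return_prob_moment: "return borel x \<in> prob_moment l"
  by (auto simp: prob_moment_def prob_space_return nn_integral_return intro!: integrableI_bounded)

context
  fixes l e :: real and m n :: "'a::euclidean_space measure"
  assumes m: "m \<in> prob_moment l" and n: "n \<in> prob_moment l" and e: "0 \<le> e" "e \<le> 1"
begin

private lemma mix_eq: "mix_measure e m n = weighted_sum_measure UNIV
    (\<lambda>b. if b then e else 1 - e) (\<lambda>b. if b then n else m)"
  using prob_momentD[OF m] prob_momentD[OF n] e by (intro mix_measure_eq) auto

lemma measure_mix_measure:
  "A \<in> sets borel \<Longrightarrow> measure (mix_measure e m n) A = (1 - e) * measure m A + e * measure n A"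
  unfolding mix_eq using prob_momentD[OF m] prob_momentD[OF n] e
  by (subst measure_weighted_sum_measure) (auto simp: sum_bool)

lemma integral_mix_measure:
  assumes "g \<in> borel_measurable borel" "\<And>x. \<bar>g x\<bar> \<le> K * (1 + norm_pow l x)"
  shows "(LINT x|mix_measure e m n. g x) = (1 - e) * (LINT x|m. g x) + e * (LINT x|n. g x)"
  unfolding mix_eq
  using prob_momentD[OF m] prob_momentD[OF n] e
    prob_moment_integrable[OF m assms] prob_moment_integrable[OF n assms] assms
  by (subst integral_weighted_sum_measure) (auto simp: sum_bool)

lemma mix_measure_prob_moment: "mix_measure e m n \<in> prob_moment l"
proof -
  have "finite_measure (mix_measure e m n)"
    unfolding mix_eq using prob_momentD[OF m] prob_momentD[OF n]
    by (intro finite_weighted_sum_measure) auto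
  then interpret finite_measure "mix_measure e m n" .
  have "measure (mix_measure e m n) UNIV = 1"
    using m n by (simp add: measure_mix_measure measure_prob_moment_UNIV)
  then have "prob_space (mix_measure e m n)"
    by (intro prob_spaceI) (metis mix_eq space_weighted_sum_measure emeasure_eq_measure ennreal_1)
  moreover have "integrable (mix_measure e m n) (norm_pow l)"
    unfolding mix_eq using e prob_momentD[OF m] prob_momentD[OF n]
    by (intro integrable_weighted_sum_measure) auto
  ultimately show ?thesis
    by (simp add: prob_moment_def mix_eq)
qed

end

lemma prob_moment_eqI:
  assumes "m \<in> prob_moment l" "n \<in> prob_moment l"
    "\<And>A. A \<in> sets borel \<Longrightarrow> measure m A = measure n A"
  shows "m = n"
proof (rule measure_eqI)
  show "sets m = sets n" using assms by (simp add: prob_momentD)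
  interpret m: prob_space m using assms by (simp add: prob_momentD)
  interpret n: prob_space n using assms by (simp add: prob_momentD)
  fix A assume "A \<in> sets m"
  then show "emeasure m A = emeasure n A"
    using assms by (simp add: m.emeasure_eq_measure n.emeasure_eq_measure prob_momentD)
qed

section \<open>Signed measures\<close>

lemma signed_measure_empty: "signed_measure \<tau> \<Longrightarrow> \<tau> {} = 0"
  by (simp add: signed_measure_def)

lemma signed_measure_sums:
  "signed_measure \<tau> \<Longrightarrow> range A \<subseteq> sets borel \<Longrightarrow> disjoint_family A \<Longrightarrow>
     (\<lambda>n. \<tau> (A n)) sums \<tau> (\<Union>n. A n)" for A :: "nat \<Rightarrow> _"
  by (simp add: signed_measure_def)

lemma signed_measure_Un:
  assumes "signed_measure \<tau>" "A \<in> sets borel" "B \<in> sets borel" "A \<inter> B = {}"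
  shows "\<tau> (A \<union> B) = \<tau> A + \<tau> B"
proof -
  have "(\<lambda>n. \<tau> (binaryset A B n)) sums \<tau> (\<Union>n. binaryset A B n)"
    using assms by (intro signed_measure_sums) (auto simp: range_binaryset_eq disjoint_family_on_def binaryset_def)
  moreover have "(\<lambda>n. \<tau> (binaryset A B n)) sums (\<tau> A + \<tau> B)"
    using signed_measure_empty[OF assms(1)] by (intro binaryset_sums)
  ultimately show ?thesis
    using sums_unique2 by (metis UN_binaryset_eq)
qed

lemma signed_measure_Diff:
  assumes "signed_measure \<tau>" "A \<in> sets borel" "B \<in> sets borel" "B \<subseteq> A"
  shows "\<tau> (A - B) = \<tau> A - \<tau> B"
  using signed_measure_Un[of \<tau> B "A - B"] assms by (simp add: Un_absorb1)

lemma signed_measure_uminus: "signed_measure \<tau> \<Longrightarrow> signed_measure (\<lambda>A. - \<tau> A)"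
  by (auto simp: signed_measure_def intro!: sums_minus)

text \<open>If the values were unbounded, one could split off from a set with unbounded values,
  again and again, a piece of value at least 1 leaving a remainder with unbounded values;
  the values of these disjoint pieces could not tend to 0.\<close>

lemma signed_measure_bounded:
  fixes \<tau> :: "'a::topological_space set \<Rightarrow> real"
  assumes \<tau>: "signed_measure \<tau>"
  obtains K where "\<And>A. A \<in> sets borel \<Longrightarrow> \<bar>\<tau> A\<bar> \<le> K"
proof -
  define bad where "bad E \<longleftrightarrow> E \<in> sets borel \<and> (\<forall>K. \<exists>B\<in>sets borel. B \<subseteq> E \<and> \<bar>\<tau> B\<bar> > K)" for E
  have split: "\<exists>B. bad B \<and> B \<subseteq> E \<and> \<bar>\<tau> (E - B)\<bar> \<ge> 1" if E: "bad E" for E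
  proof -
    \<comment> \<open>The threshold leaves a value of at least 1 whichever piece is split off:
      \<open>\<tau> B\<close> itself, or
      \<open>\<tau> (E - B) = \<tau> E - \<tau> B\<close>.\<close>
    obtain B where B: "B \<in> sets borel" "B \<subseteq> E" "\<bar>\<tau> B\<bar> > 1 + \<bar>\<tau> E\<bar>"
      using E by (auto simp: bad_def)
    have d: "\<tau> (E - B) = \<tau> E - \<tau> B"
      using \<tau> B E by (intro signed_measure_Diff) (auto simp: bad_def)
    have "bad B \<or> bad (E - B)"
    proof (rule ccontr)
      assume "\<not> ?thesis"
      moreover have "E - B \<in> sets borel"
        using B E by (auto simp: bad_def)
      ultimately obtain K1 K2 where K1: "\<And>C. C \<in> sets borel \<Longrightarrow> C \<subseteq> B \<Longrightarrow> \<bar>\<tau> C\<bar> \<le> K1"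
        and K2: "\<And>C. C \<in> sets borel \<Longrightarrow> C \<subseteq> E - B \<Longrightarrow> \<bar>\<tau> C\<bar> \<le> K2"
        unfolding bad_def using B(1) not_less by metis
      obtain C where C: "C \<in> sets borel" "C \<subseteq> E" "\<bar>\<tau> C\<bar> > K1 + K2"
        using E by (auto simp: bad_def)
      have "\<tau> (C \<inter> B \<union> (C - B)) = \<tau> (C \<inter> B) + \<tau> (C - B)"
        using B C by (intro signed_measure_Un[OF \<tau>]) auto
      moreover have "\<bar>\<tau> (C \<inter> B)\<bar> \<le> K1" "\<bar>\<tau> (C - B)\<bar> \<le> K2"
        using B C by (auto intro!: K1 K2)
      ultimately show False using C(3) Int_Diff_Un[of C B] by simp
    qed
    then show ?thesis
    proof
      assume "bad B"
      then show ?thesis using B d by (intro exI[of _ B]) auto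
    next
      assume "bad (E - B)"
      moreover have "E - (E - B) = B" using B by auto
      ultimately show ?thesis using B by (intro exI[of _ "E - B"]) auto
    qed
  qed
  have "\<not> bad UNIV"
  proof
    assume "bad UNIV"
    obtain f where f: "\<And>E. bad E \<Longrightarrow> bad (f E) \<and> f E \<subseteq> E \<and> \<bar>\<tau> (E - f E)\<bar> \<ge> 1"
      using split by metis
    define E where "E n = (f ^^ n) UNIV" for n
    have E1: "bad (E n)" for n
      by (induction n) (use \<open>bad UNIV\<close> f in \<open>auto simp: E_def\<close>)
    moreover have "E (Suc n) \<subseteq> E n \<and> \<bar>\<tau> (E n - E (Suc n))\<bar> \<ge> 1" for n
      using f[OF E1[of n]] by (simp add: E_def)
    ultimately have E: "\<And>n. bad (E n)" "\<And>n. E (Suc n) \<subseteq> E n \<and> \<bar>\<tau> (E n - E (Suc n))\<bar> \<ge> 1"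
      by blast+
    have mono: "E n \<subseteq> E k" if "k \<le> n" for k n
      by (rule lift_Suc_antimono_le[of E, OF _ that]) (use E(2) in blast)
    have "disjoint_family (\<lambda>n. E n - E (Suc n))"
      unfolding disjoint_family_on_def
    proof safe
      fix i j x assume *: "i \<noteq> j" "x \<in> E i" "x \<notin> E (Suc i)" "x \<in> E j" "x \<notin> E (Suc j)"
      then show "x \<in> {}"
        using mono[of "Suc i" j] mono[of "Suc j" i] by (meson Suc_leI linorder_neqE_nat subsetD)
    qed
    moreover have "range (\<lambda>n. E n - E (Suc n)) \<subseteq> sets borel"
      using E(1) by (auto simp: bad_def)
    ultimately have "summable (\<lambda>n. \<tau> (E n - E (Suc n)))"
      using signed_measure_sums[OF \<tau>] sums_summable by blast
    then have "(\<lambda>n. \<bar>\<tau> (E n - E (Suc n))\<bar>) \<longlonglongrightarrow> 0"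
      by (intro tendsto_rabs_zero summable_LIMSEQ_zero)
    then have "(1::real) \<le> 0"
      by (rule tendsto_lowerbound) (use E(2) in auto)
    then show False by simp
  qed
  then show ?thesis
    using that unfolding bad_def by (metis not_less borel_open open_UNIV subset_UNIV)
qed

section \<open>Positive variation and Jordan decomposition\<close>

context
  fixes \<tau> :: "'a::topological_space set \<Rightarrow> real"
  assumes \<tau>: "signed_measure \<tau>"
begin

text \<open>The set function underlying \<open>pos_variation\<close>, kept as a real function so
  that the supremum can be manipulated before it is known to be a measure.\<close>

definition "posvar A = (SUP B\<in>{B \<in> sets borel. B \<subseteq> A}. \<tau> B)"

private lemma bdd: "bdd_above (\<tau> ` {B \<in> sets borel. B \<subseteq> A})"
proof -
  obtain K where K: "\<And>A. A \<in> sets borel \<Longrightarrow> \<bar>\<tau> A\<bar> \<le> K"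
    using signed_measure_bounded[OF \<tau>] by blast
  show ?thesis by (rule bdd_aboveI2[where M=K]) (use K in fastforce)
qed

lemma posvar_upper: "B \<in> sets borel \<Longrightarrow> B \<subseteq> A \<Longrightarrow> \<tau> B \<le> posvar A"
  unfolding posvar_def using bdd by (intro cSUP_upper) auto

lemma posvar_least: "(\<And>B. B \<in> sets borel \<Longrightarrow> B \<subseteq> A \<Longrightarrow> \<tau> B \<le> K) \<Longrightarrow> posvar A \<le> K"
  unfolding posvar_def by (intro cSUP_least) auto

lemma posvar_nonneg: "0 \<le> posvar A"
  using posvar_upper[of "{}" A] signed_measure_empty[OF \<tau>] by simp

text \<open>Superadditivity: subsets of disjoint pieces can be united, and \<tau> adds up over them.
  The two suprema are removed one after the other, the remaining terms being moved to the right-hand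
  side each time.\<close>

lemma posvar_sum_le:
  fixes A :: "nat \<Rightarrow> 'a set"
  assumes A: "range A \<subseteq> sets borel" "disjoint_family A"
  shows "(\<Sum>i<n. posvar (A i)) \<le> posvar (\<Union>i<n. A i)"
proof (induction n)
  case (Suc n)
  have "posvar (A n) \<le> posvar (\<Union>i<Suc n. A i) - posvar (\<Union>i<n. A i)"
  proof (rule posvar_least)
    fix B assume B: "B \<in> sets borel" "B \<subseteq> A n"
    have "posvar (\<Union>i<n. A i) \<le> posvar (\<Union>i<Suc n. A i) - \<tau> B"
    proof (rule posvar_least)
      fix C assume C: "C \<in> sets borel" "C \<subseteq> (\<Union>i<n. A i)"
      have "A n \<inter> A i = {}" if "i < n" for i
        using A(2) that by (auto simp: disjoint_family_on_def)
      then have "C \<inter> B = {}" using B C by blast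
      then have "\<tau> C + \<tau> B = \<tau> (C \<union> B)"
        using signed_measure_Un[OF \<tau>] B C by simp
      also have "\<dots> \<le> posvar (\<Union>i<Suc n. A i)"
        using B C by (intro posvar_upper) (auto simp: lessThan_Suc)
      finally show "\<tau> C \<le> posvar (\<Union>i<Suc n. A i) - \<tau> B" by simp
    qed
    then show "\<tau> B \<le> posvar (\<Union>i<Suc n. A i) - posvar (\<Union>i<n. A i)" by simp
  qed
  then show ?case using Suc by simp
qed (simp add: posvar_nonneg)

lemma posvar_mono: "A \<subseteq> B \<Longrightarrow> posvar A \<le> posvar B"
  by (intro posvar_least posvar_upper) auto

lemma pos_variation_eq: "pos_variation \<tau> = measure_of UNIV (sets borel) (\<lambda>A. ennreal (posvar A))"
  by (simp add: pos_variation_def borel_measure_def posvar_def)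

lemma sets_pos_variation: "sets (pos_variation \<tau>) = sets borel"
  by (simp add: pos_variation_eq sets.sigma_sets_eq[of borel, simplified space_borel])

text \<open>One inequality is superadditivity together with monotonicity. For the other, a
  competitor \<open>B\<close> inside the union is cut into the pieces \<open>B \<inter> F i\<close>,
  whose values are bounded one by one. Boundedness of \<tau> makes all suprema finite, so the series
  is handled in the reals.\<close>

lemma emeasure_pos_variation:
  assumes "A \<in> sets borel"
  shows "emeasure (pos_variation \<tau>) A = ennreal (posvar A)"
proof (rule emeasure_measure_of[OF pos_variation_eq])
  have "posvar {} = 0"
    using signed_measure_empty[OF \<tau>] posvar_nonneg by (intro antisym posvar_least) auto
  then show "positive (sets (pos_variation \<tau>)) (\<lambda>A. ennreal (posvar A))"
    by (simp add: positive_def)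
  show "countably_additive (sets (pos_variation \<tau>)) (\<lambda>A. ennreal (posvar A))"
  proof (rule countably_additiveI)
    fix F :: "nat \<Rightarrow> 'a set"
    assume "range F \<subseteq> sets (pos_variation \<tau>)" and d: "disjoint_family F"
    then have F: "range F \<subseteq> sets borel" by (simp add: sets_pos_variation)
    have part: "(\<Sum>i<n. posvar (F i)) \<le> posvar (\<Union>i. F i)" for n
      using posvar_sum_le[OF F d, of n] posvar_mono[of "\<Union>i<n. F i" "\<Union>i. F i"] by fastforce
    have s: "summable (\<lambda>i. posvar (F i))"
      using part by (intro summableI_nonneg_bounded posvar_nonneg)
    have "posvar (\<Union>i. F i) \<le> (\<Sum>i. posvar (F i))"
    proof (rule posvar_least)
      fix B assume B: "B \<in> sets borel" "B \<subseteq> (\<Union>i. F i)"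
      have "(\<lambda>i. \<tau> (B \<inter> F i)) sums \<tau> (\<Union>i. B \<inter> F i)"
        using F d B by (intro signed_measure_sums[OF \<tau>]) (auto simp: disjoint_family_on_def)
      moreover have "(\<Union>i. B \<inter> F i) = B" using B by auto
      ultimately have "(\<lambda>i. \<tau> (B \<inter> F i)) sums \<tau> B" by simp
      show "\<tau> B \<le> (\<Sum>i. posvar (F i))"
        by (rule sums_le[OF _ \<open>_ sums \<tau> B\<close> summable_sums[OF s]]) (use F B in \<open>auto intro!: posvar_upper\<close>)
    qed
    moreover have "(\<Sum>i. posvar (F i)) \<le> posvar (\<Union>i. F i)"
      using part by (intro suminf_le_const s)
    ultimately have eq: "(\<Sum>i. posvar (F i)) = posvar (\<Union>i. F i)" by (intro antisym)
    show "(\<Sum>i. ennreal (posvar (F i))) = ennreal (posvar (\<Union>i. F i))"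
      unfolding eq[symmetric] by (intro suminf_ennreal2 posvar_nonneg s)
  qed
qed (use assms sets_pos_variation in auto)

lemma finite_pos_variation: "finite_measure (pos_variation \<tau>)"
  by (rule finite_measureI) (simp add: emeasure_pos_variation pos_variation_eq[THEN arg_cong[of _ _ space]])

lemma measure_pos_variation: "A \<in> sets borel \<Longrightarrow> measure (pos_variation \<tau>) A = posvar A"
  using emeasure_pos_variation[of A] posvar_nonneg by (intro measure_eq_emeasure_eq_ennreal)

end

lemma neg_variation:
  assumes "signed_measure \<tau>"
  shows "sets (neg_variation \<tau>) = sets borel" "finite_measure (neg_variation \<tau>)"
  unfolding neg_variation_def using signed_measure_uminus[OF assms]
  by (simp_all add: sets_pos_variation finite_pos_variation)

text \<open>Complementation inside \<open>A\<close> replaces \<open>\<tau> B\<close> by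
  \<open>\<tau> A - \<tau> (A - B)\<close> and so turns the supremum of \<tau> into that of its
  negative, shifted by \<open>\<tau> A\<close>.\<close>

lemma jordan_decomposition:
  assumes \<tau>: "signed_measure \<tau>" and A: "A \<in> sets borel"
  shows "measure (pos_variation \<tau>) A - measure (neg_variation \<tau>) A = \<tau> A"
proof -
  note n = signed_measure_uminus[OF \<tau>]
  have "posvar \<tau> A \<le> posvar (\<lambda>A. - \<tau> A) A + \<tau> A"
    using posvar_upper[OF n, of "A - _" A] signed_measure_Diff[OF \<tau> A] A
    by (intro posvar_least[OF \<tau>]) (fastforce simp: algebra_simps)
  moreover have "posvar (\<lambda>A. - \<tau> A) A \<le> posvar \<tau> A - \<tau> A"
    using posvar_upper[OF \<tau>, of "A - _" A] signed_measure_Diff[OF \<tau> A] A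
    by (intro posvar_least[OF n]) (fastforce simp: algebra_simps)
  ultimately show ?thesis
    unfolding neg_variation_def using measure_pos_variation[OF \<tau> A] measure_pos_variation[OF n A] by simp
qed

section \<open>Signed measures given as differences of finite measures\<close>

lemma signed_measure_difference:
  fixes \<tau> :: "'a::topological_space set \<Rightarrow> real"
  assumes "finite_measure P" "finite_measure Q" "sets P = sets borel" "sets Q = sets borel"
    and \<tau>: "\<forall>A\<in>sets borel. \<tau> A = measure P A - measure Q A"
  shows "signed_measure \<tau>"
  unfolding signed_measure_def
proof (intro conjI allI impI)
  interpret P: finite_measure P by fact
  interpret Q: finite_measure Q by fact
  show "\<tau> {} = 0" using \<tau> by simp
  fix A :: "nat \<Rightarrow> 'a set"
  assume A: "range A \<subseteq> sets borel" "disjoint_family A"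
  have "(\<lambda>n. measure P (A n)) sums measure P (\<Union>n. A n)"
    "(\<lambda>n. measure Q (A n)) sums measure Q (\<Union>n. A n)"
    using A assms by (auto intro!: P.finite_measure_UNION Q.finite_measure_UNION)
  then have "(\<lambda>n. measure P (A n) - measure Q (A n)) sums (measure P (\<Union>n. A n) - measure Q (\<Union>n. A n))"
    by (rule sums_diff)
  moreover have "\<tau> (A n) = measure P (A n) - measure Q (A n)" for n
    using A by (intro \<tau>[rule_format]) auto
  moreover have "\<tau> (\<Union>n. A n) = measure P (\<Union>n. A n) - measure Q (\<Union>n. A n)"
    using A by (intro \<tau>[rule_format]) auto
  ultimately show "(\<lambda>n. \<tau> (A n)) sums \<tau> (\<Union>n. A n)" by simp
qed

context
  fixes P Q :: "'a::topological_space measure" and \<tau> :: "'a set \<Rightarrow> real"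
  assumes P: "finite_measure P" "sets P = sets borel"
    and Q: "finite_measure Q" "sets Q = sets borel"
    and \<tau>: "\<forall>A\<in>sets borel. \<tau> A = measure P A - measure Q A"
begin

private lemma sm: "signed_measure \<tau>"
  using signed_measure_difference[OF P(1) Q(1) P(2) Q(2) \<tau>] .

text \<open>Minimality of the Jordan decomposition: for \<open>B\<close> inside \<open>A\<close>,
  \<open>\<tau> B \<le> measure P B \<le> measure P A\<close>. With its counterpart for
  \<open>Q\<close> it lets integrability pass from \<open>P\<close> and \<open>Q\<close> to the
  variations.\<close>

lemma pos_variation_le:
  "\<forall>A\<in>sets borel. emeasure (pos_variation \<tau>) A \<le> emeasure P A"
proof
  fix A :: "'a set" assume A: "A \<in> sets borel"
  interpret P: finite_measure P by (fact P)
  have "posvar \<tau> A \<le> measure P A"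
  proof (rule posvar_least[OF sm])
    fix B assume B: "B \<in> sets borel" "B \<subseteq> A"
    have "\<tau> B \<le> measure P B" using \<tau> B(1) by simp
    also have "\<dots> \<le> measure P A" using B A P by (intro P.finite_measure_mono) auto
    finally show "\<tau> B \<le> measure P A" .
  qed
  then show "emeasure (pos_variation \<tau>) A \<le> emeasure P A"
    using emeasure_pos_variation[OF sm A] by (simp add: P.emeasure_eq_measure ennreal_leI)
qed

lemma neg_variation_le:
  "\<forall>A\<in>sets borel. emeasure (neg_variation \<tau>) A \<le> emeasure Q A"
proof
  fix A :: "'a set" assume A: "A \<in> sets borel"
  interpret Q: finite_measure Q by (fact Q)
  have "posvar (\<lambda>A. - \<tau> A) A \<le> measure Q A"
  proof (rule posvar_least[OF signed_measure_uminus[OF sm]])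
    fix B assume B: "B \<in> sets borel" "B \<subseteq> A"
    have "- \<tau> B \<le> measure Q B" using \<tau> B(1) by simp
    also have "\<dots> \<le> measure Q A" using B A Q by (intro Q.finite_measure_mono) auto
    finally show "- \<tau> B \<le> measure Q A" .
  qed
  then show "emeasure (neg_variation \<tau>) A \<le> emeasure Q A"
    unfolding neg_variation_def
    using emeasure_pos_variation[OF signed_measure_uminus[OF sm] A]
    by (simp add: Q.emeasure_eq_measure ennreal_leI)
qed

private lemma nn_integral_le:
  assumes "sets R = sets borel" "sets S = sets borel"
    "\<forall>A\<in>sets borel. emeasure R A \<le> emeasure S A"
  shows "(\<integral>\<^sup>+x. g x \<partial>R) \<le> (\<integral>\<^sup>+x. g x \<partial>(S :: 'a measure))"
  using assms by (intro nn_integral_mono_measure) (auto simp: le_fun_def le_measure)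

private lemma integrable_le:
  assumes "sets R = sets borel" "sets S = sets borel"
    "\<forall>A\<in>sets borel. emeasure R A \<le> emeasure S A" "integrable S g"
  shows "integrable R (g :: 'a \<Rightarrow> real)"
proof (rule integrableI_bounded)
  show "g \<in> borel_measurable R"
    using borel_measurable_integrable[OF assms(4)] assms(1,2) by (simp cong: measurable_cong_sets)
  have "(\<integral>\<^sup>+x. ennreal (norm (g x)) \<partial>R) \<le> (\<integral>\<^sup>+x. ennreal (norm (g x)) \<partial>S)"
    using assms by (intro nn_integral_le) auto
  also have "\<dots> < \<infinity>" using assms(4) by (simp add: integrable_iff_bounded)
  finally show "(\<integral>\<^sup>+x. ennreal (norm (g x)) \<partial>R) < \<infinity>" .
qed

lemma integrable_variation:
  assumes "integrable P g" "integrable Q (g :: 'a \<Rightarrow> real)"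
  shows "integrable (pos_variation \<tau>) g" "integrable (neg_variation \<tau>) g"
  using integrable_le[of _ P g] integrable_le[of _ Q g] assms P Q sets_pos_variation[OF sm]
    neg_variation(1)[OF sm] pos_variation_le neg_variation_le by auto

text \<open>The signed integral does not depend on the decomposition. As set functions, the positive
  variation plus \<open>Q\<close> equals \<open>P\<close> plus the negative variation; both sides
  are measures, so they may be integrated, and the terms are rearranged afterwards.\<close>

lemma signed_integral_eq:
  assumes g: "integrable P g" "integrable Q g"
  shows "signed_integral \<tau> g = (LINT x|P. g x) - (LINT x|Q. g x)"
proof -
  let ?p = "pos_variation \<tau>" and ?n = "neg_variation \<tau>"
  note p = sets_pos_variation[OF sm] finite_pos_variation[OF sm]
  note n = neg_variation[OF sm]
  note ig = integrable_variation[OF g]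
  have gm: "g \<in> borel_measurable borel"
    using borel_measurable_integrable[OF g(1)] P by (simp cong: measurable_cong_sets)
  have "weighted_sum_measure UNIV (\<lambda>_. 1) (\<lambda>b. if b then ?p else Q)
      = weighted_sum_measure UNIV (\<lambda>_. 1) (\<lambda>b. if b then P else ?n)"
  proof (rule measure_eqI)
    fix A assume "A \<in> sets (weighted_sum_measure UNIV (\<lambda>_. 1) (\<lambda>b. if b then ?p else Q))"
    then have A: "A \<in> sets borel" by simp
    interpret P: finite_measure P by (fact P)
    interpret Q: finite_measure Q by (fact Q)
    interpret p: finite_measure ?p by (fact p)
    interpret n: finite_measure ?n by (fact n)
    have "measure ?p A + measure Q A = measure P A + measure ?n A"
      using jordan_decomposition[OF sm A] \<tau> A by simp
    then have "emeasure ?p A + emeasure Q A = emeasure P A + emeasure ?n A"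
      by (simp add: P.emeasure_eq_measure Q.emeasure_eq_measure p.emeasure_eq_measure
        n.emeasure_eq_measure flip: ennreal_plus)
    then show "emeasure (weighted_sum_measure UNIV (\<lambda>_. 1) (\<lambda>b. if b then ?p else Q)) A
      = emeasure (weighted_sum_measure UNIV (\<lambda>_. 1) (\<lambda>b. if b then P else ?n)) A"
      using P Q p n A
      by (subst (1 2) emeasure_weighted_sum_measure) (auto simp: sum_bool add_ac)
  qed simp
  then have "(LINT x|weighted_sum_measure UNIV (\<lambda>_. 1) (\<lambda>b. if b then ?p else Q). g x)
      = (LINT x|weighted_sum_measure UNIV (\<lambda>_. 1) (\<lambda>b. if b then P else ?n). g x)"
    by simp
  moreover have "(LINT x|weighted_sum_measure UNIV (\<lambda>_. 1) (\<lambda>b. if b then ?p else Q). g x)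
      = (LINT x|?p. g x) + (LINT x|Q. g x)"
    using P Q p n g ig gm by (subst integral_weighted_sum_measure) (auto simp: sum_bool)
  moreover have "(LINT x|weighted_sum_measure UNIV (\<lambda>_. 1) (\<lambda>b. if b then P else ?n). g x)
      = (LINT x|P. g x) + (LINT x|?n. g x)"
    using P Q p n g ig gm by (subst integral_weighted_sum_measure) (auto simp: sum_bool)
  ultimately show ?thesis
    by (simp add: signed_integral_def)
qed

end

lemma total_variation_eq:
  assumes "signed_measure \<tau>"
  shows "total_variation \<tau> = weighted_sum_measure UNIV (\<lambda>_. 1)
    (\<lambda>b. if b then pos_variation \<tau> else neg_variation \<tau>)"
  unfolding total_variation_def
  using sets_pos_variation[OF assms] finite_pos_variation[OF assms] neg_variation[OF assms]
  by (intro borel_measure_eqI finite_weighted_sum_measure)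
     (auto simp: measure_weighted_sum_measure sum_bool)

lemma signed_momentD:
  assumes "\<tau> \<in> signed_moment l"
  shows "signed_measure \<tau>" "integrable (pos_variation \<tau>) (norm_pow l)"
    "integrable (neg_variation \<tau>) (norm_pow l)"
proof -
  show \<tau>: "signed_measure \<tau>" using assms by (simp add: signed_moment_def)
  note p = sets_pos_variation[OF \<tau>] neg_variation(1)[OF \<tau>]
  have "(\<integral>\<^sup>+x. ennreal (norm (norm_pow l x)) \<partial>total_variation \<tau>) < \<infinity>"
    using assms by (simp add: signed_moment_def integrable_iff_bounded)
  then have *: "(\<integral>\<^sup>+x. ennreal (norm_pow l x) \<partial>neg_variation \<tau>)
      + (\<integral>\<^sup>+x. ennreal (norm_pow l x) \<partial>pos_variation \<tau>) < \<infinity>"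
    using p unfolding total_variation_eq[OF \<tau>]
    by (subst (asm) nn_integral_weighted_sum_measure) (auto simp: sum_bool)
  then show "integrable (pos_variation \<tau>) (norm_pow l)" "integrable (neg_variation \<tau>) (norm_pow l)"
    using p by (auto intro!: integrableI_bounded simp: ennreal_add_eq_top less_top cong: measurable_cong_sets)
qed

context
  fixes P Q :: "'a::euclidean_space measure" and \<tau> :: "'a set \<Rightarrow> real"
  assumes P: "finite_measure P" "sets P = sets borel"
    and Q: "finite_measure Q" "sets Q = sets borel"
    and \<tau>: "\<forall>A\<in>sets borel. \<tau> A = measure P A - measure Q A"
begin

private lemma sm2: "signed_measure \<tau>"
  using signed_measure_difference[OF P(1) Q(1) P(2) Q(2) \<tau>] .

text \<open>The two variations are dominated by \<open>P\<close> and \<open>Q\<close>; cancellation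
  between \<open>P\<close> and \<open>Q\<close> is given away.\<close>

lemma integral_total_variation_le:
  fixes g :: "'a \<Rightarrow> real"
  assumes "integrable P g" "integrable Q g" and g: "\<And>x. 0 \<le> g x"
  shows "(LINT x|total_variation \<tau>. g x) \<le> (LINT x|P. g x) + (LINT x|Q. g x)"
proof -
  note ig = integrable_variation[OF P Q \<tau> assms(1,2), simplified]
  have gm: "g \<in> borel_measurable borel"
    using borel_measurable_integrable[OF assms(1)] P by (simp cong: measurable_cong_sets)
  have "(LINT x|total_variation \<tau>. g x) = (LINT x|pos_variation \<tau>. g x) + (LINT x|neg_variation \<tau>. g x)"
    unfolding total_variation_eq[OF sm2]
    using sets_pos_variation[OF sm2] neg_variation(1)[OF sm2] gm ig
    by (subst integral_weighted_sum_measure) (auto simp: sum_bool)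
  moreover have le: "(LINT x|R. g x) \<le> (LINT x|S. g x)"
    if "sets R = sets borel" "sets S = sets borel"
    "\<forall>A\<in>sets borel. emeasure R A \<le> emeasure S A" "integrable S g" "integrable R g"
    for R S :: "'a measure"
  proof -
    have "(\<integral>\<^sup>+x. g x \<partial>R) \<le> (\<integral>\<^sup>+x. g x \<partial>S)"
      using that by (intro nn_integral_mono_measure) (auto simp: le_fun_def le_measure)
    then have "ennreal (LINT x|R. g x) \<le> ennreal (LINT x|S. g x)"
      using that g by (simp add: nn_integral_eq_integral)
    then show ?thesis using g by (simp add: integral_nonneg_AE)
  qed
  ultimately show ?thesis
    using le[OF sets_pos_variation[OF sm2] P(2) pos_variation_le[OF P Q \<tau>] assms(1) ig(1)]
      le[OF neg_variation(1)[OF sm2] Q(2) neg_variation_le[OF P Q \<tau>] assms(2) ig(2)] by simp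
qed

lemma tv_norm_le: "tv_norm \<tau> \<le> measure P UNIV + measure Q UNIV"
proof -
  interpret P: finite_measure P by (fact P)
  interpret Q: finite_measure Q by (fact Q)
  have "space P = UNIV" "space Q = UNIV" "space (total_variation \<tau>) = UNIV"
    using P Q by (auto dest: sets_eq_imp_space_eq simp: total_variation_eq[OF sm2])
  then show ?thesis
    using integral_total_variation_le[of "\<lambda>_. 1::real", OF P.integrable_const Q.integrable_const]
    by (simp add: tv_norm_def)
qed

text \<open>The norm is a supremum of a one-sided quantity, so it is tested with
  \<open>g / K\<close> and with \<open>- g / K\<close>. A \<open>SUP\<close> of reals bounds its
  members only over a set that is bounded above; integrability of the weight against
  \<open>P\<close> and \<open>Q\<close> provides that bound.\<close>

lemma weighted_norm_bound:
  assumes "integrable P (norm_pow l)" "integrable Q (norm_pow l)" and g: "g \<in> borel_measurable borel"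
    and K: "0 \<le> K" "\<And>x. \<bar>g x\<bar> \<le> K * (1 + norm_pow l x)"
  shows "\<bar>(LINT x|P. g x) - (LINT x|Q. g x)\<bar> \<le> K * weighted_norm l \<tau>"
proof -
  interpret P: finite_measure P by (fact P)
  interpret Q: finite_measure Q by (fact Q)
  define F where "F = {f \<in> borel_measurable borel. \<forall>x::'a. \<bar>f x\<bar> \<le> 1 + norm_pow l x}"
  have int: "integrable P f" "integrable Q f" if "f \<in> F" for f
    using that by (auto simp: F_def intro!: integrable_growth[OF P assms(1), where K=1]
      integrable_growth[OF Q assms(2), where K=1])
  have eq: "signed_integral \<tau> f = (LINT x|P. f x) - (LINT x|Q. f x)" if "f \<in> F" for f
    using int[OF that] signed_integral_eq[OF P Q \<tau>] by blast
  have "bdd_above (signed_integral \<tau> ` F)"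
  proof (rule bdd_aboveI2)
    fix f assume f: "f \<in> F"
    have "(LINT x|P. f x) \<le> (LINT x|P. 1 + norm_pow l x)"
      using f int[OF f] assms by (intro integral_mono) (auto simp: F_def abs_le_iff)
    moreover have "- (LINT x|Q. f x) \<le> (LINT x|Q. 1 + norm_pow l x)"
      unfolding integral_minus[symmetric]
      using f int[OF f] assms by (intro integral_mono) (auto simp: F_def abs_le_iff)
    ultimately show "signed_integral \<tau> f \<le> (LINT x|P. 1 + norm_pow l x) + (LINT x|Q. 1 + norm_pow l x)"
      using eq[OF f] by simp
  qed
  then have up: "signed_integral \<tau> f \<le> weighted_norm l \<tau>" if "f \<in> F" for f
    unfolding weighted_norm_def using that by (intro cSUP_upper) (auto simp: F_def)
  show ?thesis
  proof (cases "K = 0")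
    case True
    then have "g = (\<lambda>x. 0)" using K by auto
    then show ?thesis using True by simp
  next
    case False
    then have "0 < K" using K by simp
    then have F: "(\<lambda>x. g x / K) \<in> F" "(\<lambda>x. - g x / K) \<in> F"
      using g K by (auto simp: F_def field_simps)
    have "((LINT x|P. g x) - (LINT x|Q. g x)) / K \<le> weighted_norm l \<tau>"
      using up[OF F(1)] unfolding eq[OF F(1)] by (simp add: diff_divide_distrib)
    moreover have "- ((LINT x|P. g x) - (LINT x|Q. g x)) / K \<le> weighted_norm l \<tau>"
      using up[OF F(2)] unfolding eq[OF F(2)] by (simp add: diff_divide_distrib)
    ultimately show ?thesis
      using \<open>0 < K\<close> by (simp add: pos_divide_le_eq abs_le_iff mult.commute)
  qed
qed

end

lemma signed_integral_measure_diff: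
  assumes m: "m \<in> prob_moment l" and n: "n \<in> prob_moment l"
    and g: "g \<in> borel_measurable borel" "\<And>x. \<bar>g x\<bar> \<le> K * (1 + norm_pow l x)"
  shows "signed_integral (measure_diff n m) g = (LINT x|n. g x) - (LINT x|m. g x)"
  using prob_momentD[OF m] prob_momentD[OF n] prob_moment_integrable[OF m g] prob_moment_integrable[OF n g]
  by (intro signed_integral_eq) (auto simp: measure_diff_def)

section \<open>Wasserstein distances\<close>

text \<open>Merges the two cases of \<open>wasserstein\<close>: for \<open>l = 0\<close> the outer
  exponent \<open>1 / max l 1\<close> is 1, so the truncated cost fits the general formula.\<close>

definition transport_cost :: "real \<Rightarrow> 'a::euclidean_space \<Rightarrow> 'a \<Rightarrow> real" where
  "transport_cost l x y = (if l = 0 then min 1 (norm (x - y)) else norm (x - y) powr l)"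

lemma transport_cost_nonneg [simp]: "0 \<le> transport_cost l x y"
  by (simp add: transport_cost_def)

lemma transport_cost_measurable [measurable]:
  "(\<lambda>z. transport_cost l (fst z) (snd z)) \<in> borel_measurable (borel :: ('a::euclidean_space \<times> 'a) measure)"
  unfolding transport_cost_def borel_prod[symmetric] by measurable

lemma transport_cost_le:
  assumes l: "0 \<le> l"
  shows "transport_cost l x y \<le> 2 powr l * (norm_pow l x + norm_pow l y)"
proof (cases "l = 0")
  case True
  then show ?thesis by (simp add: transport_cost_def norm_pow_def)
next
  case False
  then have "norm (x - y) powr l \<le> (2 * max (norm x) (norm y)) powr l"
    using l norm_triangle_ineq4[of x y] by (intro powr_mono2) auto
  also have "\<dots> = 2 powr l * max (norm x) (norm y) powr l"
    by (simp add: powr_mult)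
  also have "\<dots> \<le> 2 powr l * (norm x powr l + norm y powr l)"
    by (intro mult_left_mono) (auto simp: max_def)
  finally show ?thesis using False by (simp add: transport_cost_def norm_pow_def)
qed

lemma wasserstein_eq:
  "wasserstein l m n =
    (INF \<rho>\<in>couplings m n. (LINT z|\<rho>. transport_cost l (fst z) (snd z)) powr (1 / max l 1))"
proof -
  have "(LINT z|\<rho>. transport_cost 0 (fst z) (snd z)) powr 1 = (LINT z|\<rho>. transport_cost 0 (fst z) (snd z))"
    for \<rho> :: "('a \<times> 'a) measure"
    by (subst powr_one) (auto intro!: integral_nonneg_AE)
  then show ?thesis by (auto simp: wasserstein_def transport_cost_def)
qed

lemma wasserstein_le:
  assumes "\<rho> \<in> couplings m n"
  shows "wasserstein l m n \<le> (LINT z|\<rho>. transport_cost l (fst z) (snd z)) powr (1 / max l 1)"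
  unfolding wasserstein_eq using assms by (intro cINF_lower bdd_belowI2[where m=0]) auto

section \<open>Couplings of measures with close cell masses\<close>

text \<open>The part of a measure left over when a mass \<open>b k\<close> is taken, uniformly, from each cell.\<close>

definition leftover :: "'a measure \<Rightarrow> (nat \<Rightarrow> 'a set) \<Rightarrow> nat \<Rightarrow> (nat \<Rightarrow> real) \<Rightarrow> 'a \<Rightarrow> real" where
  "leftover m C K b x = 1 - (\<Sum>k<K. b k / measure m (C k) * indicator (C k) x)"

context
  fixes m :: "'a::euclidean_space measure" and C :: "nat \<Rightarrow> 'a set" and K :: nat and b :: "nat \<Rightarrow> real"
  assumes m: "prob_space m" "sets m = sets borel"
    and C: "\<And>k. k < K \<Longrightarrow> C k \<in> sets borel" "disjoint_family_on C {..<K}"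
    and b: "\<And>k. k < K \<Longrightarrow> 0 \<le> b k" "\<And>k. k < K \<Longrightarrow> b k \<le> measure m (C k)"
begin

lemma leftover_cell:
  assumes "k < K" "x \<in> C k"
  shows "leftover m C K b x = 1 - b k / measure m (C k)"
proof -
  have "(\<Sum>j<K. b j / measure m (C j) * indicator (C j) x)
      = (\<Sum>j<K. if j = k then b k / measure m (C k) else 0)"
    using assms C(2) by (intro sum.cong) (auto simp: disjoint_family_on_def indicator_def)
  then show ?thesis using assms by (simp add: leftover_def)
qed

lemma leftover_outside: "x \<notin> (\<Union>k<K. C k) \<Longrightarrow> leftover m C K b x = 1"
  by (auto simp: leftover_def intro!: sum.neutral)

lemma leftover_bounds: "0 \<le> leftover m C K b x" "leftover m C K b x \<le> 1"
proof -
  have "b k / measure m (C k) \<le> 1" "0 \<le> b k / measure m (C k)" if "k < K" for k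
    using b[OF that] by (auto simp: divide_le_eq)
  then show "0 \<le> leftover m C K b x" "leftover m C K b x \<le> 1"
    using leftover_cell leftover_outside by (cases "x \<in> (\<Union>k<K. C k)"; force)+
qed

lemma leftover_measurable [measurable]: "leftover m C K b \<in> borel_measurable borel"
  unfolding leftover_def[abs_def] using C
  by (intro borel_measurable_diff borel_measurable_const borel_measurable_sum borel_measurable_times)
     (auto intro!: borel_measurable_indicator)

lemma integrable_leftover: "integrable m (leftover m C K b)"
proof -
  interpret prob_space m by (fact m)
  show ?thesis
    using leftover_bounds leftover_measurable m(2)
    by (intro integrable_const_bound[where B=1]) (auto cong: measurable_cong_sets)
qed

text \<open>A cell of mass 0 forces \<open>b k = 0\<close>, so the convention
  \<open>x / 0 = 0\<close> gives the right value.\<close>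

private lemma cell_integral:
  "k < K \<Longrightarrow> b k / measure m (C k) * measure m (C k) = b k"
  using b[of k] by (cases "measure m (C k) = 0") auto

lemma integral_leftover: "(LINT x|m. leftover m C K b x) = 1 - (\<Sum>k<K. b k)"
proof -
  interpret prob_space m by (fact m)
  have int: "integrable m (\<lambda>x. b k / measure m (C k) * indicator (C k) x)" if "k < K" for k
    using C(1)[OF that] m(2)
    by (intro integrable_mult_right integrable_real_indicator) (auto simp: emeasure_eq_measure)
  have "(LINT x|m. leftover m C K b x)
      = 1 - (\<Sum>k<K. LINT x|m. b k / measure m (C k) * indicator (C k) x)"
    unfolding leftover_def using int
    by (subst Bochner_Integration.integral_diff) (auto simp: prob_space Bochner_Integration.integral_sum)
  also have "\<dots> = 1 - (\<Sum>k<K. b k / measure m (C k) * measure m (C k))"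
    using C(1) m(2) by (auto intro!: sum.cong simp: sets_eq_imp_space_eq[OF m(2)])
  finally show ?thesis
    using cell_integral by simp
qed

text \<open>Outside the cells the leftover density is 1, which gives the tail integral. Inside,
  \<open>g\<close> is at most \<open>R\<close>, and the leftover density of a cell integrates to the
  mass not taken from it.\<close>

lemma integral_mult_leftover_le:
  assumes g: "integrable m g" "\<And>x. 0 \<le> g x" and R: "\<And>k x. k < K \<Longrightarrow> x \<in> C k \<Longrightarrow> g x \<le> R"
  shows "integrable m (\<lambda>x. g x * leftover m C K b x)"
    and "(LINT x|m. g x * leftover m C K b x)
      \<le> (LINT x|m. g x * indicator (- (\<Union>k<K. C k)) x) + R * (\<Sum>k<K. measure m (C k) - b k)"
proof -
  interpret prob_space m by (fact m)
  have gm: "g \<in> borel_measurable borel"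
    using borel_measurable_integrable[OF g(1)] m(2) by (simp cong: measurable_cong_sets)
  have S: "- (\<Union>k<K. C k) \<in> sets borel" using C by (intro borel_comp sets.finite_UN) auto
  show int: "integrable m (\<lambda>x. g x * leftover m C K b x)"
  proof (rule Bochner_Integration.integrable_bound[OF g(1)])
    show "(\<lambda>x. g x * leftover m C K b x) \<in> borel_measurable m"
      using gm leftover_measurable m(2) by (simp cong: measurable_cong_sets)
    show "AE x in m. norm (g x * leftover m C K b x) \<le> norm (g x)"
      using leftover_bounds g(2) by (auto simp: abs_mult mult_left_le)
  qed
  let ?h = "\<lambda>k x. R * ((1 - b k / measure m (C k)) * indicator (C k) x)"
  have inth: "integrable m (?h k)" if "k < K" for k
    using C(1)[OF that] m(2)
    by (intro integrable_mult_right integrable_real_indicator) (auto simp: emeasure_eq_measure)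
  have ints: "integrable m (\<lambda>x. g x * indicator (- (\<Union>k<K. C k)) x)"
    using S m(2) g by (intro integrable_real_mult_indicator) auto
  have pw: "g x * leftover m C K b x \<le> g x * indicator (- (\<Union>k<K. C k)) x + (\<Sum>k<K. ?h k x)" for x
  proof (cases "x \<in> (\<Union>k<K. C k)")
    case True
    then obtain k where k: "k < K" "x \<in> C k" by auto
    have "(\<Sum>j<K. ?h j x) = (\<Sum>j<K. if j = k then R * (1 - b k / measure m (C k)) else 0)"
      using k C(2) by (intro sum.cong) (auto simp: disjoint_family_on_def indicator_def)
    also have "\<dots> = R * leftover m C K b x"
      using k leftover_cell[OF k] by simp
    finally show ?thesis
      using R[OF k] True leftover_bounds by (auto intro: mult_right_mono)
  next
    case False
    then show ?thesis using leftover_outside[OF False] by simp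
  qed
  have "(LINT x|m. g x * leftover m C K b x)
      \<le> (LINT x|m. g x * indicator (- (\<Union>k<K. C k)) x + (\<Sum>k<K. ?h k x))"
    using int ints inth pw by (intro integral_mono Bochner_Integration.integrable_add Bochner_Integration.integrable_sum) auto
  also have "\<dots> = (LINT x|m. g x * indicator (- (\<Union>k<K. C k)) x) + (\<Sum>k<K. LINT x|m. ?h k x)"
    using ints inth by (subst Bochner_Integration.integral_add) (auto simp: Bochner_Integration.integral_sum)
  also have "(\<Sum>k<K. LINT x|m. ?h k x) = (\<Sum>k<K. R * (measure m (C k) - b k))"
  proof (intro sum.cong refl)
    fix k assume "k \<in> {..<K}"
    then have k: "k < K" by simp
    have "(LINT x|m. ?h k x) = R * ((1 - b k / measure m (C k)) * measure m (C k))"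
      by (simp add: sets_eq_imp_space_eq[OF m(2)])
    also have "\<dots> = R * (measure m (C k) - b k)"
      using cell_integral[OF k] by (simp only: left_diff_distrib) simp
    finally show "(LINT x|m. ?h k x) = R * (measure m (C k) - b k)" .
  qed
  finally show "(LINT x|m. g x * leftover m C K b x)
      \<le> (LINT x|m. g x * indicator (- (\<Union>k<K. C k)) x) + R * (\<Sum>k<K. measure m (C k) - b k)"
    by (simp add: sum_distrib_left)
qed

end

text \<open>Within each cell the common mass of the two measures is coupled by a product measure, at a
  cost controlled by the diameter of the cell; the leftovers are coupled by a product measure.
  If there is no leftover, the second summand of the density is 0, because \<open>x / 0 = 0\<close>.\<close>

lemma coupling_exists:
  fixes m n :: "'a::euclidean_space measure" and C :: "nat \<Rightarrow> 'a set"
  assumes l: "0 \<le> l" and m: "m \<in> prob_moment l" and n: "n \<in> prob_moment l"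
    and C: "\<And>k. k < K \<Longrightarrow> C k \<in> sets borel" "disjoint_family_on C {..<K}"
    and d: "0 \<le> d" "\<And>k x y. k < K \<Longrightarrow> x \<in> C k \<Longrightarrow> y \<in> C k \<Longrightarrow> transport_cost l x y \<le> d"
    and R: "0 \<le> R" "\<And>k x. k < K \<Longrightarrow> x \<in> C k \<Longrightarrow> norm_pow l x \<le> R"
  shows "\<exists>\<rho>\<in>couplings m n. (LINT z|\<rho>. transport_cost l (fst z) (snd z)) \<le>
     d + 2 powr l * ((LINT x|m. norm_pow l x * indicator (- (\<Union>k<K. C k)) x)
       + (LINT x|n. norm_pow l x * indicator (- (\<Union>k<K. C k)) x)
       + 2 * (R * (\<Sum>k<K. \<bar>measure m (C k) - measure n (C k)\<bar>)))"
proof -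
  interpret m: prob_space m using m by (simp add: prob_momentD)
  interpret n: prob_space n using n by (simp add: prob_momentD)
  interpret mn: pair_prob_space m n ..
  note sm = prob_momentD(2)[OF m] and sn = prob_momentD(2)[OF n]
  \<comment> \<open>The largest mass that can be taken from both measures in cell \<open>k\<close>.
    The mass \<open>t\<close> left over is then the same for \<open>m\<close> and
    \<open>n\<close>.\<close>
  define b where "b k = min (measure m (C k)) (measure n (C k))" for k
  define t where "t = 1 - (\<Sum>k<K. b k)"
  define u where "u = leftover m C K b"
  define v where "v = leftover n C K b"
  have b0: "\<And>k. k < K \<Longrightarrow> 0 \<le> b k" and bm: "\<And>k. k < K \<Longrightarrow> b k \<le> measure m (C k)"
    and bn: "\<And>k. k < K \<Longrightarrow> b k \<le> measure n (C k)"
    by (auto simp: b_def)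
  note cm = m.prob_space_axioms sm C b0 bm and cn = n.prob_space_axioms sn C b0 bn
  have u01: "0 \<le> u x" "u x \<le> 1" and v01: "0 \<le> v x" "v x \<le> 1" for x
    unfolding u_def v_def using leftover_bounds[OF cm] leftover_bounds[OF cn] by auto
  have um [measurable]: "u \<in> borel_measurable borel" and vm [measurable]: "v \<in> borel_measurable borel"
    unfolding u_def v_def using leftover_measurable[OF cm] leftover_measurable[OF cn] by auto
  have iu: "(\<integral>\<^sup>+x. ennreal (u x) \<partial>m) = ennreal t" and iv: "(\<integral>\<^sup>+x. ennreal (v x) \<partial>n) = ennreal t"
    using integral_leftover[OF cm] integral_leftover[OF cn] integrable_leftover[OF cm]
      integrable_leftover[OF cn] u01 v01
    by (auto simp: nn_integral_eq_integral u_def v_def t_def)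
  have t0: "0 \<le> t"
  proof -
    have "0 \<le> (LINT x|m. u x)" using u01 by (intro integral_nonneg_AE) auto
    then show ?thesis using integral_leftover[OF cm] by (simp add: u_def t_def)
  qed
  \<comment> \<open>Density, with respect to the product of \<open>m\<close> and \<open>n\<close>,
    of the sum of the cellwise product couplings of mass \<open>b k\<close>.\<close>
  define w1 where "w1 x y = (\<Sum>k<K. b k / (measure m (C k) * measure n (C k)) * indicator (C k) x * indicator (C k) y)"
    for x y :: 'a
  define w where "w x y = w1 x y + u x * v y / t" for x y
  have w1nn: "0 \<le> w1 x y" for x y
    unfolding w1_def using b0 by (intro sum_nonneg) auto
  have w1e: "ennreal (w1 x y) = (\<Sum>k<K. ennreal (b k / (measure m (C k) * measure n (C k)) * indicator (C k) x) * indicator (C k) y)"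
    "ennreal (w1 x y) = (\<Sum>k<K. ennreal (b k / (measure m (C k) * measure n (C k)) * indicator (C k) y) * indicator (C k) x)"
    for x y
  proof -
    have "ennreal (w1 x y) = (\<Sum>k<K. ennreal (b k / (measure m (C k) * measure n (C k)) * indicator (C k) x * indicator (C k) y))"
      unfolding w1_def using b0 by (intro sum_ennreal[symmetric]) auto
    then show "ennreal (w1 x y) = (\<Sum>k<K. ennreal (b k / (measure m (C k) * measure n (C k)) * indicator (C k) x) * indicator (C k) y)"
      "ennreal (w1 x y) = (\<Sum>k<K. ennreal (b k / (measure m (C k) * measure n (C k)) * indicator (C k) y) * indicator (C k) x)"
      by (simp_all only:) (intro sum.cong refl; simp add: indicator_def)+
  qed
  have wnn: "0 \<le> w x y" for x y
    unfolding w_def using w1nn u01 v01 t0 by simp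
  have Cm [measurable]: "k < K \<Longrightarrow> C k \<in> sets borel" for k using C by auto
  have w1m: "(\<lambda>z. w1 (fst z) (snd z)) \<in> borel_measurable (borel \<Otimes>\<^sub>M borel)"
    unfolding w1_def by (intro borel_measurable_sum) measurable
  then have wm: "(\<lambda>z. w (fst z) (snd z)) \<in> borel_measurable (borel \<Otimes>\<^sub>M borel)"
    unfolding w_def by measurable
  have smn [measurable_cong]: "sets (m \<Otimes>\<^sub>M n) = sets (borel \<Otimes>\<^sub>M borel)"
    using sm sn by (intro sets_pair_measure_cong) auto
  note [measurable_cong] = sm sn
  note [measurable] = wm
  have Wm: "(\<lambda>z. ennreal (w (fst z) (snd z))) \<in> borel_measurable (m \<Otimes>\<^sub>M n)"
    by measurable
  \<comment> \<open>The quotient \<open>t / t\<close> is 1 unless \<open>t = 0\<close>, when it is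
    0. In that case \<open>u\<close> integrates to 0, hence vanishes almost everywhere, and the
    marginal density is still 1 almost everywhere.\<close>
  have ux: "(\<integral>\<^sup>+y. ennreal (w x y) \<partial>n) = ennreal (1 - u x + u x * (t / t))" for x
  proof -
    have "(\<integral>\<^sup>+y. ennreal (w x y) \<partial>n)
        = (\<integral>\<^sup>+y. ennreal (w1 x y) + ennreal (u x / t) * ennreal (v y) \<partial>n)"
      using w1nn u01 v01 t0 by (intro nn_integral_cong) (simp add: w_def ennreal_mult[symmetric] ennreal_plus[symmetric] del: ennreal_plus)
    also have "\<dots> = (\<integral>\<^sup>+y. ennreal (w1 x y) \<partial>n) + ennreal (u x / t) * ennreal t"
    proof -
      have "(\<lambda>y. w1 x y) \<in> borel_measurable n" using measurable_compose[OF _ w1m, of "\<lambda>y. (x, y)" n] by simp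
      then show ?thesis by (simp add: nn_integral_add nn_integral_cmult iv)
    qed
    also have "(\<integral>\<^sup>+y. ennreal (w1 x y) \<partial>n)
        = (\<integral>\<^sup>+y. (\<Sum>k<K. ennreal (b k / (measure m (C k) * measure n (C k)) * indicator (C k) x) * indicator (C k) y) \<partial>n)"
      by (simp only: w1e(1))
    also have "\<dots> = (\<Sum>k<K. ennreal (b k / (measure m (C k) * measure n (C k)) * indicator (C k) x) * ennreal (measure n (C k)))"
      using C(1) sn
      by (subst nn_integral_sum)
         (auto intro!: sum.cong simp: nn_integral_cmult_indicator n.emeasure_eq_measure )
    also have "\<dots> = (\<Sum>k<K. ennreal (b k / measure m (C k) * indicator (C k) x))"
    proof (intro sum.cong refl)
      fix k assume "k \<in> {..<K}"
      then have k: "k < K" by simp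
      have "b k / (measure m (C k) * measure n (C k)) * indicator (C k) x * measure n (C k)
          = b k / measure m (C k) * indicator (C k) x"
        using bn[OF k] b0[OF k] by (cases "measure n (C k) = 0") auto
      then show "ennreal (b k / (measure m (C k) * measure n (C k)) * indicator (C k) x) * ennreal (measure n (C k))
          = ennreal (b k / measure m (C k) * indicator (C k) x)"
        using b0[OF k] by (simp add: ennreal_mult[symmetric])
    qed
    also have "\<dots> = ennreal (1 - u x)"
      using b0 by (subst sum_ennreal) (auto simp: u_def leftover_def)
    also have "ennreal (1 - u x) + ennreal (u x / t) * ennreal t = ennreal (1 - u x + u x * (t / t))"
      using u01 t0 by (simp add: ennreal_mult[symmetric] ennreal_plus[symmetric] del: ennreal_plus)
    finally show ?thesis .
  qed
  have vy: "(\<integral>\<^sup>+x. ennreal (w x y) \<partial>m) = ennreal (1 - v y + v y * (t / t))" for y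
  proof -
    have "(\<integral>\<^sup>+x. ennreal (w x y) \<partial>m)
        = (\<integral>\<^sup>+x. ennreal (w1 x y) + ennreal (v y / t) * ennreal (u x) \<partial>m)"
      using w1nn u01 v01 t0 by (intro nn_integral_cong) (simp add: w_def mult.commute ennreal_mult[symmetric] ennreal_plus[symmetric] del: ennreal_plus)
    also have "\<dots> = (\<integral>\<^sup>+x. ennreal (w1 x y) \<partial>m) + ennreal (v y / t) * ennreal t"
    proof -
      have "(\<lambda>x. w1 x y) \<in> borel_measurable m" using measurable_compose[OF _ w1m, of "\<lambda>x. (x, y)" m] by simp
      then show ?thesis by (simp add: nn_integral_add nn_integral_cmult iu)
    qed
    also have "(\<integral>\<^sup>+x. ennreal (w1 x y) \<partial>m)
        = (\<integral>\<^sup>+x. (\<Sum>k<K. ennreal (b k / (measure m (C k) * measure n (C k)) * indicator (C k) y) * indicator (C k) x) \<partial>m)"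
      by (simp only: w1e(2))
    also have "\<dots> = (\<Sum>k<K. ennreal (b k / (measure m (C k) * measure n (C k)) * indicator (C k) y) * ennreal (measure m (C k)))"
      using C(1) sm
      by (subst nn_integral_sum)
         (auto intro!: sum.cong simp: nn_integral_cmult_indicator m.emeasure_eq_measure )
    also have "\<dots> = (\<Sum>k<K. ennreal (b k / measure n (C k) * indicator (C k) y))"
    proof (intro sum.cong refl)
      fix k assume "k \<in> {..<K}"
      then have k: "k < K" by simp
      have "b k / (measure m (C k) * measure n (C k)) * indicator (C k) y * measure m (C k)
          = b k / measure n (C k) * indicator (C k) y"
        using bm[OF k] b0[OF k] by (cases "measure m (C k) = 0") auto
      then show "ennreal (b k / (measure m (C k) * measure n (C k)) * indicator (C k) y) * ennreal (measure m (C k))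
          = ennreal (b k / measure n (C k) * indicator (C k) y)"
        using b0[OF k] by (simp add: ennreal_mult[symmetric])
    qed
    also have "\<dots> = ennreal (1 - v y)"
      using b0 by (subst sum_ennreal) (auto simp: v_def leftover_def)
    also have "ennreal (1 - v y) + ennreal (v y / t) * ennreal t = ennreal (1 - v y + v y * (t / t))"
      using v01 t0 by (simp add: ennreal_mult[symmetric] ennreal_plus[symmetric] del: ennreal_plus)
    finally show ?thesis .
  qed
  have ux1: "AE x in m. (\<integral>\<^sup>+y. ennreal (w x y) \<partial>n) = 1"
  proof (cases "t = 0")
    case True
    then have "AE x in m. u x = 0"
      using iu nn_integral_0_iff_AE[of "\<lambda>x. ennreal (u x)" m] u01 by (auto simp: order_antisym)
    then show ?thesis using ux by auto
  qed (simp add: ux)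
  have vy1: "AE y in n. (\<integral>\<^sup>+x. ennreal (w x y) \<partial>m) = 1"
  proof (cases "t = 0")
    case True
    then have "AE x in n. v x = 0"
      using iv nn_integral_0_iff_AE[of "\<lambda>x. ennreal (v x)" n] v01 by (auto simp: order_antisym)
    then show ?thesis using vy by auto
  qed (simp add: vy)
  define \<rho> where "\<rho> = density (m \<Otimes>\<^sub>M n) (\<lambda>z. ennreal (w (fst z) (snd z)))"
  have s\<rho> [measurable_cong]: "sets \<rho> = sets (borel \<Otimes>\<^sub>M borel)"
    by (simp add: \<rho>_def smn)
  have sp\<rho>: "space \<rho> = UNIV" "space (m \<Otimes>\<^sub>M n) = UNIV"
    using sets_eq_imp_space_eq[OF s\<rho>] sets_eq_imp_space_eq[OF smn] by (simp_all add: space_pair_measure)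
  have e\<rho>1: "emeasure \<rho> (fst -` A) = emeasure m A" if A: "A \<in> sets borel" for A
  proof -
    have [measurable]: "A \<in> sets borel" by fact
    have "emeasure \<rho> (fst -` A) = (\<integral>\<^sup>+z. ennreal (w (fst z) (snd z)) * indicator A (fst z) \<partial>(m \<Otimes>\<^sub>M n))"
      unfolding \<rho>_def using measurable_sets[OF measurable_fst, of A borel borel] A
      by (subst emeasure_density) (auto simp: space_pair_measure smn indicator_def intro!: nn_integral_cong)
    also have "\<dots> = (\<integral>\<^sup>+x. \<integral>\<^sup>+y. ennreal (w x y) * indicator A x \<partial>n \<partial>m)"
      by (subst n.nn_integral_fst[symmetric]) auto
    also have "\<dots> = (\<integral>\<^sup>+x. indicator A x \<partial>m)"
    proof (rule nn_integral_cong_AE)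
      show "AE x in m. (\<integral>\<^sup>+y. ennreal (w x y) * indicator A x \<partial>n) = indicator A x"
        using ux1 by eventually_elim (auto simp: indicator_def)
    qed
    finally show ?thesis using A sm by simp
  qed
  have e\<rho>2: "emeasure \<rho> (snd -` A) = emeasure n A" if A: "A \<in> sets borel" for A
  proof -
    have [measurable]: "A \<in> sets borel" by fact
    have "emeasure \<rho> (snd -` A) = (\<integral>\<^sup>+z. ennreal (w (fst z) (snd z)) * indicator A (snd z) \<partial>(m \<Otimes>\<^sub>M n))"
      unfolding \<rho>_def using measurable_sets[OF measurable_snd, of A borel borel] A
      by (subst emeasure_density) (auto simp: space_pair_measure smn indicator_def intro!: nn_integral_cong)
    also have "\<dots> = (\<integral>\<^sup>+y. \<integral>\<^sup>+x. ennreal (w x y) * indicator A y \<partial>m \<partial>n)"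
      by (subst mn.nn_integral_snd[symmetric]) (auto simp: split_beta')
    also have "\<dots> = (\<integral>\<^sup>+x. indicator A x \<partial>n)"
    proof (rule nn_integral_cong_AE)
      show "AE y in n. (\<integral>\<^sup>+x. ennreal (w x y) * indicator A y \<partial>m) = indicator A y"
        using vy1 by eventually_elim (auto simp: indicator_def)
    qed
    finally show ?thesis using A sn by simp
  qed
  have "\<rho> \<in> couplings m n"
    unfolding couplings_def
  proof (intro CollectI conjI)
    show "prob_space \<rho>"
      using e\<rho>1[of UNIV] m.emeasure_space_1 by (intro prob_spaceI) (simp add: sp\<rho> prob_momentD(3)[OF m])
    show "sets \<rho> = sets borel" using s\<rho> unfolding borel_prod .
    have f: "fst \<in> \<rho> \<rightarrow>\<^sub>M borel" "snd \<in> \<rho> \<rightarrow>\<^sub>M borel" by measurable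
    show "distr \<rho> borel fst = m"
      using f e\<rho>1 sm by (intro measure_eqI) (auto simp: emeasure_distr sp\<rho>)
    show "distr \<rho> borel snd = n"
      using f e\<rho>2 sn by (intro measure_eqI) (auto simp: emeasure_distr sp\<rho>)
  qed
  moreover have "(LINT z|\<rho>. transport_cost l (fst z) (snd z)) \<le>
     d + 2 powr l * ((LINT x|m. norm_pow l x * u x) + (LINT x|n. norm_pow l x * v x))"
  proof -
    let ?g = "norm_pow l :: 'a \<Rightarrow> real"
    have cm1 [measurable]: "(\<lambda>z. transport_cost l (fst z) (snd z)) \<in> borel_measurable (borel \<Otimes>\<^sub>M (borel :: 'a measure))"
      using transport_cost_measurable by (simp add: borel_prod)
    have gu: "integrable m (\<lambda>x. ?g x * u x)" and gv: "integrable n (\<lambda>x. ?g x * v x)"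
      unfolding u_def v_def
      using integral_mult_leftover_le(1)[OF cm, of ?g R] integral_mult_leftover_le(1)[OF cn, of ?g R]
        prob_momentD(4)[OF m] prob_momentD(4)[OF n] R by auto
    have nngu: "(\<integral>\<^sup>+x. ennreal (?g x * u x) \<partial>m) = ennreal (LINT x|m. ?g x * u x)"
      and nngv: "(\<integral>\<^sup>+x. ennreal (?g x * v x) \<partial>n) = ennreal (LINT x|n. ?g x * v x)"
      using gu gv u01 v01 by (auto intro!: nn_integral_eq_integral)
    \<comment> \<open>Stated as an inequality so as to include \<open>t = 0\<close>, where the
      left-hand side is 0.\<close>
    have tt: "ennreal (1 / t) * ennreal t \<le> 1"
      using t0 by (simp add: ennreal_mult[symmetric])
    \<comment> \<open>Where \<open>w1\<close> is nonzero, both points lie in one cell and the cost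
      is at most \<open>d\<close>. For the leftover summand the cost is split into a function of
      each point; integrating out the other point produces the factor \<open>t\<close> that cancels
      \<open>1 / t\<close>.\<close>
    have pw: "ennreal (w x y) * ennreal (transport_cost l x y) \<le> ennreal d * ennreal (w x y)
        + ennreal (2 powr l) * ennreal (1 / t) * (ennreal (?g x * u x) * ennreal (v y) + ennreal (u x) * ennreal (?g y * v y))"
      for x y
    proof -
      have c1: "w1 x y * transport_cost l x y \<le> w1 x y * d"
      proof (cases "\<exists>k<K. x \<in> C k \<and> y \<in> C k")
        case True
        then show ?thesis using w1nn d(2) by (intro mult_left_mono) auto
      next
        case False
        then have "w1 x y = 0" unfolding w1_def by (intro sum.neutral) (auto simp: indicator_def)
        then show ?thesis by simp
      qed
      have c2: "u x * v y / t * transport_cost l x y \<le> u x * v y / t * (2 powr l * (?g x + ?g y))"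
        using u01 v01 t0 transport_cost_le[OF l, of x y] by (intro mult_left_mono) auto
      have "w1 x y * d \<le> d * w x y"
        unfolding w_def using d(1) u01 v01 t0 by (simp add: algebra_simps)
      then have "w x y * transport_cost l x y \<le> d * w x y + 2 powr l * (1 / t) * ((?g x * u x) * v y + u x * (?g y * v y))"
        using c1 c2 unfolding w_def by (simp add: algebra_simps add_divide_distrib)
      moreover define c where "c = 1 / t"
      ultimately have "ennreal (w x y * transport_cost l x y)
          \<le> ennreal (d * w x y + 2 powr l * c * ((?g x * u x) * v y + u x * (?g y * v y)))"
        by (intro ennreal_leI) simp
      moreover have "0 \<le> c" using t0 by (simp add: c_def)
      ultimately show ?thesis
        unfolding c_def[symmetric] using wnn d(1) u01 v01 by (simp add: ennreal_mult)
    qed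
    have "(\<integral>\<^sup>+z. ennreal (transport_cost l (fst z) (snd z)) \<partial>\<rho>)
        = (\<integral>\<^sup>+z. ennreal (w (fst z) (snd z)) * ennreal (transport_cost l (fst z) (snd z)) \<partial>(m \<Otimes>\<^sub>M n))"
      unfolding \<rho>_def using Wm by (subst nn_integral_density) auto
    also have "\<dots> \<le> (\<integral>\<^sup>+z. ennreal d * ennreal (w (fst z) (snd z))
        + ennreal (2 powr l) * ennreal (1 / t) * (ennreal (?g (fst z) * u (fst z)) * ennreal (v (snd z))
          + ennreal (u (fst z)) * ennreal (?g (snd z) * v (snd z))) \<partial>(m \<Otimes>\<^sub>M n))"
      using pw by (intro nn_integral_mono) auto
    also have "\<dots> = ennreal d * (\<integral>\<^sup>+z. ennreal (w (fst z) (snd z)) \<partial>(m \<Otimes>\<^sub>M n))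
        + ennreal (2 powr l) * ennreal (1 / t) * ((\<integral>\<^sup>+z. ennreal (?g (fst z) * u (fst z)) * ennreal (v (snd z)) \<partial>(m \<Otimes>\<^sub>M n))
          + (\<integral>\<^sup>+z. ennreal (u (fst z)) * ennreal (?g (snd z) * v (snd z)) \<partial>(m \<Otimes>\<^sub>M n)))"
      by (simp add: nn_integral_add nn_integral_cmult)
    also have "(\<integral>\<^sup>+z. ennreal (w (fst z) (snd z)) \<partial>(m \<Otimes>\<^sub>M n)) = 1"
    proof -
      have "(\<integral>\<^sup>+z. ennreal (w (fst z) (snd z)) \<partial>(m \<Otimes>\<^sub>M n)) = (\<integral>\<^sup>+x. \<integral>\<^sup>+y. ennreal (w x y) \<partial>n \<partial>m)"
        by (subst n.nn_integral_fst[symmetric]) auto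
      also have "\<dots> = (\<integral>\<^sup>+x. 1 \<partial>m)" by (intro nn_integral_cong_AE ux1)
      finally show ?thesis by (simp add: m.emeasure_space_1)
    qed
    also have "(\<integral>\<^sup>+z. ennreal (?g (fst z) * u (fst z)) * ennreal (v (snd z)) \<partial>(m \<Otimes>\<^sub>M n))
        = ennreal (LINT x|m. ?g x * u x) * ennreal t"
      by (subst n.nn_integral_fst[symmetric]) (auto simp: nn_integral_cmult nn_integral_multc iv nngu)
    also have "(\<integral>\<^sup>+z. ennreal (u (fst z)) * ennreal (?g (snd z) * v (snd z)) \<partial>(m \<Otimes>\<^sub>M n))
        = ennreal t * ennreal (LINT x|n. ?g x * v x)"
      by (subst n.nn_integral_fst[symmetric]) (auto simp: nn_integral_cmult nn_integral_multc iu nngv)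
    also have "ennreal d * 1 + ennreal (2 powr l) * ennreal (1 / t) *
        (ennreal (LINT x|m. ?g x * u x) * ennreal t + ennreal t * ennreal (LINT x|n. ?g x * v x))
      = ennreal d + (ennreal (1 / t) * ennreal t) * (ennreal (2 powr l) * (ennreal (LINT x|m. ?g x * u x) + ennreal (LINT x|n. ?g x * v x)))"
      by (simp add: algebra_simps)
    also have "\<dots> \<le> ennreal d + 1 * (ennreal (2 powr l) * (ennreal (LINT x|m. ?g x * u x) + ennreal (LINT x|n. ?g x * v x)))"
      by (intro add_left_mono mult_right_mono tt) simp
    also have "\<dots> = ennreal (d + 2 powr l * ((LINT x|m. ?g x * u x) + (LINT x|n. ?g x * v x)))"
      using d(1) u01 v01 by (simp add: ennreal_mult integral_nonneg_AE)
    finally show ?thesis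
      using d(1) u01 v01 by (intro integral_real_bounded) (auto intro!: add_nonneg_nonneg mult_nonneg_nonneg integral_nonneg_AE)
  qed
  moreover have "(LINT x|m. norm_pow l x * u x) \<le> (LINT x|m. norm_pow l x * indicator (- (\<Union>k<K. C k)) x)
      + R * (\<Sum>k<K. \<bar>measure m (C k) - measure n (C k)\<bar>)"
  proof -
    have "(\<Sum>k<K. measure m (C k) - b k) \<le> (\<Sum>k<K. \<bar>measure m (C k) - measure n (C k)\<bar>)"
      by (intro sum_mono) (auto simp: b_def min_def)
    then show ?thesis
      using integral_mult_leftover_le(2)[OF cm, of "norm_pow l" R] prob_momentD(4)[OF m] R(2)
        mult_left_mono[OF _ R(1)] unfolding u_def by fastforce
  qed
  moreover have "(LINT x|n. norm_pow l x * v x) \<le> (LINT x|n. norm_pow l x * indicator (- (\<Union>k<K. C k)) x)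
      + R * (\<Sum>k<K. \<bar>measure m (C k) - measure n (C k)\<bar>)"
  proof -
    have "(\<Sum>k<K. measure n (C k) - b k) \<le> (\<Sum>k<K. \<bar>measure m (C k) - measure n (C k)\<bar>)"
      by (intro sum_mono) (auto simp: b_def min_def)
    then show ?thesis
      using integral_mult_leftover_le(2)[OF cn, of "norm_pow l" R] prob_momentD(4)[OF n] R(2)
        mult_left_mono[OF _ R(1)] unfolding v_def by fastforce
  qed
  ultimately have "(LINT z|\<rho>. transport_cost l (fst z) (snd z)) \<le>
     d + 2 powr l * (((LINT x|m. norm_pow l x * indicator (- (\<Union>k<K. C k)) x)
        + R * (\<Sum>k<K. \<bar>measure m (C k) - measure n (C k)\<bar>))
      + ((LINT x|n. norm_pow l x * indicator (- (\<Union>k<K. C k)) x)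
        + R * (\<Sum>k<K. \<bar>measure m (C k) - measure n (C k)\<bar>)))"
    by (meson add_left_mono add_mono mult_left_mono order_trans powr_ge_zero)
  then show ?thesis
    using \<open>\<rho> \<in> couplings m n\<close> by (intro bexI[of _ \<rho>]) (simp_all add: algebra_simps)
qed

section \<open>Small cells and a criterion for closeness in the Wasserstein distance\<close>

lemma small_cells_exist:
  fixes R e :: real
  assumes e: "0 < e"
  obtains K and C :: "nat \<Rightarrow> 'a::euclidean_space set"
  where "\<And>k. C k \<in> sets borel" "disjoint_family_on C {..<K}" "(\<Union>k<K. C k) = cball 0 R"
    "\<And>k x y. x \<in> C k \<Longrightarrow> y \<in> C k \<Longrightarrow> norm (x - y) < e"
proof -
  have "compact (cball (0::'a) R)" by simp
  then obtain F where F: "finite F" "cball (0::'a) R \<subseteq> (\<Union>x\<in>F. ball x (e / 2))"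
    unfolding compact_eq_totally_bounded using e by (meson half_gt_zero)
  obtain xs where xs: "set xs = F" using finite_list[OF F(1)] by blast
  \<comment> \<open>Balls within \<open>cball 0 R\<close>, made disjoint by removing all earlier
    ones. Beyond the end of the list \<open>xs ! k\<close> is unspecified, but measurability and the
    diameter bound hold for every \<open>k\<close>, so they are stated without a bound on the
    index.\<close>
  define C where "C k = (cball 0 R \<inter> ball (xs ! k) (e / 2)) - (\<Union>j<k. ball (xs ! j) (e / 2))" for k
  show ?thesis
  proof (rule that[of C "length xs"])
    show "C k \<in> sets borel" for k
      unfolding C_def by (intro sets.Diff sets.Int sets.finite_UN) auto
    show "disjoint_family_on C {..<length xs}"
      unfolding disjoint_family_on_def
    proof (intro ballI impI)
      fix i j :: nat assume "i \<noteq> j"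
      then consider "i < j" | "j < i" by linarith
      then show "C i \<inter> C j = {}"
        by cases (auto simp: C_def)
    qed
    show "(\<Union>k<length xs. C k) = cball 0 R"
    proof
      show "cball 0 R \<subseteq> (\<Union>k<length xs. C k)"
      proof
        fix x :: 'a assume x: "x \<in> cball 0 R"
        then obtain y where "y \<in> F" "x \<in> ball y (e / 2)" using F by auto
        then obtain k where k: "k < length xs" "x \<in> ball (xs ! k) (e / 2)"
          using xs by (metis in_set_conv_nth)
        \<comment> \<open>The first ball that contains the point, so that the point is not removed
          from the cell.\<close>
        define j where "j = (LEAST k. x \<in> ball (xs ! k) (e / 2))"
        have "x \<in> ball (xs ! j) (e / 2)"
          unfolding j_def using k(2) by (rule LeastI)
        moreover have "j \<le> k"
          unfolding j_def using k(2) by (rule Least_le)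
        moreover have "x \<notin> ball (xs ! i) (e / 2)" if "i < j" for i
          using not_less_Least[OF that[unfolded j_def]] .
        ultimately have "j < length xs" "x \<in> C j"
          using k(1) x by (auto simp: C_def)
        then show "x \<in> (\<Union>k<length xs. C k)" by auto
      qed
    qed (auto simp: C_def)
    show "norm (x - y) < e" if "x \<in> C k" "y \<in> C k" for k x y
    proof -
      have "dist (xs ! k) x < e / 2" "dist (xs ! k) y < e / 2" using that by (auto simp: C_def)
      then have "dist x y < e" using dist_triangle_half_r by blast
      then show ?thesis by (simp add: dist_norm)
    qed
  qed
qed

lemma tail_integral_small:
  fixes m :: "'a::euclidean_space measure" and g :: "'a \<Rightarrow> real"
  assumes m: "sets m = sets borel" and g: "integrable m g" and k: "0 < \<kappa>"
  obtains R where "0 \<le> R" "\<bar>LINT x|m. g x * indicator (- cball 0 R) x\<bar> < \<kappa>"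
proof -
  have gm: "g \<in> borel_measurable borel"
    using borel_measurable_integrable[OF g] m by (simp cong: measurable_cong_sets)
  have "(\<lambda>n. LINT x|m. g x * indicator (- cball 0 (real n)) x) \<longlonglongrightarrow> (LINT x|m. 0)"
  proof (rule integral_dominated_convergence[where w="\<lambda>x. \<bar>g x\<bar>"])
    show "(\<lambda>x. g x * indicator (- cball 0 (real n)) x) \<in> borel_measurable m" for n
      using gm m by (simp cong: measurable_cong_sets)
    show "AE x in m. (\<lambda>n. g x * indicator (- cball 0 (real n)) x) \<longlonglongrightarrow> 0"
    proof (rule AE_I2, rule tendsto_eventually)
      fix x :: 'a
      obtain N where "norm x \<le> real N" using real_arch_simple by blast
      then show "\<forall>\<^sub>F n in sequentially. g x * indicator (- cball 0 (real n)) x = 0"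
        unfolding eventually_sequentially by (intro exI[of _ N]) (auto simp: indicator_def)
    qed
    show "AE x in m. norm (g x * indicator (- cball 0 (real n)) x) \<le> \<bar>g x\<bar>" for n
      by (auto simp: indicator_def)
  qed (use g in auto)
  then have "\<forall>\<^sub>F n in sequentially. \<bar>LINT x|m. g x * indicator (- cball 0 (real n)) x\<bar> < \<kappa>"
    using k by (auto dest!: tendstoD[where e=\<kappa>] simp: dist_real_def)
  then obtain n where "\<bar>LINT x|m. g x * indicator (- cball 0 (real n)) x\<bar> < \<kappa>"
    using eventually_happens by fastforce
  then show ?thesis using that[of "real n"] by auto
qed

text \<open>The order of the quantifiers matters: \<theta> is fixed by \<epsilon> alone, and only
  afterwards are the cells chosen, covering so much that the tail of \<mu> is below any prescribed
  \<kappa>. Markov's inequality for a tail integral with mean of order \<kappa> and threshold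
  \<theta> is then as good as desired.\<close>

lemma wasserstein_small:
  fixes \<mu> :: "'a::euclidean_space measure"
  assumes l: "0 \<le> l" and \<mu>: "\<mu> \<in> prob_moment l" and \<epsilon>: "0 < \<epsilon>"
  obtains \<theta> where "0 < \<theta>" and
    "\<And>\<kappa>. 0 < \<kappa> \<Longrightarrow> \<exists>K C \<delta>. 0 < \<delta> \<and> (\<forall>k. C k \<in> sets borel) \<and>
       (LINT x|\<mu>. norm_pow l x * indicator (- (\<Union>k<K::nat. C k)) x) \<le> \<kappa> \<and>
       (\<forall>m\<in>prob_moment l.
          (\<forall>k<K. \<bar>measure m (C k) - measure \<mu> (C k)\<bar> \<le> \<delta>) \<longrightarrow>
          (LINT x|m. norm_pow l x * indicator (- (\<Union>k<K. C k)) x) \<le> \<theta> \<longrightarrow>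
          wasserstein l m \<mu> < \<epsilon>)"
proof -
  define E where "E = \<epsilon> powr max l 1"
  have E: "0 < E" using \<epsilon> by (simp add: E_def)
  define c where "c = 2 powr l"
  have c: "0 < c" by (simp add: c_def)
  \<comment> \<open>The admissible cost \<open>E\<close> is shared out: \<open>d = E / 4\<close> for
    transport inside the cells, and at most \<open>E / 2\<close> for \<open>c\<close> times two
    tails of size \<theta> and the mismatch \<open>2 * \<theta>\<close> of the cell masses.\<close>
  define \<theta> where "\<theta> = E / (8 * c)"
  have \<theta>: "0 < \<theta>" using E c by (simp add: \<theta>_def)
  show ?thesis
  proof (rule that[OF \<theta>])
    fix \<kappa> :: real assume \<kappa>: "0 < \<kappa>"
    obtain R where R: "0 \<le> R" "\<bar>LINT x|\<mu>. norm_pow l x * indicator (- cball 0 R) x\<bar> < min \<kappa> \<theta>"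
      using tail_integral_small[OF prob_momentD(2,4)[OF \<mu>], of "min \<kappa> \<theta>"] \<kappa> \<theta> by auto
    define d where "d = E / 4"
    define e where "e = (if l = 0 then d else d powr (1 / l))"
    have "0 < d" using E by (simp add: d_def)
    then have "0 < e" by (simp add: e_def)
    then obtain K and C :: "nat \<Rightarrow> 'a set" where C: "\<And>k. C k \<in> sets borel"
      "disjoint_family_on C {..<K}" "(\<Union>k<K. C k) = cball 0 R"
      "\<And>k x y. x \<in> C k \<Longrightarrow> y \<in> C k \<Longrightarrow> norm (x - y) < e"
      using small_cells_exist[of e R] by metis
    have cost: "transport_cost l x y \<le> d" if "x \<in> C k" "y \<in> C k" for k x y
    proof (cases "l = 0")
      case True
      then show ?thesis using C(4)[OF that] by (auto simp: transport_cost_def e_def min_def)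
    next
      case False
      have "norm (x - y) powr l \<le> e powr l"
        using C(4)[OF that] l by (intro powr_mono2) auto
      also have "\<dots> = d" using False \<open>0 < d\<close> by (simp add: e_def powr_powr)
      finally show ?thesis using False by (simp add: transport_cost_def)
    qed
    define R' where "R' = (if l = 0 then 1 else R powr l)"
    have R': "0 \<le> R'" by (simp add: R'_def)
    have g: "norm_pow l x \<le> R'" if "k < K" "x \<in> C k" for k x
    proof -
      have "norm x \<le> R" using C(3) that by (metis UN_I lessThan_iff mem_cball_0)
      then show ?thesis using l by (auto simp: norm_pow_def R'_def intro: powr_mono2)
    qed
    \<comment> \<open>There are \<open>K\<close> cells on which the weight is at most
      \<open>R'\<close>, so mass errors \<delta> contribute at most
      \<open>R' * K * \<delta>\<close>, which is below \<theta>; the summand 1 keeps the denominator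
      positive.\<close>
    define \<delta> where "\<delta> = E / (8 * c * (R' * real K + 1))"
    have pos: "0 < R' * real K + 1" using R' by (simp add: add_nonneg_pos)
    then have \<delta>: "0 < \<delta>" using E c by (simp add: \<delta>_def)
    have "wasserstein l m \<mu> < \<epsilon>" if m: "m \<in> prob_moment l"
      and close: "\<forall>k<K. \<bar>measure m (C k) - measure \<mu> (C k)\<bar> \<le> \<delta>"
      and tail: "(LINT x|m. norm_pow l x * indicator (- (\<Union>k<K. C k)) x) \<le> \<theta>" for m
    proof -
      let ?T = "\<lambda>m. LINT x|m. norm_pow l x * indicator (- (\<Union>k<K. C k)) x"
      let ?s = "\<Sum>k<K. \<bar>measure m (C k) - measure \<mu> (C k)\<bar>"
      have "\<exists>\<rho>\<in>couplings m \<mu>. (LINT z|\<rho>. transport_cost l (fst z) (snd z)) \<le> d + c * (?T m + ?T \<mu> + 2 * (R' * ?s))"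
        unfolding c_def using C(1,2) \<open>0 < d\<close> cost R' g by (intro coupling_exists l m \<mu>) auto
      then obtain \<rho> where \<rho>: "\<rho> \<in> couplings m \<mu>"
        and le: "(LINT z|\<rho>. transport_cost l (fst z) (snd z)) \<le> d + c * (?T m + ?T \<mu> + 2 * (R' * ?s))"
        by blast
      have "?s \<le> (\<Sum>k<K. \<delta>)" using close by (intro sum_mono) auto
      then have "R' * ?s \<le> R' * real K * \<delta>"
        using mult_left_mono[OF _ R'] by (simp add: mult.assoc)
      also have "\<dots> < (R' * real K + 1) * \<delta>" using \<delta> by (simp add: algebra_simps)
      also have "\<dots> = E / (8 * c)" using pos by (simp add: \<delta>_def)
      finally have "2 * (R' * ?s) < 2 * \<theta>" by (simp add: \<theta>_def)
      moreover have "?T \<mu> \<le> \<theta>" using R C(3) by auto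
      ultimately have "?T m + ?T \<mu> + 2 * (R' * ?s) < 4 * \<theta>" using tail by linarith
      then have "c * (?T m + ?T \<mu> + 2 * (R' * ?s)) < c * (4 * \<theta>)" using c by simp
      also have "\<dots> = E / 2" using c by (simp add: \<theta>_def)
      finally have "(LINT z|\<rho>. transport_cost l (fst z) (snd z)) < E"
        using le E unfolding d_def by linarith
      then have "(LINT z|\<rho>. transport_cost l (fst z) (snd z)) powr (1 / max l 1) < E powr (1 / max l 1)"
        by (intro powr_less_mono2) (auto intro!: integral_nonneg_AE)
      also have "\<dots> = \<epsilon>" using \<epsilon> by (simp add: E_def powr_powr)
      finally show ?thesis using wasserstein_le[OF \<rho>, of l] by simp
    qed
    moreover have "(LINT x|\<mu>. norm_pow l x * indicator (- (\<Union>k<K. C k)) x) \<le> \<kappa>"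
      using R C(3) by auto
    ultimately show "\<exists>K C \<delta>. 0 < \<delta> \<and> (\<forall>k. C k \<in> sets borel) \<and>
       (LINT x|\<mu>. norm_pow l x * indicator (- (\<Union>k<K::nat. C k)) x) \<le> \<kappa> \<and>
       (\<forall>m\<in>prob_moment l.
          (\<forall>k<K. \<bar>measure m (C k) - measure \<mu> (C k)\<bar> \<le> \<delta>) \<longrightarrow>
          (LINT x|m. norm_pow l x * indicator (- (\<Union>k<K. C k)) x) \<le> \<theta> \<longrightarrow>
          wasserstein l m \<mu> < \<epsilon>)"
      using C(1) \<delta> by (intro exI[of _ K] exI[of _ C] exI[of _ \<delta>]) auto
  qed
qed

section \<open>Integrals along sequences that converge in the Wasserstein distance\<close>

lemma pair_measure_coupling:
  assumes "m \<in> prob_moment l" "n \<in> prob_moment l'"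
  shows "m \<Otimes>\<^sub>M n \<in> couplings m n"
proof -
  interpret m: prob_space m using assms by (simp add: prob_momentD)
  interpret n: prob_space n using assms by (simp add: prob_momentD)
  interpret mn: pair_prob_space m n ..
  note s = prob_momentD(2)[OF assms(1)] prob_momentD(2)[OF assms(2)]
  have "sets (m \<Otimes>\<^sub>M n) = sets (borel \<Otimes>\<^sub>M borel)" using s by (intro sets_pair_measure_cong)
  then have "sets (m \<Otimes>\<^sub>M n) = sets borel" unfolding borel_prod .
  moreover have "distr (m \<Otimes>\<^sub>M n) borel fst = m"
    using n.distr_pair_fst[of m] s by (metis distr_cong)
  moreover have "distr (m \<Otimes>\<^sub>M n) borel snd = n"
  proof (rule measure_eqI)
    fix A assume "A \<in> sets (distr (m \<Otimes>\<^sub>M n) borel snd)"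
    then have A: "A \<in> sets n" using s by simp
    have "emeasure (distr (m \<Otimes>\<^sub>M n) borel snd) A = emeasure (m \<Otimes>\<^sub>M n) (space m \<times> A)"
    proof (subst emeasure_distr)
      show "snd \<in> m \<Otimes>\<^sub>M n \<rightarrow>\<^sub>M borel" using s by (simp cong: measurable_cong_sets)
      have "snd -` A \<inter> space (m \<Otimes>\<^sub>M n) = space m \<times> A"
        using sets.sets_into_space[OF A] by (auto simp: space_pair_measure)
      then show "emeasure (m \<Otimes>\<^sub>M n) (snd -` A \<inter> space (m \<Otimes>\<^sub>M n)) = emeasure (m \<Otimes>\<^sub>M n) (space m \<times> A)"
        by simp
    qed (use A s in simp)
    also have "\<dots> = emeasure n A"
      using A by (subst n.emeasure_pair_measure_Times) (auto simp: m.emeasure_space_1)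
    finally show "emeasure (distr (m \<Otimes>\<^sub>M n) borel snd) A = emeasure n A" .
  qed (use s in simp)
  ultimately show ?thesis
    using mn.prob_space_axioms by (auto simp: couplings_def)
qed

lemma coupling_integral:
  fixes g :: "'a::euclidean_space \<Rightarrow> real"
  assumes \<rho>: "\<rho> \<in> couplings m n" and g: "g \<in> borel_measurable borel"
  shows "integrable \<rho> (\<lambda>z. g (fst z)) \<longleftrightarrow> integrable m g"
    "integrable \<rho> (\<lambda>z. g (snd z)) \<longleftrightarrow> integrable n g"
    "(LINT z|\<rho>. g (fst z)) = (LINT x|m. g x)" "(LINT z|\<rho>. g (snd z)) = (LINT x|n. g x)"
proof -
  have "sets \<rho> = sets (borel \<Otimes>\<^sub>M borel)" using \<rho> unfolding couplings_def borel_prod by simp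
  then have f: "fst \<in> \<rho> \<rightarrow>\<^sub>M borel" "snd \<in> \<rho> \<rightarrow>\<^sub>M borel" by (simp_all cong: measurable_cong_sets)
  have d: "distr \<rho> borel fst = m" "distr \<rho> borel snd = n" using \<rho> by (auto simp: couplings_def)
  show "integrable \<rho> (\<lambda>z. g (fst z)) \<longleftrightarrow> integrable m g"
    "integrable \<rho> (\<lambda>z. g (snd z)) \<longleftrightarrow> integrable n g"
    "(LINT z|\<rho>. g (fst z)) = (LINT x|m. g x)" "(LINT z|\<rho>. g (snd z)) = (LINT x|n. g x)"
    using integrable_distr_eq[OF f(1) g] integrable_distr_eq[OF f(2) g]
      integral_distr[OF f(1) g] integral_distr[OF f(2) g] by (simp_all add: d)
qed

text \<open>Pairs at distance below \<open>s\<close> are compared by the Lipschitz bound; pairs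
  further apart have transport cost at least \<open>c\<close>, so the bound \<open>2 * B\<close> on
  the difference is paid for by the cost. A single coupling of small cost then compares the two
  integrals, for every exponent \<open>l\<close> alike.\<close>

lemma lipschitz_integral_tendsto:
  fixes h :: "'a::euclidean_space \<Rightarrow> real"
  assumes l: "0 \<le> l" and \<pi>: "\<And>N. 0 < N \<Longrightarrow> \<pi> N \<in> prob_moment l" and \<eta>: "\<eta> \<in> prob_moment l"
    and W: "(\<lambda>N. wasserstein l (\<pi> N) \<eta>) \<longlonglongrightarrow> 0"
    and L: "0 < L" "\<And>x y. \<bar>h x - h y\<bar> \<le> L * norm (x - y)"
    and B: "0 < B" "\<And>x. \<bar>h x\<bar> \<le> B" and hm: "h \<in> borel_measurable borel"
  shows "(\<lambda>N. LINT x|\<pi> N. h x) \<longlonglongrightarrow> (LINT x|\<eta>. h x)"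
proof (rule LIMSEQ_I)
  fix e :: real assume e: "0 < e"
  define s where "s = e / (2 * L)"
  have s: "0 < s" using e L by (simp add: s_def)
  define c where "c = (if l = 0 then min 1 s else s powr l)"
  have c: "0 < c" using s by (simp add: c_def)
  have pw: "\<bar>h x - h y\<bar> \<le> e / 2 + 2 * B / c * transport_cost l x y" for x y
  proof (cases "norm (x - y) < s")
    case True
    then have "L * norm (x - y) \<le> L * s" using L by simp
    then have "\<bar>h x - h y\<bar> \<le> e / 2" using L(2)[of x y] L(1) by (simp add: s_def)
    moreover have "0 \<le> 2 * B / c * transport_cost l x y" using B c by simp
    ultimately show ?thesis by linarith
  next
    case False
    then have "c \<le> transport_cost l x y"
      using s l by (auto simp: c_def transport_cost_def intro: powr_mono2)
    then have "2 * B / c * c \<le> 2 * B / c * transport_cost l x y"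
      using B c by (intro mult_left_mono) auto
    moreover have "\<bar>h x - h y\<bar> \<le> 2 * B" using B(2)[of x] B(2)[of y] by linarith
    ultimately show ?thesis using e c by simp
  qed
  \<comment> \<open>A coupling whose cost, raised to the outer exponent, is below \<open>E\<close>
    contributes at most \<open>2 * B / c * (e * c / (8 * B)) = e / 4\<close>.\<close>
  define E where "E = (e * c / (8 * B)) powr (1 / max l 1)"
  have E: "0 < E" using e c B by (simp add: E_def)
  obtain N0 where N0: "\<And>N. N \<ge> N0 \<Longrightarrow> wasserstein l (\<pi> N) \<eta> < E"
    using order_tendstoD(2)[OF W E] by (auto simp: eventually_sequentially)
  have "norm ((LINT x|\<pi> N. h x) - (LINT x|\<eta>. h x)) < e" if N: "N \<ge> max 1 N0" for N
  proof -
    have p: "\<pi> N \<in> prob_moment l" using N by (intro \<pi>) auto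
    have "\<exists>\<rho>\<in>couplings (\<pi> N) \<eta>. (LINT z|\<rho>. transport_cost l (fst z) (snd z)) powr (1 / max l 1) < E"
    proof (subst cINF_less_iff[symmetric])
      show "(INF \<rho>\<in>couplings (\<pi> N) \<eta>. (LINT z|\<rho>. transport_cost l (fst z) (snd z)) powr (1 / max l 1)) < E"
        using N0[of N] N unfolding wasserstein_eq by simp
    qed (auto intro!: bdd_belowI2[where m=0] pair_measure_coupling[OF p \<eta>])
    then obtain \<rho> where \<rho>: "\<rho> \<in> couplings (\<pi> N) \<eta>"
      and lt: "(LINT z|\<rho>. transport_cost l (fst z) (snd z)) powr (1 / max l 1) < E" by blast
    let ?I = "LINT z|\<rho>. transport_cost l (fst z) (snd z)"
    have I: "?I \<le> e * c / (8 * B)"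
    proof (rule ccontr)
      assume "\<not> ?thesis"
      then have "(e * c / (8 * B)) powr (1 / max l 1) \<le> ?I powr (1 / max l 1)"
        using e c B by (intro powr_mono2) auto
      then show False using lt by (simp add: E_def)
    qed
    interpret prob_space \<rho> using \<rho> by (simp add: couplings_def)
    have s\<rho>: "sets \<rho> = sets borel" using \<rho> by (simp add: couplings_def)
    have ic: "integrable \<rho> (\<lambda>z. transport_cost l (fst z) (snd z))"
    proof (rule Bochner_Integration.integrable_bound)
      show "integrable \<rho> (\<lambda>z. 2 powr l * (norm_pow l (fst z) + norm_pow l (snd z)))"
        using coupling_integral[OF \<rho>, of "norm_pow l"] prob_momentD(4)[OF p] prob_momentD(4)[OF \<eta>] by simp
      show "(\<lambda>z. transport_cost l (fst z) (snd z)) \<in> borel_measurable \<rho>"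
        using transport_cost_measurable s\<rho> by (simp cong: measurable_cong_sets)
      show "AE z in \<rho>. norm (transport_cost l (fst z) (snd z)) \<le> norm (2 powr l * (norm_pow l (fst z) + norm_pow l (snd z)))"
        using transport_cost_le[OF l] by (intro AE_I2) simp
    qed
    have "integrable (\<pi> N) h" "integrable \<eta> h"
      using B(1) B(2) hm p \<eta>
      by (auto intro!: prob_moment_integrable[where K=B] order_trans[OF B(2)])
    then have ih: "integrable \<rho> (\<lambda>z. h (fst z))" "integrable \<rho> (\<lambda>z. h (snd z))"
      using coupling_integral[OF \<rho> hm] by auto
    have "(LINT x|\<pi> N. h x) - (LINT x|\<eta>. h x) = (LINT z|\<rho>. h (fst z) - h (snd z))"
      using coupling_integral[OF \<rho> hm] ih by simp
    also have "\<bar>\<dots>\<bar> \<le> (LINT z|\<rho>. \<bar>h (fst z) - h (snd z)\<bar>)"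
      using integral_abs_bound by blast
    also have "\<dots> \<le> (LINT z|\<rho>. e / 2 + 2 * B / c * transport_cost l (fst z) (snd z))"
      using ih ic pw by (intro integral_mono Bochner_Integration.integrable_add integrable_mult_right) auto
    also have "\<dots> = e / 2 + 2 * B / c * ?I"
      using ic prob_space by simp
    also have "\<dots> \<le> e / 2 + 2 * B / c * (e * c / (8 * B))"
      using I B c by (intro add_left_mono mult_left_mono) auto
    also have "\<dots> < e" using e B c by simp
    finally show ?thesis by simp
  qed
  then show "\<exists>no. \<forall>n\<ge>no. norm ((LINT x|\<pi> n. h x) - (LINT x|\<eta>. h x)) < e" by blast
qed

text \<open>Sup-convolution: Lipschitz majorants of a bounded function, which decrease to it at every
  point of continuity. Being continuous, they are measurable.\<close>

definition lipschitz_envelope :: "('a::real_normed_vector \<Rightarrow> real) \<Rightarrow> real \<Rightarrow> 'a \<Rightarrow> real" where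
  "lipschitz_envelope h k z = (SUP w. h w - k * norm (z - w))"

context
  fixes h :: "'a::real_normed_vector \<Rightarrow> real" and B :: real
  assumes B: "\<And>x. \<bar>h x\<bar> \<le> B"
begin

private lemma bdd_env: "0 \<le> k \<Longrightarrow> bdd_above (range (\<lambda>w. h w - k * norm (z - w)))"
  using B by (intro bdd_aboveI2[where M=B]) (metis abs_le_D1 diff_left_mono diff_zero mult_nonneg_nonneg norm_ge_zero order_trans)

lemma lipschitz_envelope_ge: "0 \<le> k \<Longrightarrow> h z \<le> lipschitz_envelope h k z"
  unfolding lipschitz_envelope_def using cSUP_upper[OF UNIV_I bdd_env, of k z z] by simp

lemma lipschitz_envelope_bound: "0 \<le> k \<Longrightarrow> \<bar>lipschitz_envelope h k z\<bar> \<le> B"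
proof -
  assume k: "0 \<le> k"
  have "lipschitz_envelope h k z \<le> B"
    unfolding lipschitz_envelope_def
  proof (rule cSUP_least)
    fix w show "h w - k * norm (z - w) \<le> B"
      using B[of w] k mult_nonneg_nonneg[OF k norm_ge_zero[of "z - w"]] by linarith
  qed simp
  then show ?thesis using lipschitz_envelope_ge[OF k, of z] B[of z] by linarith
qed

lemma lipschitz_envelope_lipschitz:
  assumes k: "0 \<le> k"
  shows "\<bar>lipschitz_envelope h k x - lipschitz_envelope h k y\<bar> \<le> k * norm (x - y)"
proof -
  have *: "lipschitz_envelope h k x \<le> lipschitz_envelope h k y + k * norm (x - y)" for x y
    unfolding lipschitz_envelope_def[of h k x]
  proof (rule cSUP_least)
    fix w
    have "h w - k * norm (y - w) \<le> lipschitz_envelope h k y"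
      unfolding lipschitz_envelope_def using bdd_env[OF k] by (intro cSUP_upper) auto
    moreover have "k * norm (y - w) \<le> k * norm (x - w) + k * norm (x - y)"
      using k norm_triangle_ineq[of "y - x" "x - w"]
      by (simp add: norm_minus_commute flip: distrib_left) (metis add.commute mult_left_mono)
    ultimately show "h w - k * norm (x - w) \<le> lipschitz_envelope h k y + k * norm (x - y)"
      by linarith
  qed simp
  show ?thesis using *[of x y] *[of y x] by (simp add: norm_minus_commute abs_le_iff)
qed

text \<open>A competitor at distance at least \<open>d\<close> from \<open>z\<close> is penalised by
  at least \<open>k * d\<close>, which for large \<open>k\<close> is no less than
  \<open>2 * B\<close>, the largest possible gain. Nearby competitors differ little from
  \<open>h z\<close> by continuity.\<close>

lemma lipschitz_envelope_tendsto:
  assumes c: "isCont h z"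
  shows "(\<lambda>k. lipschitz_envelope h (real k) z) \<longlonglongrightarrow> h z"
proof (rule LIMSEQ_I)
  fix e :: real assume e: "0 < e"
  obtain d where d: "0 < d" "\<And>w. norm (w - z) < d \<Longrightarrow> \<bar>h w - h z\<bar> < e / 2"
    using c e unfolding continuous_at_eps_delta dist_norm by (metis half_gt_zero real_norm_def)
  obtain k0 where k0: "2 * B / d \<le> real k0" using real_arch_simple by blast
  have "norm (lipschitz_envelope h (real k) z - h z) < e" if "k \<ge> k0" for k
  proof -
    have "lipschitz_envelope h (real k) z \<le> h z + e / 2"
      unfolding lipschitz_envelope_def
    proof (rule cSUP_least)
      fix w
      show "h w - real k * norm (z - w) \<le> h z + e / 2"
      proof (cases "norm (w - z) < d")
        case True
        have "0 \<le> real k * norm (z - w)" by simp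
        then show ?thesis using d(2)[OF True] by linarith
      next
        case False
        have "2 * B \<le> real k * d" using k0 that d(1) by (simp add: pos_divide_le_eq) (meson le_less_trans mult_right_mono not_le of_nat_le_iff order_trans less_imp_le)
        also have "\<dots> \<le> real k * norm (z - w)"
          using False by (intro mult_left_mono) (auto simp: norm_minus_commute)
        finally show ?thesis using B[of w] B[of z] e by linarith
      qed
    qed simp
    then show ?thesis using lipschitz_envelope_ge[of "real k" z] e by simp
  qed
  then show "\<exists>no. \<forall>k\<ge>no. norm (lipschitz_envelope h (real k) z - h z) < e" by blast
qed

end

text \<open>An envelope that is almost optimal in the \<eta>-integral bounds the integrals from
  above for large \<open>N\<close>. The lower bound is the same statement for \<open>- h\<close>,
  which has the same points of continuity.\<close>

lemma wasserstein_integral_tendsto: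
  fixes h :: "'a::euclidean_space \<Rightarrow> real"
  assumes l: "0 \<le> l" and \<pi>: "\<And>N. 0 < N \<Longrightarrow> \<pi> N \<in> prob_moment l" and \<eta>: "\<eta> \<in> prob_moment l"
    and W: "(\<lambda>N. wasserstein l (\<pi> N) \<eta>) \<longlonglongrightarrow> 0"
    and B: "\<And>x. \<bar>h x\<bar> \<le> B" and hm: "h \<in> borel_measurable borel"
    and cont: "AE x in \<eta>. isCont h x"
  shows "(\<lambda>N. LINT x|\<pi> N. h x) \<longlonglongrightarrow> (LINT x|\<eta>. h x)"
proof -
  have upper: "\<forall>\<^sub>F N in sequentially. (LINT x|\<pi> N. h x) < (LINT x|\<eta>. h x) + e"
    if e: "0 < e" and B: "\<And>x. \<bar>h x\<bar> \<le> B" and hm: "h \<in> borel_measurable borel"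
    and cont: "AE x in \<eta>. isCont h x" for h and e :: real
  proof -
    have B': "\<bar>g x\<bar> \<le> (B + 1) * (1 + norm_pow l x)" if "\<bar>g x\<bar> \<le> B" for g :: "'a \<Rightarrow> real" and x
    proof -
      have "B + 1 \<le> (B + 1) * (1 + norm_pow l x)"
        using that by (simp add: distrib_left)
      then show ?thesis using that by linarith
    qed
    have em: "lipschitz_envelope h (real k) \<in> borel_measurable borel" for k
    proof (rule borel_measurable_continuous_onI)
      show "continuous_on UNIV (lipschitz_envelope h (real k))"
        using lipschitz_envelope_lipschitz[OF B, of "real k"]
        by (intro lipschitz_on_continuous_on[where L="real k"] lipschitz_onI) (auto simp: dist_norm)
    qed
    have eB: "\<bar>lipschitz_envelope h (real k) x\<bar> \<le> B" for k x
      by (rule lipschitz_envelope_bound[OF B]) simp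
    have int: "integrable m (lipschitz_envelope h (real k))" "integrable m h" if "m \<in> prob_moment l" for m k
      by (rule prob_moment_integrable[OF that em], rule B', rule eB)
         (rule prob_moment_integrable[OF that hm], rule B', rule B)
    have "(\<lambda>k. LINT x|\<eta>. lipschitz_envelope h (real k) x) \<longlonglongrightarrow> (LINT x|\<eta>. h x)"
    proof (rule integral_dominated_convergence[where w="\<lambda>_. B"])
      interpret prob_space \<eta> using \<eta> by (simp add: prob_momentD)
      show "integrable \<eta> (\<lambda>_. B)" by simp
      show "AE x in \<eta>. (\<lambda>k. lipschitz_envelope h (real k) x) \<longlonglongrightarrow> h x"
        using cont by eventually_elim (rule lipschitz_envelope_tendsto[OF B])
    qed (use int[OF \<eta>] eB in auto)
    then have "\<forall>\<^sub>F k in sequentially. (LINT x|\<eta>. lipschitz_envelope h (real k) x) < (LINT x|\<eta>. h x) + e \<and> 0 < k"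
      using e by (intro eventually_conj order_tendstoD eventually_gt_at_top) auto
    then obtain k where k: "(LINT x|\<eta>. lipschitz_envelope h (real k) x) < (LINT x|\<eta>. h x) + e" "0 < k"
      using eventually_happens by fastforce
    have "(\<lambda>N. LINT x|\<pi> N. lipschitz_envelope h (real k) x) \<longlonglongrightarrow> (LINT x|\<eta>. lipschitz_envelope h (real k) x)"
    proof (rule lipschitz_integral_tendsto[OF l \<pi> \<eta> W])
      \<comment> \<open>The bound has to be strictly positive, whereas \<open>B\<close> may be
        0.\<close>
      show "\<bar>lipschitz_envelope h (real k) x\<bar> \<le> \<bar>B\<bar> + 1" for x using eB[of k x] by linarith
      show "\<bar>lipschitz_envelope h (real k) x - lipschitz_envelope h (real k) y\<bar> \<le> real k * norm (x - y)" for x y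
        by (rule lipschitz_envelope_lipschitz[OF B]) simp
    qed (use em k(2) in auto)
    then have "\<forall>\<^sub>F N in sequentially. (LINT x|\<pi> N. lipschitz_envelope h (real k) x) < (LINT x|\<eta>. h x) + e"
      using k(1) by (rule order_tendstoD)
    then show ?thesis
      using eventually_gt_at_top[of 0]
    proof eventually_elim
      case (elim N)
      have "(LINT x|\<pi> N. h x) \<le> (LINT x|\<pi> N. lipschitz_envelope h (real k) x)"
        using int[OF \<pi>[OF elim(2)]] by (intro integral_mono lipschitz_envelope_ge[where B=B] B) auto
      then show ?case using elim by simp
    qed
  qed
  show ?thesis
  proof (rule order_tendstoI)
    fix a assume "a < (LINT x|\<eta>. h x)"
    then have "\<forall>\<^sub>F N in sequentially. (LINT x|\<pi> N. - h x) < (LINT x|\<eta>. - h x) + ((LINT x|\<eta>. h x) - a)"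
      using B hm cont by (intro upper) (auto elim: eventually_mono intro: continuous_minus)
    then show "\<forall>\<^sub>F N in sequentially. a < (LINT x|\<pi> N. h x)" by simp
  next
    fix a assume "(LINT x|\<eta>. h x) < a"
    then show "\<forall>\<^sub>F N in sequentially. (LINT x|\<pi> N. h x) < a"
      using upper[of "a - (LINT x|\<eta>. h x)" h] B hm cont by simp
  qed
qed

section \<open>The mean value theorem along a segment of measures\<close>

lemma mix_measure_0: "m \<in> prob_moment l \<Longrightarrow> n \<in> prob_moment l \<Longrightarrow> mix_measure 0 m n = m"
  by (rule prob_moment_eqI[where l=l]) (auto simp: measure_mix_measure[where l=l] intro!: mix_measure_prob_moment)

lemma mix_measure_1: "m \<in> prob_moment l \<Longrightarrow> n \<in> prob_moment l \<Longrightarrow> mix_measure 1 m n = n"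
  by (rule prob_moment_eqI[where l=l]) (auto simp: measure_mix_measure[where l=l] intro!: mix_measure_prob_moment)

text \<open>Moving from a point of the segment towards either end stays on the segment. The first
  identity yields right, the second left difference quotients of \<open>U\<close> along it.\<close>

lemma mix_mix_measure:
  assumes m: "m \<in> prob_moment l" and n: "n \<in> prob_moment l" and s: "0 \<le> s" "s \<le> 1" and e: "0 \<le> e" "e \<le> 1"
  shows "mix_measure e (mix_measure s m n) n = mix_measure (s + e * (1 - s)) m n" (is ?A)
    and "mix_measure e (mix_measure s m n) m = mix_measure (s * (1 - e)) m n" (is ?B)
proof -
  note ms = mix_measure_prob_moment[OF m n s]
  have r: "0 \<le> s + e * (1 - s)" "s + e * (1 - s) \<le> 1" "0 \<le> s * (1 - e)" "s * (1 - e) \<le> 1"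
    using s e mult_left_le_one_le[of "1 - s" e] mult_left_le_one_le[of "1 - e" s] by auto
  show ?A
    using m n ms r s e
    by (intro prob_moment_eqI[where l=l] mix_measure_prob_moment) (auto simp: measure_mix_measure[where l=l] algebra_simps)
  show ?B
    using m n ms r s e
    by (intro prob_moment_eqI[where l=l] mix_measure_prob_moment) (auto simp: measure_mix_measure[where l=l] algebra_simps)
qed

text \<open>Transfers a right derivative at 0 to a one-sided difference quotient at \<open>s\<close>
  through the affine change \<open>y = s + a * e\<close>. A negative \<open>a\<close> reverses the
  orientation, which is how left quotients come from right derivatives.\<close>

lemma tendsto_quotient_rescale:
  fixes h k :: "real \<Rightarrow> real"
  assumes k: "(k has_real_derivative c) (at_right 0)" and k0: "k 0 = h s" and a: "a \<noteq> 0"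
    and F: "filterlim (\<lambda>y. (y - s) / a) (at_right 0) F"
    and eq: "\<forall>\<^sub>F y in F. h y = k ((y - s) / a)"
  shows "((\<lambda>y. (h y - h s) / (y - s)) \<longlongrightarrow> c / a) F"
proof -
  have "((\<lambda>e. (k e - k 0) / (e - 0)) \<longlongrightarrow> c) (at_right 0)"
    using k by (simp add: has_field_derivative_iff)
  from filterlim_compose[OF this F]
  have "((\<lambda>y. (k ((y - s) / a) - k 0) / ((y - s) / a) / a) \<longlongrightarrow> c / a) F"
    by (intro tendsto_divide tendsto_const a) simp
  then show ?thesis
    by (rule Lim_transform_eventually) (use eq in eventually_elim, use a k0 in simp)
qed

lemma filterlim_rescale:
  fixes s a :: real
  shows "0 < a \<Longrightarrow> filterlim (\<lambda>y. (y - s) / a) (at_right 0) (at_right s)"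
    "a < 0 \<Longrightarrow> filterlim (\<lambda>y. (y - s) / a) (at_right 0) (at_left s)"
proof -
  have t: "((\<lambda>y. (y - s) / a) \<longlongrightarrow> 0) (at s within S)" if "a \<noteq> 0" for S
    using that by (auto intro!: tendsto_eq_intros)
  show "0 < a \<Longrightarrow> filterlim (\<lambda>y. (y - s) / a) (at_right 0) (at_right s)"
    using t by (auto simp: filterlim_at eventually_at_filter)
  show "a < 0 \<Longrightarrow> filterlim (\<lambda>y. (y - s) / a) (at_right 0) (at_left s)"
    using t by (auto simp: filterlim_at eventually_at_filter zero_less_divide_iff)
qed

text \<open>The hypothesis provides only right derivatives at 0 for motions starting at a measure.
  At the point with parameter \<open>s\<close> the motion towards \<open>n\<close> has speed
  \<open>1 - s\<close> and the motion towards \<open>m\<close> speed \<open>- s\<close>; once these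
  factors are divided out, both quotients tend to \<open>h' s\<close>. So \<open>h\<close> is
  differentiable inside the interval and the classical mean value theorem applies.\<close>

lemma functional_mvt:
  fixes m n :: "'a::euclidean_space measure"
  assumes m: "m \<in> prob_moment l" and n: "n \<in> prob_moment l"
    and D: "\<And>s. 0 \<le> s \<Longrightarrow> s \<le> 1 \<Longrightarrow>
      has_linear_functional_derivative l U (D (mix_measure s m n)) (mix_measure s m n)"
  obtains s where "0 < s" "s < 1"
    "U n - U m = (LINT x|n. D (mix_measure s m n) x) - (LINT x|m. D (mix_measure s m n) x)"
proof -
  define M where "M s = mix_measure s m n" for s
  define h where "h s = U (M s)" for s
  define h' where "h' s = (LINT x|n. D (M s) x) - (LINT x|m. D (M s) x)" for s
  have M: "M s \<in> prob_moment l" if "0 \<le> s" "s \<le> 1" for s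
    unfolding M_def using that by (intro mix_measure_prob_moment m n)
  have der: "((\<lambda>e. U (mix_measure e (M s) \<nu>)) has_real_derivative
      (LINT x|\<nu>. D (M s) x) - ((1 - s) * (LINT x|m. D (M s) x) + s * (LINT x|n. D (M s) x))) (at_right 0)"
    if s: "0 \<le> s" "s \<le> 1" and \<nu>: "\<nu> \<in> prob_moment l" for s \<nu>
  proof -
    have hd: "has_linear_functional_derivative l U (D (M s)) (M s)"
      using D[OF s] by (simp add: M_def)
    then obtain K where K: "\<And>y. \<bar>D (M s) y\<bar> / (1 + norm_pow l y) \<le> K"
      and Dm: "D (M s) \<in> borel_measurable borel"
      unfolding has_linear_functional_derivative_def bdd_above_def by auto
    have "0 < 1 + norm_pow l y" for y :: 'a by (simp add: add_pos_nonneg)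
    then have K': "\<bar>D (M s) y\<bar> \<le> K * (1 + norm_pow l y)" for y
      using K[of y] by (simp add: pos_divide_le_eq)
    have "signed_integral (measure_diff \<nu> (M s)) (D (M s)) = (LINT x|\<nu>. D (M s) x) - (LINT x|M s. D (M s) x)"
      using signed_integral_measure_diff[OF M[OF s] \<nu> Dm K'] .
    \<comment> \<open>The integral against a point of the segment is the mixture of the integrals
      against the ends; this makes the two one-sided limits agree.\<close>
    also have "(LINT x|M s. D (M s) x) = (1 - s) * (LINT x|m. D (M s) x) + s * (LINT x|n. D (M s) x)"
      using integral_mix_measure[OF m n s Dm K'] by (simp add: M_def)
    finally show ?thesis
      using hd \<nu> unfolding has_linear_functional_derivative_def by auto
  qed
  have right: "((\<lambda>y. (h y - h s) / (y - s)) \<longlongrightarrow> h' s) (at_right s)" if s: "0 \<le> s" "s < 1" for s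
  proof -
    let ?k = "\<lambda>e. U (mix_measure e (M s) n)"
    have "((\<lambda>y. (h y - h s) / (y - s)) \<longlongrightarrow>
      ((LINT x|n. D (M s) x) - ((1 - s) * (LINT x|m. D (M s) x) + s * (LINT x|n. D (M s) x))) / (1 - s)) (at_right s)"
    proof (rule tendsto_quotient_rescale[where k = ?k])
      show "?k 0 = h s" using mix_measure_0[OF M n] s by (simp add: h_def)
      show "filterlim (\<lambda>y. (y - s) / (1 - s)) (at_right 0) (at_right s)"
        using s by (intro filterlim_rescale) simp
      have "\<forall>\<^sub>F y in at_right s. y \<in> {s<..<1}"
        using s by (intro eventually_at_right_real) simp
      then show "\<forall>\<^sub>F y in at_right s. h y = ?k ((y - s) / (1 - s))"
      proof eventually_elim
        case (elim y)
        then show ?case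
          using s mix_mix_measure(1)[OF m n, of s "(y - s) / (1 - s)"] by (simp add: h_def M_def)
      qed
    qed (use der[of s n] s n in auto)
    also have "((LINT x|n. D (M s) x) - ((1 - s) * (LINT x|m. D (M s) x) + s * (LINT x|n. D (M s) x))) / (1 - s) = h' s"
      using s by (simp add: h'_def field_simps)
    finally show ?thesis .
  qed
  have left: "((\<lambda>y. (h y - h s) / (y - s)) \<longlongrightarrow> h' s) (at_left s)" if s: "0 < s" "s \<le> 1" for s
  proof -
    let ?k = "\<lambda>e. U (mix_measure e (M s) m)"
    have "((\<lambda>y. (h y - h s) / (y - s)) \<longlongrightarrow>
      ((LINT x|m. D (M s) x) - ((1 - s) * (LINT x|m. D (M s) x) + s * (LINT x|n. D (M s) x))) / (- s)) (at_left s)"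
    proof (rule tendsto_quotient_rescale[where k = ?k])
      show "?k 0 = h s" using mix_measure_0[OF M m] s by (simp add: h_def)
      show "filterlim (\<lambda>y. (y - s) / (- s)) (at_right 0) (at_left s)"
        using s by (intro filterlim_rescale) simp
      have "\<forall>\<^sub>F y in at_left s. y \<in> {0<..<s}"
        using s by (intro eventually_at_left_real) simp
      then show "\<forall>\<^sub>F y in at_left s. h y = ?k ((y - s) / (- s))"
      proof eventually_elim
        case (elim y)
        then have "s * (1 - (y - s) / (- s)) = y" "0 \<le> (y - s) / (- s)" "(y - s) / (- s) \<le> 1"
          using s by (auto simp: field_simps)
        then show ?case
          using s mix_mix_measure(2)[OF m n, of s "(y - s) / (- s)"] by (simp add: h_def M_def)
      qed
    qed (use der[of s m] s m in auto)
    also have "((LINT x|m. D (M s) x) - ((1 - s) * (LINT x|m. D (M s) x) + s * (LINT x|n. D (M s) x))) / (- s) = h' s"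
      using s by (simp add: h'_def field_simps)
    finally show ?thesis .
  qed
  have deriv: "(h has_real_derivative h' s) (at s)" if "0 < s" "s < 1" for s
    unfolding has_field_derivative_iff using left[of s] right[of s] that by (intro filterlim_split_at) auto
  \<comment> \<open>At the two ends the one-sided derivatives give continuity within the
    interval.\<close>
  have "continuous_on {0..1} h"
    unfolding continuous_on_eq_continuous_within
  proof
    fix s :: real assume "s \<in> {0..1}"
    then consider "s = 0" | "s = 1" | "0 < s" "s < 1" by fastforce
    then show "continuous (at s within {0..1}) h"
    proof cases
      case 1
      have "(h has_real_derivative h' 0) (at 0 within {0..1})"
        unfolding has_field_derivative_iff using right[of 0] by (simp add: at_within_Icc_at_right)
      then show ?thesis using 1 DERIV_continuous by blast
    next
      case 2
      have "(h has_real_derivative h' 1) (at 1 within {0..1})"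
        unfolding has_field_derivative_iff using left[of 1] by (simp add: at_within_Icc_at_left)
      then show ?thesis using 2 DERIV_continuous by blast
    next
      case 3
      then show ?thesis
        using DERIV_isCont[OF deriv] continuous_at_imp_continuous_at_within by blast
    qed
  qed
  then obtain c z where z: "0 < z" "z < 1" "(h has_real_derivative c) (at z)" "h 1 - h 0 = (1 - 0) * c"
    using MVT[of 0 1 h] deriv by (metis real_differentiable_def zero_less_one)
  have "c = h' z" using DERIV_unique[OF z(3) deriv] z by simp
  then show ?thesis
    using that[OF z(1,2)] z(4) mix_measure_0[OF m n] mix_measure_1[OF m n]
    by (simp add: h_def h'_def M_def)
qed

section \<open>Limits in distribution of sums of independent variables\<close>

lemma exp_minus_linear_bound:
  fixes x :: real
  assumes "0 \<le> x"
  shows "\<bar>exp (- x) - (1 - x)\<bar> \<le> x\<^sup>2"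
proof -
  have "exp (- x) \<le> 1 / (1 + x)"
    using exp_ge_add_one_self[of x] assms by (simp add: exp_minus field_simps)
  also have "1 / (1 + x) \<le> 1 - x + x\<^sup>2"
  proof -
    \<comment> \<open>The product equals \<open>1 + x ^ 3\<close>.\<close>
    have "1 \<le> (1 - x + x\<^sup>2) * (1 + x)"
      using assms by (simp add: power2_eq_square algebra_simps)
    then show ?thesis using assms by (simp add: pos_divide_le_eq)
  qed
  finally show ?thesis
    using exp_ge_add_one_self[of "- x"] by (simp add: abs_le_iff)
qed

text \<open>The variables are not identically distributed, so each characteristic function is
  compared with its own factor \<open>exp (- x i)\<close>, where \<open>x i\<close> is
  \<open>t\<^sup>2 / 2\<close> times the variance of the scaled variable; the product of these
  factors depends on the averaged variance only. The truncation level \<open>A\<close> is fixed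
  while \<open>N\<close> grows, and \<open>v = 0\<close> is allowed.\<close>

lemma lindeberg_char:
  fixes Y :: "nat \<Rightarrow> 'o \<Rightarrow> real"
  assumes P: "prob_space P" and indep: "prob_space.indep_vars P (\<lambda>_. borel) Y {1..}"
    and mean: "\<And>i. 1 \<le> i \<Longrightarrow> (LINT \<omega>|P. Y i \<omega>) = 0"
    and sq: "\<And>i. 1 \<le> i \<Longrightarrow> integrable P (\<lambda>\<omega>. (Y i \<omega>)\<^sup>2)"
    and var: "(\<lambda>N. (\<Sum>i=1..N. LINT \<omega>|P. (Y i \<omega>)\<^sup>2) / real N) \<longlonglongrightarrow> v"
    and lind: "\<And>e. 0 < e \<Longrightarrow> \<exists>A\<ge>0. \<forall>\<^sub>F N in sequentially.
      (\<Sum>i=1..N. LINT \<omega>|P. (Y i \<omega>)\<^sup>2 * indicator {\<omega>. A < \<bar>Y i \<omega>\<bar>} \<omega>) / real N \<le> e"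
  shows "(\<lambda>N. char (distr P borel (\<lambda>\<omega>. (\<Sum>i=1..N. Y i \<omega>) / sqrt (real N))) t)
    \<longlonglongrightarrow> complex_of_real (exp (- (t\<^sup>2 * v / 2)))"
proof -
  interpret prob_space P by fact
  have Ym [measurable]: "Y i \<in> borel_measurable P" if "1 \<le> i" for i
    using indep that by (simp add: indep_vars_def2)
  have Yi: "integrable P (Y i)" if "1 \<le> i" for i
    using square_integrable_imp_integrable[OF Ym sq] that by simp
  define s where "s i = (LINT \<omega>|P. (Y i \<omega>)\<^sup>2)" for i
  define L where "L A i = (LINT \<omega>|P. (Y i \<omega>)\<^sup>2 * indicator {\<omega>. A < \<bar>Y i \<omega>\<bar>} \<omega>)" for A i
  have s0: "0 \<le> s i" for i by (simp add: s_def)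
  have L0: "0 \<le> L A i" for A i by (auto simp: L_def intro!: integral_nonneg_AE)
  have iL: "integrable P (\<lambda>\<omega>. (Y i \<omega>)\<^sup>2 * indicator {\<omega>. A < \<bar>Y i \<omega>\<bar>} \<omega>)" if "1 \<le> i" for A i
  proof (rule Bochner_Integration.integrable_bound[OF sq[OF that]])
    have "Measurable.pred P (\<lambda>\<omega>. A < \<bar>Y i \<omega>\<bar>)" using Ym[OF that] by measurable
    then have [measurable]: "{\<omega>. A < \<bar>Y i \<omega>\<bar>} \<inter> space P \<in> sets P" by (simp add: pred_def Int_def conj_commute)
    have "(\<lambda>\<omega>. (Y i \<omega>)\<^sup>2 * indicator ({\<omega>. A < \<bar>Y i \<omega>\<bar>} \<inter> space P) \<omega>) \<in> borel_measurable P"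
      using Ym[OF that] by measurable
    then show "(\<lambda>\<omega>. (Y i \<omega>)\<^sup>2 * indicator {\<omega>. A < \<bar>Y i \<omega>\<bar>} \<omega>) \<in> borel_measurable P"
      by (rule measurable_cong[THEN iffD1, rotated]) (simp add: indicator_def)
    show "AE x in P. norm ((Y i x)\<^sup>2 * indicator {\<omega>. A < \<bar>Y i \<omega>\<bar>} x) \<le> norm ((Y i x)\<^sup>2)"
      by (auto simp: indicator_def)
  qed
  define V where "V N = (\<Sum>i=1..N. s i) / real N" for N
  define LL where "LL A N = (\<Sum>i=1..N. L A i) / real N" for A N
  have V: "V \<longlonglongrightarrow> v" using var by (simp add: V_def[abs_def] s_def)
  define ch where "ch N = char (distr P borel (\<lambda>\<omega>. (\<Sum>i=1..N. Y i \<omega>) / sqrt (real N))) t" for N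
  have bound: "norm (ch N - complex_of_real (exp (- (t\<^sup>2 * V N / 2))))
      \<le> t\<^sup>2 / 6 * (\<bar>t\<bar> * A / sqrt (real N) * V N + 6 * LL A N)
        + t\<^sup>2 / 2 * (A\<^sup>2 / real N + LL A N) * (t\<^sup>2 / 2 * V N)"
    if N: "0 < N" and A: "0 \<le> A" for N A
  proof -
    define Z where "Z i \<omega> = Y i \<omega> / sqrt (real N)" for i \<omega>
    define x where "x i = t\<^sup>2 * s i / (2 * real N)" for i
    have x0: "0 \<le> x i" for i using s0 by (simp add: x_def)
    have Zm: "Z i \<in> borel_measurable P" if "1 \<le> i" for i
      unfolding Z_def using Ym[OF that] by measurable
    have "indep_vars (\<lambda>_. borel) Y {1..N}" using indep by (rule indep_vars_subset) auto
    then have iZ: "indep_vars (\<lambda>_. borel) Z {1..N}"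
      unfolding Z_def by (rule indep_vars_compose2) simp
    have "ch N = char (distr P borel (\<lambda>\<omega>. \<Sum>i=1..N. Z i \<omega>)) t"
      by (simp add: ch_def Z_def sum_divide_distrib)
    also have "\<dots> = (\<Prod>i=1..N. char (distr P borel (Z i)) t)"
      by (rule char_distr_sum[OF iZ])
    finally have chN: "ch N = (\<Prod>i=1..N. char (distr P borel (Z i)) t)" .
    have "(\<Sum>i=1..N. - x i) = - (t\<^sup>2 * V N / 2)"
      by (simp add: x_def V_def sum_negf sum_divide_distrib[symmetric] sum_distrib_left[symmetric])
    then have eN: "complex_of_real (exp (- (t\<^sup>2 * V N / 2))) = (\<Prod>i=1..N. complex_of_real (exp (- x i)))"
      by (simp add: exp_sum[symmetric] flip: of_real_prod)
    have "norm (ch N - complex_of_real (exp (- (t\<^sup>2 * V N / 2))))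
        \<le> (\<Sum>i=1..N. norm (char (distr P borel (Z i)) t - complex_of_real (exp (- x i))))"
      unfolding chN eN
    \<comment> \<open>All factors have modulus at most 1, so the difference of the products is at
      most the sum of the differences.\<close>
    proof (rule norm_prod_diff)
      fix i assume "i \<in> {1..N}"
      then have "Z i \<in> borel_measurable P" using Zm by simp
      then show "norm (char (distr P borel (Z i)) t) \<le> 1"
        by (intro real_distribution.cmod_char_le_1 real_distribution_distr)
      show "norm (complex_of_real (exp (- x i))) \<le> 1" using x0 by (simp add: norm_of_real)
    qed
    also have "\<dots> \<le> (\<Sum>i=1..N. t\<^sup>2 / 6 * (\<bar>t\<bar> * A / sqrt (real N) * (s i / real N) + 6 * (L A i / real N))
        + t\<^sup>2 / 2 * (A\<^sup>2 / real N + LL A N) * x i)"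
    proof (rule sum_mono)
      fix i assume i: "i \<in> {1..N}"
      then have i1: "1 \<le> i" by simp
      have Z2: "(Z i \<omega>)\<^sup>2 = (Y i \<omega>)\<^sup>2 / real N" for \<omega>
        using N by (simp add: Z_def power_divide)
      have EZ: "expectation (Z i) = 0" unfolding Z_def using mean[OF i1] by simp
      have EZ2: "expectation (\<lambda>\<omega>. (Z i \<omega>)\<^sup>2) = s i / real N" by (simp add: Z2 s_def)
      have IZ: "integrable P (Z i)" unfolding Z_def using Yi[OF i1] by simp
      have IZ2: "integrable P (\<lambda>\<omega>. (Z i \<omega>)\<^sup>2)" unfolding Z2 using sq[OF i1] by simp
      have "norm (char (distr P borel (Z i)) t - (1 - t\<^sup>2 * (s i / real N) / 2))
          \<le> t\<^sup>2 / 6 * expectation (\<lambda>\<omega>. min (6 * (Z i \<omega>)\<^sup>2) (\<bar>t\<bar> * \<bar>Z i \<omega>\<bar> ^ 3))"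
        using Zm[OF i1] IZ IZ2 EZ EZ2 by (intro char_approx3') auto
      also have "expectation (\<lambda>\<omega>. min (6 * (Z i \<omega>)\<^sup>2) (\<bar>t\<bar> * \<bar>Z i \<omega>\<bar> ^ 3))
          \<le> expectation (\<lambda>\<omega>. \<bar>t\<bar> * A / sqrt (real N) * ((Y i \<omega>)\<^sup>2 / real N)
            + 6 * ((Y i \<omega>)\<^sup>2 * indicator {\<omega>. A < \<bar>Y i \<omega>\<bar>} \<omega> / real N))"
      proof (rule integral_mono)
        have [measurable]: "Z i \<in> borel_measurable P" by (rule Zm[OF i1])
        show "integrable P (\<lambda>\<omega>. min (6 * (Z i \<omega>)\<^sup>2) (\<bar>t\<bar> * \<bar>Z i \<omega>\<bar> ^ 3))"
          by (rule Bochner_Integration.integrable_bound[OF integrable_mult_right[OF IZ2, of 6]]) (auto simp: min_def)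
        show "integrable P (\<lambda>\<omega>. \<bar>t\<bar> * A / sqrt (real N) * ((Y i \<omega>)\<^sup>2 / real N)
            + 6 * ((Y i \<omega>)\<^sup>2 * indicator {\<omega>. A < \<bar>Y i \<omega>\<bar>} \<omega> / real N))"
          using sq[OF i1] iL[OF i1]
          by (intro Bochner_Integration.integrable_add integrable_mult_right integrable_divide) auto
        fix \<omega>
        show "min (6 * (Z i \<omega>)\<^sup>2) (\<bar>t\<bar> * \<bar>Z i \<omega>\<bar> ^ 3) \<le> \<bar>t\<bar> * A / sqrt (real N) * ((Y i \<omega>)\<^sup>2 / real N)
            + 6 * ((Y i \<omega>)\<^sup>2 * indicator {\<omega>. A < \<bar>Y i \<omega>\<bar>} \<omega> / real N)"
        \<comment> \<open>Above the level the quadratic alternative of the minimum is used, below it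
          the cubic one, in which one factor is at most \<open>A / sqrt N\<close>.\<close>
        proof (cases "A < \<bar>Y i \<omega>\<bar>")
          case True
          have "0 \<le> \<bar>t\<bar> * A / sqrt (real N) * ((Y i \<omega>)\<^sup>2 / real N)" using A by simp
          then show ?thesis using True by (simp add: Z2 min_le_iff_disj)
        next
          case False
          have "\<bar>Z i \<omega>\<bar> ^ 3 = \<bar>Y i \<omega>\<bar> / sqrt (real N) * ((Y i \<omega>)\<^sup>2 / real N)"
            using Z2[of \<omega>] by (simp add: power3_eq_cube power2_eq_square Z_def abs_mult_self_eq mult_ac flip: abs_mult)
          also have "\<dots> \<le> A / sqrt (real N) * ((Y i \<omega>)\<^sup>2 / real N)"
            using False by (intro mult_right_mono divide_right_mono) auto
          finally have "\<bar>t\<bar> * \<bar>Z i \<omega>\<bar> ^ 3 \<le> \<bar>t\<bar> * (A / sqrt (real N) * ((Y i \<omega>)\<^sup>2 / real N))"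
            by (intro mult_left_mono) auto
          then show ?thesis using False by (simp add: min_le_iff_disj mult.assoc)
        qed
      qed
      also have "\<dots> = \<bar>t\<bar> * A / sqrt (real N) * (s i / real N) + 6 * (L A i / real N)"
        using sq[OF i1] iL[OF i1] by (subst Bochner_Integration.integral_add) (auto simp: s_def L_def)
      finally have 1: "norm (char (distr P borel (Z i)) t - (1 - t\<^sup>2 * (s i / real N) / 2))
          \<le> t\<^sup>2 / 6 * (\<bar>t\<bar> * A / sqrt (real N) * (s i / real N) + 6 * (L A i / real N))"
        by this (rule mult_left_mono, auto)
      \<comment> \<open>No single variance is large: splitting at level \<open>A\<close> bounds each
        \<open>x i\<close> by a multiple of \<open>A\<^sup>2 / N + LL A N\<close>. Hence the sum of
        the squares \<open>(x i)\<^sup>2\<close>, the error of linearising the exponential, is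
        small.\<close>
      have "s i \<le> A\<^sup>2 + L A i"
      proof -
        have "s i \<le> expectation (\<lambda>\<omega>. A\<^sup>2 + (Y i \<omega>)\<^sup>2 * indicator {\<omega>. A < \<bar>Y i \<omega>\<bar>} \<omega>)"
          unfolding s_def
        proof (rule integral_mono)
          fix \<omega>
          show "(Y i \<omega>)\<^sup>2 \<le> A\<^sup>2 + (Y i \<omega>)\<^sup>2 * indicator {\<omega>. A < \<bar>Y i \<omega>\<bar>} \<omega>"
            using A power_mono[of "\<bar>Y i \<omega>\<bar>" A 2] by (auto simp: indicator_def not_less)
        qed (use sq[OF i1] iL[OF i1] in auto)
        also have "\<dots> = A\<^sup>2 + L A i"
          using iL[OF i1] by (simp add: L_def prob_space)
        finally show ?thesis .
      qed
      moreover have "L A i \<le> (\<Sum>j=1..N. L A j)"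
        using i L0 by (intro member_le_sum) auto
      ultimately have "s i / real N \<le> A\<^sup>2 / real N + LL A N"
        unfolding LL_def add_divide_distrib[symmetric] by (intro divide_right_mono) auto
      then have "t\<^sup>2 / 2 * (s i / real N) \<le> t\<^sup>2 / 2 * (A\<^sup>2 / real N + LL A N)"
        by (intro mult_left_mono) auto
      then have xi: "x i \<le> t\<^sup>2 / 2 * (A\<^sup>2 / real N + LL A N)" by (simp add: x_def)
      then have xx: "(x i)\<^sup>2 \<le> t\<^sup>2 / 2 * (A\<^sup>2 / real N + LL A N) * x i"
        by (subst power2_eq_square[of "x i"]) (rule mult_right_mono[OF xi x0])
      have "norm ((1 - t\<^sup>2 * (s i / real N) / 2) - complex_of_real (exp (- x i))) = \<bar>exp (- x i) - (1 - x i)\<bar>"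
      proof -
        have "complex_of_real 1 - t\<^sup>2 * (s i / real N) / 2 = complex_of_real (1 - x i)"
          by (simp add: x_def)
        then have "(1 - t\<^sup>2 * (s i / real N) / 2) - complex_of_real (exp (- x i)) = complex_of_real ((1 - x i) - exp (- x i))"
          by simp
        then show ?thesis by (simp only: norm_of_real abs_minus_commute)
      qed
      also have "\<dots> \<le> (x i)\<^sup>2" by (rule exp_minus_linear_bound[OF x0])
      finally have 2: "norm ((1 - t\<^sup>2 * (s i / real N) / 2) - complex_of_real (exp (- x i)))
          \<le> t\<^sup>2 / 2 * (A\<^sup>2 / real N + LL A N) * x i" using xx by simp
      show "norm (char (distr P borel (Z i)) t - complex_of_real (exp (- x i)))
        \<le> t\<^sup>2 / 6 * (\<bar>t\<bar> * A / sqrt (real N) * (s i / real N) + 6 * (L A i / real N))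
        + t\<^sup>2 / 2 * (A\<^sup>2 / real N + LL A N) * x i"
        using norm_triangle_le[OF add_mono[OF 1 2]] by simp
    qed
    also have "\<dots> = t\<^sup>2 / 6 * (\<bar>t\<bar> * A / sqrt (real N) * V N + 6 * LL A N)
        + t\<^sup>2 / 2 * (A\<^sup>2 / real N + LL A N) * (t\<^sup>2 / 2 * V N)"
    proof -
      have "(\<Sum>i=1..N. s i / real N) = V N" "(\<Sum>i=1..N. L A i / real N) = LL A N" "(\<Sum>i=1..N. x i) = t\<^sup>2 / 2 * V N"
        by (simp_all add: V_def LL_def x_def sum_divide_distrib sum_distrib_left)
      moreover have "(\<Sum>i=1..N. a * (b * f i + 6 * g i) + d * x i)
          = a * (b * (\<Sum>i=1..N. f i) + 6 * (\<Sum>i=1..N. g i)) + d * (\<Sum>i=1..N. x i)"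
        for a b d :: real and f g :: "nat \<Rightarrow> real"
        by (simp add: sum.distrib sum_distrib_left algebra_simps)
      ultimately show ?thesis by presburger
    qed
    finally show ?thesis .
  qed
  have "(\<lambda>N. ch N - complex_of_real (exp (- (t\<^sup>2 * V N / 2)))) \<longlonglongrightarrow> 0"
  proof (rule LIMSEQ_I)
    fix r :: real assume r: "0 < r"
    have "0 \<le> v" by (rule LIMSEQ_le_const[OF V]) (auto simp: V_def s0 sum_nonneg)
    \<comment> \<open>The bound tends to \<open>c * e\<close>, and the summand 1 in the denominator
      of \<open>e\<close> covers \<open>c = 0\<close>.\<close>
    define c where "c = t\<^sup>2 + t\<^sup>2 / 2 * (t\<^sup>2 / 2 * v)"
    have c: "0 \<le> c" using \<open>0 \<le> v\<close> by (simp add: c_def)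
    define e where "e = r / (2 * (c + 1))"
    have e: "0 < e" using r c by (simp add: e_def)
    obtain A where A: "0 \<le> A" "\<forall>\<^sub>F N in sequentially. LL A N \<le> e"
      using lind[OF e] by (auto simp: LL_def L_def)
    let ?G = "\<lambda>N. t\<^sup>2 / 6 * (\<bar>t\<bar> * A / sqrt (real N) * V N + 6 * e)
        + t\<^sup>2 / 2 * (A\<^sup>2 / real N + e) * (t\<^sup>2 / 2 * V N)"
    have q: "(\<lambda>N. \<bar>t\<bar> * A / sqrt (real N)) \<longlonglongrightarrow> 0" "(\<lambda>N. A\<^sup>2 / real N) \<longlonglongrightarrow> 0"
      by (auto intro!: tendsto_divide_0 filterlim_at_top_imp_at_infinity filterlim_real_sequentially
        filterlim_compose[OF sqrt_at_top])
    have "?G \<longlonglongrightarrow> t\<^sup>2 / 6 * (0 * v + 6 * e) + t\<^sup>2 / 2 * (0 + e) * (t\<^sup>2 / 2 * v)"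
      by (intro tendsto_intros V q)
    also have "t\<^sup>2 / 6 * (0 * v + 6 * e) + t\<^sup>2 / 2 * (0 + e) * (t\<^sup>2 / 2 * v) = c * e"
      by (simp add: c_def algebra_simps)
    finally have "?G \<longlonglongrightarrow> c * e" .
    moreover have "c * e < r"
      using c r by (simp add: e_def pos_divide_less_eq algebra_simps add_nonneg_pos)
    ultimately have "\<forall>\<^sub>F N in sequentially. ?G N < r" by (rule order_tendstoD)
    then have "\<forall>\<^sub>F N in sequentially. norm (ch N - complex_of_real (exp (- (t\<^sup>2 * V N / 2)))) < r"
      using A(2) eventually_gt_at_top[of 0]
    proof eventually_elim
      case (elim N)
      have VN: "0 \<le> V N" by (simp add: V_def s0 sum_nonneg)
      have "t\<^sup>2 / 6 * (\<bar>t\<bar> * A / sqrt (real N) * V N + 6 * LL A N)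
        + t\<^sup>2 / 2 * (A\<^sup>2 / real N + LL A N) * (t\<^sup>2 / 2 * V N) \<le> ?G N"
        using elim(2) VN by (intro add_mono mult_left_mono mult_right_mono) auto
      then show ?case using bound[OF elim(3) A(1)] elim(1) by linarith
    qed
    then show "\<exists>no. \<forall>n\<ge>no. norm (ch n - complex_of_real (exp (- (t\<^sup>2 * V n / 2))) - 0) < r"
      by (simp add: eventually_sequentially)
  qed
  moreover have "(\<lambda>N. complex_of_real (exp (- (t\<^sup>2 * V N / 2)))) \<longlonglongrightarrow> complex_of_real (exp (- (t\<^sup>2 * v / 2)))"
    by (intro tendsto_intros V) simp
  ultimately have "(\<lambda>N. (ch N - complex_of_real (exp (- (t\<^sup>2 * V N / 2)))) + complex_of_real (exp (- (t\<^sup>2 * V N / 2))))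
      \<longlonglongrightarrow> 0 + complex_of_real (exp (- (t\<^sup>2 * v / 2)))"
    by (rule tendsto_add)
  then show ?thesis by (simp add: ch_def)
qed

text \<open>Affine image of the standard normal law. The Dirac mass for \<open>v = 0\<close> is
  computed separately and fits the same formula.\<close>

lemma gaussian_law_char:
  assumes v: "0 \<le> v"
  shows "real_distribution (gaussian_law a v)"
    and "char (gaussian_law a v) t = iexp (t * a) * complex_of_real (exp (- (t\<^sup>2 * v / 2)))"
proof -
  have "real_distribution (gaussian_law a v) \<and>
    char (gaussian_law a v) t = iexp (t * a) * complex_of_real (exp (- (t\<^sup>2 * v / 2)))"
  proof (cases "v = 0")
    case True
    then show ?thesis
      by (auto simp: gaussian_law_def char_def integral_return real_distribution_def
        real_distribution_axioms_def prob_space_return)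
  next
    case False
    define s where "s = sqrt v"
    have s: "0 < s" "s\<^sup>2 = v" using v False by (auto simp: s_def)
    interpret S: real_distribution std_normal_distribution by (rule real_dist_normal_dist)
    have "distributed std_normal_distribution lborel (\<lambda>x. x) (\<lambda>x. ennreal (normal_density 0 1 x))"
      by (auto simp: distributed_def distr_id2)
    from S.normal_density_affine[OF this, of s a] s
    have "distributed std_normal_distribution lborel (\<lambda>x. a + s * x) (\<lambda>x. ennreal (normal_density a s x))"
      by simp
    then have "distr std_normal_distribution lborel (\<lambda>x. a + s * x) = gaussian_law a v"
      using False by (simp add: distributed_def gaussian_law_def s_def)
    moreover have "distr std_normal_distribution lborel (\<lambda>x. a + s * x) = distr std_normal_distribution borel (\<lambda>x. a + s * x)"
      by (intro distr_cong) auto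
    ultimately have G: "gaussian_law a v = distr std_normal_distribution borel (\<lambda>x. a + s * x)" by simp
    have "char (gaussian_law a v) t = (CLINT x|std_normal_distribution. iexp (t * (a + s * x)))"
      unfolding G char_def by (subst integral_distr) auto
    also have "\<dots> = (CLINT x|std_normal_distribution. iexp (t * a) * iexp ((t * s) * x))"
      by (simp add: algebra_simps exp_add)
    also have "\<dots> = iexp (t * a) * char std_normal_distribution (t * s)"
      by (simp add: char_def)
    also have "char std_normal_distribution (t * s) = complex_of_real (exp (- (t\<^sup>2 * v / 2)))"
      by (simp add: char_std_normal_distribution power_mult_distrib s)
    finally show ?thesis
      unfolding G by (auto intro!: S.real_distribution_distr)
  qed
  then show "real_distribution (gaussian_law a v)"
    and "char (gaussian_law a v) t = iexp (t * a) * complex_of_real (exp (- (t\<^sup>2 * v / 2)))" by auto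
qed

text \<open>Replacing \<open>B N\<close> by \<open>c\<close> changes the integrand by a factor of
  modulus 1 that is within \<open>\<bar>t\<bar> * e\<close> of 1 where \<open>B N\<close> is close
  to \<open>c\<close>, and within 2 of it elsewhere.\<close>

lemma slutsky_char:
  fixes A B :: "nat \<Rightarrow> 'o \<Rightarrow> real"
  assumes P: "prob_space P" and A: "\<And>N. A N \<in> borel_measurable P" and B: "\<And>N. B N \<in> borel_measurable P"
    and ch: "(\<lambda>N. char (distr P borel (A N)) t) \<longlonglongrightarrow> \<phi>"
    and conv: "\<And>e. 0 < e \<Longrightarrow> (\<lambda>N. measure P {\<omega>\<in>space P. e < \<bar>B N \<omega> - c\<bar>}) \<longlonglongrightarrow> 0"
  shows "(\<lambda>N. char (distr P borel (\<lambda>\<omega>. A N \<omega> + B N \<omega>)) t) \<longlonglongrightarrow> iexp (t * c) * \<phi>"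
proof -
  interpret prob_space P by fact
  note [measurable] = A B
  have bound: "norm (char (distr P borel (\<lambda>\<omega>. A N \<omega> + B N \<omega>)) t - iexp (t * c) * char (distr P borel (A N)) t)
      \<le> \<bar>t\<bar> * e + 2 * measure P {\<omega>\<in>space P. e < \<bar>B N \<omega> - c\<bar>}" if e: "0 < e" for N e
  proof -
    have n1: "norm (iexp x) = 1" for x by simp
    have int: "complex_integrable P (\<lambda>\<omega>. iexp (t * (A N \<omega> + B N \<omega>)))"
      "complex_integrable P (\<lambda>\<omega>. iexp (t * c) * iexp (t * A N \<omega>))"
      by (auto intro!: integrable_const_bound[where B=1] simp: norm_mult)
    have "char (distr P borel (\<lambda>\<omega>. A N \<omega> + B N \<omega>)) t - iexp (t * c) * char (distr P borel (A N)) t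
      = (CLINT \<omega>|P. iexp (t * (A N \<omega> + B N \<omega>)) - iexp (t * c) * iexp (t * A N \<omega>))"
      unfolding char_def using int by (subst (1 2) integral_distr) auto
    also have "norm \<dots> \<le> (LINT \<omega>|P. norm (iexp (t * (A N \<omega> + B N \<omega>)) - iexp (t * c) * iexp (t * A N \<omega>)))"
      by (rule integral_norm_bound)
    also have "\<dots> \<le> (LINT \<omega>|P. \<bar>t\<bar> * e + 2 * indicator {\<omega>\<in>space P. e < \<bar>B N \<omega> - c\<bar>} \<omega>)"
    proof (rule integral_mono)
      show "integrable P (\<lambda>\<omega>. norm (iexp (t * (A N \<omega> + B N \<omega>)) - iexp (t * c) * iexp (t * A N \<omega>)))"
        using int by auto
      show "integrable P (\<lambda>\<omega>. \<bar>t\<bar> * e + 2 * indicator {\<omega>\<in>space P. e < \<bar>B N \<omega> - c\<bar>} \<omega>)"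
        by (auto intro!: integrable_real_indicator simp: emeasure_eq_measure)
      fix \<omega> assume \<omega>: "\<omega> \<in> space P"
      have "iexp (t * (A N \<omega> + B N \<omega>)) - iexp (t * c) * iexp (t * A N \<omega>)
          = iexp (t * c) * iexp (t * A N \<omega>) * (iexp (t * (B N \<omega> - c)) - 1)"
        by (simp add: algebra_simps exp_add[symmetric])
      then have eq: "norm (iexp (t * (A N \<omega> + B N \<omega>)) - iexp (t * c) * iexp (t * A N \<omega>))
          = norm (iexp (t * (B N \<omega> - c)) - 1)"
        by (simp only: norm_mult n1 mult_1)
      show "norm (iexp (t * (A N \<omega> + B N \<omega>)) - iexp (t * c) * iexp (t * A N \<omega>))
          \<le> \<bar>t\<bar> * e + 2 * indicator {\<omega>\<in>space P. e < \<bar>B N \<omega> - c\<bar>} \<omega>"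
      proof (cases "e < \<bar>B N \<omega> - c\<bar>")
        case True
        have "norm (iexp (t * (B N \<omega> - c)) - 1) \<le> norm (iexp (t * (B N \<omega> - c))) + norm (1::complex)"
          by (rule norm_triangle_ineq4)
        then have "norm (iexp (t * (B N \<omega> - c)) - 1) \<le> 2" by (simp only: n1 norm_one)
        moreover have "0 \<le> \<bar>t\<bar> * e" using e by simp
        ultimately show ?thesis unfolding eq using True \<omega> by simp
      next
        case False
        have "norm (iexp (t * (B N \<omega> - c)) - 1) \<le> \<bar>t * (B N \<omega> - c)\<bar>"
          using iexp_approx1[of "t * (B N \<omega> - c)" 0] by simp
        also have "\<dots> \<le> \<bar>t\<bar> * e" using False by (simp add: abs_mult mult_left_mono)
        finally show ?thesis unfolding eq by (simp add: add_increasing2)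
      qed
    qed
    also have "\<dots> = \<bar>t\<bar> * e + 2 * measure P {\<omega>\<in>space P. e < \<bar>B N \<omega> - c\<bar>}"
      by (subst Bochner_Integration.integral_add) (auto simp: prob_space emeasure_eq_measure intro!: integrable_real_indicator)
    finally show ?thesis .
  qed
  have "(\<lambda>N. char (distr P borel (\<lambda>\<omega>. A N \<omega> + B N \<omega>)) t - iexp (t * c) * char (distr P borel (A N)) t) \<longlonglongrightarrow> 0"
  proof (rule LIMSEQ_I)
    fix r :: real assume r: "0 < r"
    define e where "e = r / (2 * (\<bar>t\<bar> + 1))"
    have e: "0 < e" using r by (simp add: e_def)
    have te: "\<bar>t\<bar> * e < r" using r by (simp add: e_def pos_divide_less_eq algebra_simps add_nonneg_pos)
    have "(\<lambda>N. \<bar>t\<bar> * e + 2 * measure P {\<omega>\<in>space P. e < \<bar>B N \<omega> - c\<bar>}) \<longlonglongrightarrow> \<bar>t\<bar> * e + 2 * 0"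
      by (intro tendsto_intros conv e)
    then have "\<forall>\<^sub>F N in sequentially. \<bar>t\<bar> * e + 2 * measure P {\<omega>\<in>space P. e < \<bar>B N \<omega> - c\<bar>} < r"
      using te by (intro order_tendstoD(2)) auto
    then have "\<forall>\<^sub>F N in sequentially. norm (char (distr P borel (\<lambda>\<omega>. A N \<omega> + B N \<omega>)) t - iexp (t * c) * char (distr P borel (A N)) t) < r"
      by eventually_elim (rule le_less_trans[OF bound[OF e]])
    then show "\<exists>no. \<forall>n\<ge>no. norm (char (distr P borel (\<lambda>\<omega>. A n \<omega> + B n \<omega>)) t - iexp (t * c) * char (distr P borel (A n)) t - 0) < r"
      by (simp add: eventually_sequentially)
  qed
  from tendsto_add[OF this tendsto_mult[OF tendsto_const[of "iexp (t * c)"] ch]]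
  show ?thesis by simp
qed

section \<open>Independent sequences\<close>

text \<open>The joint law of past and present is a product, so that conditioning on the past becomes
  Fubini's theorem. The past is a vector restricted to the indices below \<open>j\<close>, empty for
  \<open>j = 1\<close>.\<close>

lemma indep_past_present:
  fixes X :: "nat \<Rightarrow> 'o \<Rightarrow> 'a::topological_space"
  assumes P: "prob_space P" and indep: "prob_space.indep_vars P (\<lambda>_. borel) X {1..}" and j: "1 \<le> j"
  shows "distr P (PiM {1..<j} (\<lambda>_. borel) \<Otimes>\<^sub>M borel) (\<lambda>\<omega>. (restrict (\<lambda>i. X i \<omega>) {1..<j}, X j \<omega>))
    = distr P (PiM {1..<j} (\<lambda>_. borel)) (\<lambda>\<omega>. restrict (\<lambda>i. X i \<omega>) {1..<j}) \<Otimes>\<^sub>M distr P borel (X j)"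
    and "(\<lambda>\<omega>. restrict (\<lambda>i. X i \<omega>) {1..<j}) \<in> P \<rightarrow>\<^sub>M PiM {1..<j} (\<lambda>_. borel)"
    and "X j \<in> P \<rightarrow>\<^sub>M borel"
proof -
  interpret prob_space P by fact
  have "indep_var (PiM {1..<j} (\<lambda>_. borel)) (\<lambda>\<omega>. restrict (\<lambda>i. X i \<omega>) {1..<j})
      (PiM {j} (\<lambda>_. borel)) (\<lambda>\<omega>. restrict (\<lambda>i. X i \<omega>) {j})"
    using j by (intro indep_var_restrict[OF indep]) auto
  then have V: "(\<lambda>\<omega>. restrict (\<lambda>i. X i \<omega>) {1..<j}) \<in> P \<rightarrow>\<^sub>M PiM {1..<j} (\<lambda>_. borel)"
    and W: "(\<lambda>\<omega>. restrict (\<lambda>i. X i \<omega>) {j}) \<in> P \<rightarrow>\<^sub>M PiM {j} (\<lambda>_. borel)"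
    and eq: "distr P (PiM {1..<j} (\<lambda>_. borel)) (\<lambda>\<omega>. restrict (\<lambda>i. X i \<omega>) {1..<j})
        \<Otimes>\<^sub>M distr P (PiM {j} (\<lambda>_. borel)) (\<lambda>\<omega>. restrict (\<lambda>i. X i \<omega>) {j})
      = distr P (PiM {1..<j} (\<lambda>_. borel) \<Otimes>\<^sub>M PiM {j} (\<lambda>_. borel))
          (\<lambda>\<omega>. (restrict (\<lambda>i. X i \<omega>) {1..<j}, restrict (\<lambda>i. X i \<omega>) {j}))"
    unfolding indep_var_distribution_eq by blast+
  have cj: "(\<lambda>x. x j) \<in> PiM {j} (\<lambda>_. borel) \<rightarrow>\<^sub>M (borel :: 'a measure)"
    by (intro measurable_component_singleton) simp
  show Xj: "X j \<in> P \<rightarrow>\<^sub>M borel"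
    using measurable_compose[OF W cj] by simp
  show "(\<lambda>\<omega>. restrict (\<lambda>i. X i \<omega>) {1..<j}) \<in> P \<rightarrow>\<^sub>M PiM {1..<j} (\<lambda>_. borel)" by (fact V)
  let ?V = "distr P (PiM {1..<j} (\<lambda>_. borel)) (\<lambda>\<omega>. restrict (\<lambda>i. X i \<omega>) {1..<j})"
  let ?W = "distr P (PiM {j} (\<lambda>_. borel)) (\<lambda>\<omega>. restrict (\<lambda>i. X i \<omega>) {j})"
  \<comment> \<open>The present is recovered as the only coordinate of the vector indexed by
    \<open>{j}\<close>.\<close>
  have XW: "distr P borel (X j) = distr ?W borel (\<lambda>x. x j)"
    using distr_distr[OF cj W] by (simp add: comp_def)
  have "prob_space (distr ?W borel (\<lambda>x. x j))"
    unfolding XW[symmetric] by (rule prob_space_distr[OF Xj])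
  then have "?V \<Otimes>\<^sub>M distr ?W borel (\<lambda>x. x j)
      = distr (?V \<Otimes>\<^sub>M ?W) (PiM {1..<j} (\<lambda>_. borel) \<Otimes>\<^sub>M borel) (\<lambda>(x, y). (x, y j))"
    using cj by (subst pair_measure_distr[symmetric]) (auto simp: prob_space_imp_sigma_finite distr_id2)
  also have "\<dots> = distr P (PiM {1..<j} (\<lambda>_. borel) \<Otimes>\<^sub>M borel) (\<lambda>\<omega>. (restrict (\<lambda>i. X i \<omega>) {1..<j}, X j \<omega>))"
    unfolding eq using V W cj by (subst distr_distr) (auto simp: comp_def)
  finally show "distr P (PiM {1..<j} (\<lambda>_. borel) \<Otimes>\<^sub>M borel) (\<lambda>\<omega>. (restrict (\<lambda>i. X i \<omega>) {1..<j}, X j \<omega>))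
      = ?V \<Otimes>\<^sub>M distr P borel (X j)"
    unfolding XW by simp
qed

lemma square_integrable_mult:
  fixes f g :: "'o \<Rightarrow> real"
  assumes [measurable]: "f \<in> borel_measurable P" "g \<in> borel_measurable P"
    and "integrable P (\<lambda>x. (f x)\<^sup>2)" "integrable P (\<lambda>x. (g x)\<^sup>2)"
  shows "integrable P (\<lambda>x. f x * g x)"
proof (rule Bochner_Integration.integrable_bound)
  show "integrable P (\<lambda>x. (f x)\<^sup>2 + (g x)\<^sup>2)" using assms by simp
  show "AE x in P. norm (f x * g x) \<le> norm ((f x)\<^sup>2 + (g x)\<^sup>2)"
  proof (rule AE_I2)
    fix x
    have "2 * (\<bar>f x\<bar> * \<bar>g x\<bar>) \<le> (f x)\<^sup>2 + (g x)\<^sup>2"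
      using sum_squares_bound[of "\<bar>f x\<bar>" "\<bar>g x\<bar>"] by simp
    moreover have "0 \<le> \<bar>f x\<bar> * \<bar>g x\<bar>" by simp
    ultimately show "norm (f x * g x) \<le> norm ((f x)\<^sup>2 + (g x)\<^sup>2)" unfolding real_norm_def abs_mult by linarith
  qed
qed measurable

text \<open>Each increment is a function of past and present whose integral over the present
  vanishes for every fixed past. In the product form of the law, the mixed term of an earlier sum
  with a later increment therefore integrates to 0, and squares add up.\<close>

lemma orthogonal_increments:
  fixes X :: "nat \<Rightarrow> 'o \<Rightarrow> 'a::topological_space"
    and \<phi> :: "nat \<Rightarrow> (nat \<Rightarrow> 'a) \<times> 'a \<Rightarrow> real"
  assumes P: "prob_space P" and indep: "prob_space.indep_vars P (\<lambda>_. borel) X {1..}"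
    and \<phi>: "\<And>j. 1 \<le> j \<Longrightarrow> j \<le> N \<Longrightarrow> \<phi> j \<in> borel_measurable (PiM {1..<j} (\<lambda>_. borel) \<Otimes>\<^sub>M borel)"
    and zero: "\<And>j x. 1 \<le> j \<Longrightarrow> j \<le> N \<Longrightarrow> (LINT y|distr P borel (X j). \<phi> j (x, y)) = 0"
    and sq: "\<And>j. 1 \<le> j \<Longrightarrow> j \<le> N \<Longrightarrow>
      integrable P (\<lambda>\<omega>. (\<phi> j (restrict (\<lambda>i. X i \<omega>) {1..<j}, X j \<omega>))\<^sup>2)"
  shows "integrable P (\<lambda>\<omega>. (\<Sum>j=1..N. \<phi> j (restrict (\<lambda>i. X i \<omega>) {1..<j}, X j \<omega>))\<^sup>2)"
    and "(LINT \<omega>|P. (\<Sum>j=1..N. \<phi> j (restrict (\<lambda>i. X i \<omega>) {1..<j}, X j \<omega>))\<^sup>2)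
      = (\<Sum>j=1..N. LINT \<omega>|P. (\<phi> j (restrict (\<lambda>i. X i \<omega>) {1..<j}, X j \<omega>))\<^sup>2)"
proof -
  interpret prob_space P by fact
  define Z where "Z j \<omega> = \<phi> j (restrict (\<lambda>i. X i \<omega>) {1..<j}, X j \<omega>)" for j \<omega>
  have Zm: "Z j \<in> borel_measurable P" if "1 \<le> j" "j \<le> N" for j
    unfolding Z_def using indep_past_present(2,3)[OF P indep that(1)] \<phi>[OF that]
    by (intro measurable_compose[OF _ \<phi>[OF that]] measurable_Pair) auto
  have "n \<le> N \<Longrightarrow> integrable P (\<lambda>\<omega>. (\<Sum>j=1..n. Z j \<omega>)\<^sup>2) \<and>
    (LINT \<omega>|P. (\<Sum>j=1..n. Z j \<omega>)\<^sup>2) = (\<Sum>j=1..n. LINT \<omega>|P. (Z j \<omega>)\<^sup>2)" for n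
  proof (induction n)
    case (Suc n)
    define S where "S \<omega> = (\<Sum>j=1..n. Z j \<omega>)" for \<omega>
    have Sm: "S \<in> borel_measurable P"
      unfolding S_def using Zm Suc.prems by (intro borel_measurable_sum) auto
    have N: "1 \<le> Suc n" "Suc n \<le> N" using Suc.prems by auto
    note ZSm = Zm[OF N]
    have IS: "integrable P (\<lambda>\<omega>. (S \<omega>)\<^sup>2)" using Suc unfolding S_def by simp
    have IZ: "integrable P (\<lambda>\<omega>. (Z (Suc n) \<omega>)\<^sup>2)" using sq[OF N] by (simp add: Z_def)
    have ISZ: "integrable P (\<lambda>\<omega>. S \<omega> * Z (Suc n) \<omega>)"
      by (rule square_integrable_mult[OF Sm ZSm IS IZ])
    let ?M = "PiM {1..<Suc n} (\<lambda>_. borel :: 'a measure)"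
    let ?V = "\<lambda>\<omega>. restrict (\<lambda>i. X i \<omega>) {1..<Suc n}"
    note pp = indep_past_present[OF P indep N(1)]
    \<comment> \<open>The partial sum as a function of the past vector: since
      \<open>j \<le> n\<close>, both \<open>restrict x {1..<j}\<close> and \<open>x j\<close> can be
      read off from a vector indexed by \<open>{1..<Suc n}\<close>.\<close>
    define s where "s x = (\<Sum>j=1..n. \<phi> j (restrict x {1..<j}, x j))" for x :: "nat \<Rightarrow> 'a"
    have sm: "s \<in> borel_measurable ?M"
      unfolding s_def
    proof (intro borel_measurable_sum)
      fix j assume j: "j \<in> {1..n}"
      then have jN: "1 \<le> j" "j \<le> N" using Suc.prems by auto
      have "(\<lambda>x. restrict x {1..<j}) \<in> ?M \<rightarrow>\<^sub>M PiM {1..<j} (\<lambda>_. borel)"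
        using j by (intro measurable_restrict_subset) auto
      moreover have "(\<lambda>x. x j) \<in> ?M \<rightarrow>\<^sub>M borel"
        using j by (intro measurable_component_singleton) auto
      ultimately show "(\<lambda>x. \<phi> j (restrict x {1..<j}, x j)) \<in> borel_measurable ?M"
        by (intro measurable_compose[OF _ \<phi>[OF jN]] measurable_Pair)
    qed
    have sV: "s (?V \<omega>) = S \<omega>" for \<omega>
      unfolding s_def S_def Z_def
      by (intro sum.cong refl arg_cong[where f="\<phi> _"]) (auto simp: restrict_def fun_eq_iff)
    have fm: "(\<lambda>p. s (fst p) * \<phi> (Suc n) p) \<in> borel_measurable (?M \<Otimes>\<^sub>M borel)"
      using \<phi>[OF N] measurable_compose[OF measurable_fst sm] by (intro borel_measurable_times) auto
    have VXm: "(\<lambda>\<omega>. (?V \<omega>, X (Suc n) \<omega>)) \<in> P \<rightarrow>\<^sub>M ?M \<Otimes>\<^sub>M borel"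
      using pp(2,3) by (rule measurable_Pair)
    interpret V: prob_space "distr P ?M ?V" using pp(2) by (rule prob_space_distr)
    interpret Y: prob_space "distr P borel (X (Suc n))" using pp(3) by (rule prob_space_distr)
    interpret VY: pair_prob_space "distr P ?M ?V" "distr P borel (X (Suc n))" ..
    have "integrable (distr P ?M ?V \<Otimes>\<^sub>M distr P borel (X (Suc n))) (\<lambda>p. s (fst p) * \<phi> (Suc n) p)"
      unfolding pp(1)[symmetric]
      using ISZ by (subst integrable_distr_eq[OF VXm fm]) (simp only: sV Z_def fst_conv)
    note VY.integral_fst'[OF this]
    then have "(LINT p|distr P (?M \<Otimes>\<^sub>M borel) (\<lambda>\<omega>. (?V \<omega>, X (Suc n) \<omega>)). s (fst p) * \<phi> (Suc n) p) = 0"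
      unfolding pp(1) by (simp add: zero[OF N])
    then have E0: "(LINT \<omega>|P. S \<omega> * Z (Suc n) \<omega>) = 0"
      by (subst (asm) integral_distr[OF VXm fm]) (simp only: sV Z_def fst_conv)
    have eq: "(\<Sum>j=1..Suc n. Z j \<omega>)\<^sup>2 = (S \<omega>)\<^sup>2 + 2 * (S \<omega> * Z (Suc n) \<omega>) + (Z (Suc n) \<omega>)\<^sup>2" for \<omega>
      by (simp add: S_def power2_sum)
    have "(LINT \<omega>|P. (\<Sum>j=1..Suc n. Z j \<omega>)\<^sup>2) = (LINT \<omega>|P. (S \<omega>)\<^sup>2) + (LINT \<omega>|P. (Z (Suc n) \<omega>)\<^sup>2)"
      unfolding eq using IS IZ ISZ E0 by simp
    then show ?case
      using Suc IS IZ ISZ unfolding eq by (simp add: S_def)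
  qed simp
  from this[of N] show "integrable P (\<lambda>\<omega>. (\<Sum>j=1..N. \<phi> j (restrict (\<lambda>i. X i \<omega>) {1..<j}, X j \<omega>))\<^sup>2)"
    and "(LINT \<omega>|P. (\<Sum>j=1..N. \<phi> j (restrict (\<lambda>i. X i \<omega>) {1..<j}, X j \<omega>))\<^sup>2)
      = (\<Sum>j=1..N. LINT \<omega>|P. (\<phi> j (restrict (\<lambda>i. X i \<omega>) {1..<j}, X j \<omega>))\<^sup>2)"
    by (simp_all add: Z_def)
qed

text \<open>Hoeffding's inequality for each partial sum, with the threshold
  \<open>\<delta> * N\<close> even for small \<open>i\<close>, followed by a union bound; the
  exponential rate absorbs the number \<open>N\<close> of events.\<close>

lemma uniform_weak_law:
  fixes X :: "nat \<Rightarrow> 'o \<Rightarrow> 'a::topological_space" and f :: "'a \<Rightarrow> real"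
  assumes P: "prob_space P" and indep: "prob_space.indep_vars P (\<lambda>_. borel) X {1..}"
    and f: "f \<in> borel_measurable borel" "\<And>x. 0 \<le> f x" "\<And>x. f x \<le> 1" and \<delta>: "0 < \<delta>"
  shows "(\<lambda>N. measure P {\<omega>\<in>space P. \<exists>i\<le>N.
      \<delta> * real N \<le> \<bar>\<Sum>j=1..i. f (X j \<omega>) - (LINT \<omega>|P. f (X j \<omega>))\<bar>}) \<longlonglongrightarrow> 0"
proof -
  interpret prob_space P by fact
  have Xm: "X j \<in> P \<rightarrow>\<^sub>M borel" if "1 \<le> j" for j
    using indep that by (simp add: indep_vars_def2)
  have fm: "(\<lambda>\<omega>. f (X j \<omega>)) \<in> borel_measurable P" if "1 \<le> j" for j
    using measurable_compose[OF Xm[OF that] f(1)] .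
  define E where "E N i = {\<omega>\<in>space P. \<delta> * real N \<le> \<bar>\<Sum>j=1..i. f (X j \<omega>) - (LINT \<omega>|P. f (X j \<omega>))\<bar>}" for N i
  have Em: "E N i \<in> events" for N i
  proof -
    have "(\<lambda>\<omega>. \<Sum>j=1..i. f (X j \<omega>) - (LINT \<omega>|P. f (X j \<omega>))) \<in> borel_measurable P"
      using fm by (intro borel_measurable_sum borel_measurable_diff) auto
    then show ?thesis unfolding E_def by measurable
  qed
  have single: "prob (E N i) \<le> 2 * exp (-2 * \<delta>\<^sup>2 * real N)" if i: "1 \<le> i" "i \<le> N" for i N
  proof -
    have "indep_vars (\<lambda>_. borel) X {1..i}" using indep by (rule indep_vars_subset) auto
    then have "indep_vars (\<lambda>_. borel) (\<lambda>j \<omega>. f (X j \<omega>)) {1..i}"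
      by (rule indep_vars_compose2) (use f in simp)
    then interpret H: Hoeffding_ineq P "{1..i}" "\<lambda>j \<omega>. f (X j \<omega>)" "\<lambda>_. 0" "\<lambda>_. 1"
      "\<Sum>j\<in>{1..i}. expectation (\<lambda>\<omega>. f (X j \<omega>))"
      by unfold_locales (use f in auto)
    have "prob (E N i) \<le> 2 * exp (-2 * (\<delta> * real N)\<^sup>2 / (\<Sum>j\<in>{1..i}. (1 - 0)\<^sup>2))"
      unfolding E_def sum_subtractf using \<delta> i by (intro H.Hoeffding_ineq_abs_ge) auto
    also have "\<dots> \<le> 2 * exp (-2 * \<delta>\<^sup>2 * real N)"
    proof -
      have "\<delta>\<^sup>2 * real N * real i \<le> \<delta>\<^sup>2 * real N * real N" using i by (intro mult_left_mono) auto
      then have "\<delta>\<^sup>2 * real N \<le> (\<delta> * real N)\<^sup>2 / real i"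
        using i by (simp add: pos_le_divide_eq power2_eq_square mult_ac)
      then show ?thesis by simp
    qed
    finally show ?thesis .
  qed
  have bound: "prob {\<omega>\<in>space P. \<exists>i\<le>N. \<delta> * real N \<le> \<bar>\<Sum>j=1..i. f (X j \<omega>) - (LINT \<omega>|P. f (X j \<omega>))\<bar>}
      \<le> 2 * (real N * exp (-2 * \<delta>\<^sup>2 * real N))" if N: "0 < N" for N
  proof -
    \<comment> \<open>The empty sum is 0 and the threshold positive, so the union runs over
      \<open>{1..N}\<close>, where Hoeffding's inequality applies.\<close>
    have "E N 0 = {}" using \<delta> N by (auto simp: E_def not_le)
    have "{\<omega>\<in>space P. \<exists>i\<le>N. \<delta> * real N \<le> \<bar>\<Sum>j=1..i. f (X j \<omega>) - (LINT \<omega>|P. f (X j \<omega>))\<bar>} = (\<Union>i\<in>{..N}. E N i)"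
      by (auto simp: E_def)
    also have "{..N} = insert 0 {1..N}" by auto
    also have "(\<Union>i\<in>insert 0 {1..N}. E N i) = (\<Union>i\<in>{1..N}. E N i)"
      using \<open>E N 0 = {}\<close> by simp
    also have "prob \<dots> \<le> (\<Sum>i=1..N. prob (E N i))"
      using Em by (intro finite_measure_subadditive_finite) auto
    also have "\<dots> \<le> (\<Sum>i=1..N. 2 * exp (-2 * \<delta>\<^sup>2 * real N))"
      by (intro sum_mono single) auto
    finally show ?thesis by simp
  qed
  have "(\<lambda>N. 2 * (real N * exp (-2 * \<delta>\<^sup>2 * real N))) \<longlonglongrightarrow> 0"
    using \<delta> by real_asymp
  then show ?thesis
  proof (rule tendsto_sandwich[OF _ _ tendsto_const, rotated 2])
    show "\<forall>\<^sub>F N in sequentially. prob {\<omega>\<in>space P. \<exists>i\<le>N.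
        \<delta> * real N \<le> \<bar>\<Sum>j=1..i. f (X j \<omega>) - (LINT \<omega>|P. f (X j \<omega>))\<bar>}
        \<le> 2 * (real N * exp (-2 * \<delta>\<^sup>2 * real N))"
      using eventually_gt_at_top[of 0] by eventually_elim (rule bound)
  qed simp
qed

section \<open>Growth functions\<close>

lemma norm_pow_half_square: "0 \<le> l \<Longrightarrow> (norm_pow (l / 2) x)\<^sup>2 = norm_pow l x"
  by (auto simp: norm_pow_def power2_eq_square powr_add[symmetric])

lemma growth_square: "0 \<le> l \<Longrightarrow> (1 + norm_pow (l / 2) x)\<^sup>2 \<le> 2 * (1 + norm_pow l x)"
  using norm_pow_half_square[of l x] sum_squares_bound[of 1 "norm_pow (l / 2) x"]
  by (simp add: power2_sum)

lemma norm_pow_half_le: "0 \<le> l \<Longrightarrow> norm_pow (l / 2) x \<le> 1 + norm_pow l x"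
proof -
  assume "0 \<le> l"
  then have "2 * norm_pow (l / 2) x \<le> 1 + norm_pow l x"
    using norm_pow_half_square[of l x] sum_squares_bound[of 1 "norm_pow (l / 2) x"] by simp
  then show ?thesis using norm_pow_nonneg[of "l / 2" x] by linarith
qed

lemma norm_pow_Pair_le:
  fixes z :: "'a::euclidean_space \<times> 'b::euclidean_space"
  assumes l: "0 \<le> l"
  shows "norm_pow l z \<le> 2 powr l * (norm_pow l (fst z) + norm_pow l (snd z))"
proof (cases "l = 0")
  case False
  have "norm z \<le> 2 * max (norm (fst z)) (norm (snd z))"
    using norm_Pair_le[of "fst z" "snd z"] by simp
  then have "norm z powr l \<le> (2 * max (norm (fst z)) (norm (snd z))) powr l"
    using l by (intro powr_mono2) auto
  also have "\<dots> = 2 powr l * max (norm (fst z)) (norm (snd z)) powr l"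
    by (simp add: powr_mult)
  also have "\<dots> \<le> 2 powr l * (norm (fst z) powr l + norm (snd z) powr l)"
    by (intro mult_left_mono) (auto simp: max_def)
  finally show ?thesis using False by (simp add: norm_pow_def)
qed (simp add: norm_pow_def)

lemma pair_measure_prob_moment:
  fixes m n :: "'a::euclidean_space measure"
  assumes l: "0 \<le> l" and m: "m \<in> prob_moment l" and n: "n \<in> prob_moment l"
  shows "m \<Otimes>\<^sub>M n \<in> prob_moment l"
proof -
  note c = pair_measure_coupling[OF m n]
  have s: "sets (m \<Otimes>\<^sub>M n) = sets borel" using c by (simp add: couplings_def)
  have "integrable (m \<Otimes>\<^sub>M n) (norm_pow l)"
  proof (rule Bochner_Integration.integrable_bound)
    show "integrable (m \<Otimes>\<^sub>M n) (\<lambda>z. 2 powr l * (norm_pow l (fst z) + norm_pow l (snd z)))"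
      using coupling_integral[OF c, of "norm_pow l"] prob_momentD(4)[OF m] prob_momentD(4)[OF n] by simp
    show "norm_pow l \<in> borel_measurable (m \<Otimes>\<^sub>M n)"
      using s by (simp cong: measurable_cong_sets)
    show "AE z in m \<Otimes>\<^sub>M n. norm (norm_pow l z) \<le> norm (2 powr l * (norm_pow l (fst z) + norm_pow l (snd z)))"
      using norm_pow_Pair_le[OF l] by (intro AE_I2) simp
  qed
  then show ?thesis using c s by (simp add: prob_moment_def couplings_def)
qed

text \<open>Truncation at level \<open>A\<close> splits \<open>Z\<close> into a small part
  \<open>S\<close> and a large part \<open>T\<close>. The centred small part is at most
  \<open>2 * A\<close>, so if the centred variable exceeds \<open>4 * A\<close>, at least half of it
  comes from \<open>T\<close>. The factor 4 in the bound is the square of this 2, and the variance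
  of \<open>T\<close> is at most its second moment.\<close>

lemma centered_truncation:
  fixes Z :: "'o \<Rightarrow> real"
  assumes P: "prob_space P" and Z [measurable]: "Z \<in> borel_measurable P" and sq: "integrable P (\<lambda>\<omega>. (Z \<omega>)\<^sup>2)" and A: "0 \<le> A"
  shows "(LINT \<omega>|P. (Z \<omega> - (LINT \<omega>|P. Z \<omega>))\<^sup>2 * indicator {\<omega>. 4 * A < \<bar>Z \<omega> - (LINT \<omega>|P. Z \<omega>)\<bar>} \<omega>)
    \<le> 4 * (LINT \<omega>|P. (Z \<omega>)\<^sup>2 * indicator {\<omega>. A < \<bar>Z \<omega>\<bar>} \<omega>)"
proof -
  interpret prob_space P by fact
  define S where "S \<omega> = (if A < \<bar>Z \<omega>\<bar> then 0 else Z \<omega>)" for \<omega>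
  define T where "T \<omega> = (if A < \<bar>Z \<omega>\<bar> then Z \<omega> else 0)" for \<omega>
  have [measurable]: "S \<in> borel_measurable P" "T \<in> borel_measurable P" unfolding S_def T_def by measurable
  have Zi: "integrable P Z" by (rule square_integrable_imp_integrable[OF Z sq])
  have SA: "\<bar>S \<omega>\<bar> \<le> A" for \<omega> using A by (simp add: S_def)
  have Si: "integrable P S" using SA by (intro integrable_const_bound[where B=A]) auto
  have Ti: "integrable P T" by (rule Bochner_Integration.integrable_bound[OF Zi]) (auto simp: T_def)
  have T2i: "integrable P (\<lambda>\<omega>. (T \<omega>)\<^sup>2)" by (rule Bochner_Integration.integrable_bound[OF sq]) (auto simp: T_def)
  have ES: "\<bar>expectation S\<bar> \<le> A"
    by (rule order_trans[OF integral_abs_bound integral_le_const]) (use Si SA in auto)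
  have EZ: "expectation Z = expectation S + expectation T"
    using Si Ti by (subst Bochner_Integration.integral_add[symmetric]) (auto simp: S_def T_def intro!: Bochner_Integration.integral_cong)
  have pw: "(Z \<omega> - expectation Z)\<^sup>2 * indicator {\<omega>. 4 * A < \<bar>Z \<omega> - expectation Z\<bar>} \<omega> \<le> 4 * (T \<omega> - expectation T)\<^sup>2" for \<omega>
  proof (cases "4 * A < \<bar>Z \<omega> - expectation Z\<bar>")
    case True
    have "Z \<omega> - expectation Z = (S \<omega> - expectation S) + (T \<omega> - expectation T)"
      by (simp add: EZ S_def T_def)
    then have "\<bar>Z \<omega> - expectation Z\<bar> \<le> \<bar>S \<omega> - expectation S\<bar> + \<bar>T \<omega> - expectation T\<bar>"
      using abs_triangle_ineq by simp
    moreover have "\<bar>S \<omega> - expectation S\<bar> \<le> 2 * A" using SA[of \<omega>] ES by linarith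
    moreover have "a \<le> 2 * c" if "a \<le> b + c" "b \<le> 2 * A" "4 * A < a" for a b c :: real
      using that by linarith
    ultimately have "\<bar>Z \<omega> - expectation Z\<bar> \<le> 2 * \<bar>T \<omega> - expectation T\<bar>" using True by blast
    then have "\<bar>Z \<omega> - expectation Z\<bar>\<^sup>2 \<le> (2 * \<bar>T \<omega> - expectation T\<bar>)\<^sup>2" by (intro power_mono) auto
    then show ?thesis by (simp add: power_mult_distrib indicator_def)
  qed simp
  have i4: "integrable P (\<lambda>\<omega>. 4 * (T \<omega> - expectation T)\<^sup>2)"
    using T2i Ti by (simp add: power2_diff)
  have "(LINT \<omega>|P. (Z \<omega> - expectation Z)\<^sup>2 * indicator {\<omega>. 4 * A < \<bar>Z \<omega> - expectation Z\<bar>} \<omega>)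
      \<le> (LINT \<omega>|P. 4 * (T \<omega> - expectation T)\<^sup>2)"
    using i4 pw by (intro integral_mono') auto
  also have "\<dots> = 4 * (expectation (\<lambda>\<omega>. (T \<omega>)\<^sup>2) - (expectation T)\<^sup>2)"
    using T2i Ti by (simp add: variance_eq)
  also have "\<dots> \<le> 4 * expectation (\<lambda>\<omega>. (T \<omega>)\<^sup>2)" by simp
  also have "expectation (\<lambda>\<omega>. (T \<omega>)\<^sup>2) = (LINT \<omega>|P. (Z \<omega>)\<^sup>2 * indicator {\<omega>. A < \<bar>Z \<omega>\<bar>} \<omega>)"
    by (intro Bochner_Integration.integral_cong) (auto simp: T_def indicator_def)
  finally show ?thesis .
qed

section \<open>Nonlinear functionals of empirical measures\<close>

text \<open>The constants of the growth and Hoelder conditions are parameters here. They may always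
  be enlarged, so \<open>Cg\<close> is taken positive and \<open>Ch\<close> nonnegative.\<close>

locale nonlinear_clt = prob_space P for P :: "'o measure" +
  fixes l r :: real and X :: "nat \<Rightarrow> 'o \<Rightarrow> 'a::euclidean_space"
    and \<nu> :: "nat \<Rightarrow> 'a measure" and \<mu> :: "'a measure" and \<eta> :: "('a \<times> 'a) measure"
    and \<sigma> :: "'a set \<Rightarrow> real" and U :: "'a measure \<Rightarrow> real" and D :: "'a measure \<Rightarrow> 'a \<Rightarrow> real"
    and Cg \<alpha> Ch :: real
  assumes l: "0 \<le> l"
    and indep: "indep_vars (\<lambda>_. borel) X {1..}"
    and law: "\<And>i. 1 \<le> i \<Longrightarrow> distr P borel (X i) = \<nu> i"
    and \<nu>: "\<And>i. 1 \<le> i \<Longrightarrow> \<nu> i \<in> prob_moment l"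
    and \<mu>: "\<mu> \<in> prob_moment l"
    and U_measurable: "U \<in> borel_measurable (prob_moment_space l)"
    and \<eta>: "\<eta> \<in> prob_moment l"
    and \<eta>_fst: "distr \<eta> borel fst = \<mu>" and \<eta>_snd: "distr \<eta> borel snd = \<mu>"
    and conv_\<eta>: "(\<lambda>N. wasserstein l (average_measure N (\<lambda>i. \<nu> i \<Otimes>\<^sub>M \<nu> i)) \<eta>) \<longlonglongrightarrow> 0"
    and \<sigma>: "\<sigma> \<in> signed_moment l"
    and conv_\<sigma>: "(\<lambda>N. weighted_norm l
          (\<lambda>A. sqrt (real N) * measure_diff (average_measure N \<nu>) \<mu> A - \<sigma> A)) \<longlonglongrightarrow> 0"
    and r: "0 < r"
    and deriv: "\<And>m. m \<in> wasserstein_ball l \<mu> r \<Longrightarrow> has_linear_functional_derivative l U (D m) m"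
    and growth: "\<And>m x. m \<in> wasserstein_ball l \<mu> r \<Longrightarrow> \<bar>D m x\<bar> \<le> Cg * (1 + norm_pow (l / 2) x)"
    and Cg: "0 < Cg"
    and cont_at_\<mu>:
      "\<forall>\<epsilon>>0. \<exists>\<delta>>0. \<forall>m\<in>wasserstein_ball l \<mu> r. wasserstein l m \<mu> < \<delta> \<longrightarrow>
         (SUP x. \<bar>D m x - D \<mu> x\<bar> / (1 + norm_pow (l / 2) x)) < \<epsilon>"
    and cont_ae: "AE x in \<mu>. isCont (D \<mu>) x"
    and \<alpha>: "1 / 2 < \<alpha>" "\<alpha> \<le> 1" and Ch: "0 \<le> Ch"
    and hoelder: "\<And>m\<^sub>1 m\<^sub>2 x. m\<^sub>1 \<in> wasserstein_ball l \<mu> r \<Longrightarrow> m\<^sub>2 \<in> wasserstein_ball l \<mu> r \<Longrightarrow>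
            \<bar>D m\<^sub>2 x - D m\<^sub>1 x\<bar> \<le>
              Ch * ((1 + norm_pow l x) * tv_norm (measure_diff m\<^sub>2 m\<^sub>1) powr \<alpha> +
                   (1 + norm_pow (l * (1 - \<alpha>)) x) *
                     (LINT y|total_variation (measure_diff m\<^sub>2 m\<^sub>1). norm_pow l y) powr \<alpha>)"
begin

section \<open>Growth bounds and convergence of the averaged laws\<close>

definition "wball = wasserstein_ball l \<mu> r"
definition "f = D \<mu>"
definition "nubar N = average_measure N \<nu>"
definition "wn N = weighted_norm l (\<lambda>A. sqrt (real N) * measure_diff (average_measure N \<nu>) \<mu> A - \<sigma> A)"

lemma D_measurable: "m \<in> wball \<Longrightarrow> D m \<in> borel_measurable borel"
  using deriv by (auto simp: wball_def has_linear_functional_derivative_def)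

text \<open>Converts growth of order \<open>l / 2\<close>, as assumed for \<open>D\<close>, into
  growth of order \<open>l\<close>, the form that integrability and \<open>weighted_norm\<close> ask
  for.\<close>

lemma growth_l: "0 \<le> c \<Longrightarrow> \<bar>y\<bar> \<le> c * (1 + norm_pow (l / 2) x) \<Longrightarrow> \<bar>y\<bar> \<le> 2 * c * (1 + norm_pow l x)"
proof -
  assume c: "0 \<le> c" and y: "\<bar>y\<bar> \<le> c * (1 + norm_pow (l / 2) x)"
  have "c * (1 + norm_pow (l / 2) x) \<le> c * (2 * (1 + norm_pow l x))"
  proof (rule mult_left_mono[OF _ c])
    show "1 + norm_pow (l / 2) x \<le> 2 * (1 + norm_pow l x)"
      using norm_pow_half_le[OF l, of x] norm_pow_nonneg[of l x] unfolding distrib_left by linarith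
  qed
  then show ?thesis using y by (simp add: algebra_simps)
qed

lemma D_growth: "m \<in> wball \<Longrightarrow> \<bar>D m x\<bar> \<le> 2 * Cg * (1 + norm_pow l x)"
  using growth Cg by (intro growth_l) (auto simp: wball_def)

lemma D_integrable: "m \<in> wball \<Longrightarrow> n \<in> prob_moment l \<Longrightarrow> integrable n (D m)"
  using prob_moment_integrable[OF _ D_measurable D_growth] by blast

lemma nubar: "0 < N \<Longrightarrow> nubar N \<in> prob_moment l"
  unfolding nubar_def using \<nu> by (intro average_measure_prob_moment) auto

lemma integral_nubar:
  assumes "g \<in> borel_measurable borel" "\<And>x. \<bar>g x\<bar> \<le> K * (1 + norm_pow l x)"
  shows "(LINT x|nubar N. g x) = (\<Sum>i=1..N. LINT x|\<nu> i. g x) / real N"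
  unfolding nubar_def using \<nu> assms by (intro integral_average_measure) auto

text \<open>The signed measure inside \<open>wn\<close> is written as a difference of finite
  measures by adding the negative variation of \<sigma> to the scaled averaged law and the positive
  variation to the scaled \<mu>. The bound is uniform over all \<open>g\<close> of the given growth,
  so \<open>g\<close> may depend on \<open>N\<close>.\<close>

lemma nubar_bound:
  assumes N: "0 < N" and g: "g \<in> borel_measurable borel"
    and K: "0 \<le> K" "\<And>x. \<bar>g x\<bar> \<le> K * (1 + norm_pow l x)"
  shows "\<bar>sqrt (real N) * ((LINT x|nubar N. g x) - (LINT x|\<mu>. g x)) - signed_integral \<sigma> g\<bar> \<le> K * wn N"
proof -
  let ?p = "pos_variation \<sigma>" and ?n = "neg_variation \<sigma>"
  note s = signed_momentD[OF \<sigma>]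
  note p = sets_pos_variation[OF s(1)] finite_pos_variation[OF s(1)]
  note n = neg_variation[OF s(1)]
  note nb = prob_momentD[OF nubar[OF N]] and m = prob_momentD[OF \<mu>]
  let ?c = "\<lambda>b. if b then sqrt (real N) else 1"
  let ?MP = "\<lambda>b. if b then nubar N else ?n" and ?MQ = "\<lambda>b. if b then \<mu> else ?p"
  define Pp where "Pp = weighted_sum_measure UNIV ?c ?MP"
  define Q where "Q = weighted_sum_measure UNIV ?c ?MQ"
  have sets: "\<And>b. sets (?MP b) = sets borel" "\<And>b. sets (?MQ b) = sets borel"
    and fin: "\<And>b. finite_measure (?MP b)" "\<And>b. finite_measure (?MQ b)"
    using p n nb m by auto
  have fP: "finite_measure Pp" "sets Pp = sets borel" "finite_measure Q" "sets Q = sets borel"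
    unfolding Pp_def Q_def using sets fin by (auto intro!: finite_weighted_sum_measure)
  have \<tau>: "\<forall>A\<in>sets borel. sqrt (real N) * measure_diff (average_measure N \<nu>) \<mu> A - \<sigma> A = measure Pp A - measure Q A"
  proof
    fix A :: "'a set" assume A: "A \<in> sets borel"
    have "measure Pp A = sqrt (real N) * measure (nubar N) A + measure ?n A"
      unfolding Pp_def using sets fin A by (subst measure_weighted_sum_measure) (auto simp: sum_bool)
    moreover have "measure Q A = sqrt (real N) * measure \<mu> A + measure ?p A"
      unfolding Q_def using sets fin A by (subst measure_weighted_sum_measure) (auto simp: sum_bool)
    ultimately show "sqrt (real N) * measure_diff (average_measure N \<nu>) \<mu> A - \<sigma> A = measure Pp A - measure Q A"
      using jordan_decomposition[OF s(1) A] by (simp add: measure_diff_def nubar_def algebra_simps)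
  qed
  have int: "integrable (?MP b) h" "integrable (?MQ b) h"
    if "h \<in> borel_measurable borel" "\<And>x. \<bar>h x\<bar> \<le> K' * (1 + norm_pow l x)" for h K' b
    using prob_moment_integrable[OF nubar[OF N] that] prob_moment_integrable[OF \<mu> that]
      integrable_growth[OF n(2,1) s(3) that] integrable_growth[OF p(2,1) s(2) that] by auto
  have "\<bar>norm_pow l x\<bar> \<le> 1 * (1 + norm_pow l x)" for x :: 'a by simp
  note in1 = int[OF norm_pow_measurable this]
  have "\<bar>(LINT x|Pp. g x) - (LINT x|Q. g x)\<bar> \<le> K * wn N"
    unfolding wn_def
  proof (rule weighted_norm_bound[OF fP \<tau>])
    show "integrable Pp (norm_pow l)" "integrable Q (norm_pow l)"
      unfolding Pp_def Q_def using sets in1 by (auto intro!: integrable_weighted_sum_measure)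
  qed (use g K in auto)
  also have "(LINT x|Pp. g x) = sqrt (real N) * (LINT x|nubar N. g x) + (LINT x|?n. g x)"
    unfolding Pp_def using sets int[OF g K(2)] g by (subst integral_weighted_sum_measure) (auto simp: sum_bool)
  also have "(LINT x|Q. g x) = sqrt (real N) * (LINT x|\<mu>. g x) + (LINT x|?p. g x)"
    unfolding Q_def using sets int[OF g K(2)] g by (subst integral_weighted_sum_measure) (auto simp: sum_bool)
  finally show ?thesis by (simp add: signed_integral_def algebra_simps)
qed

lemma wn: "wn \<longlonglongrightarrow> 0"
  using conv_\<sigma> by (simp add: wn_def[abs_def])

text \<open>The deviation is of order \<open>1 / sqrt N\<close>. Convergence holds for every
  measurable \<open>g\<close> of growth \<open>l\<close>, including discontinuous ones such as
  indicators of cells and truncations.\<close>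

lemma nubar_tendsto:
  assumes g: "g \<in> borel_measurable borel" and K: "0 \<le> K" "\<And>x. \<bar>g x\<bar> \<le> K * (1 + norm_pow l x)"
  shows "(\<lambda>N. LINT x|nubar N. g x) \<longlonglongrightarrow> (LINT x|\<mu>. g x)"
proof -
  have b: "\<bar>(LINT x|nubar N. g x) - (LINT x|\<mu>. g x)\<bar> \<le> (K * wn N + \<bar>signed_integral \<sigma> g\<bar>) / sqrt (real N)"
    if N: "0 < N" for N
  proof -
    have "sqrt (real N) * \<bar>(LINT x|nubar N. g x) - (LINT x|\<mu>. g x)\<bar>
        = \<bar>sqrt (real N) * ((LINT x|nubar N. g x) - (LINT x|\<mu>. g x))\<bar>" by (simp add: abs_mult)
    also have "\<dots> \<le> K * wn N + \<bar>signed_integral \<sigma> g\<bar>" using nubar_bound[OF N g K] by linarith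
    finally show ?thesis using N by (simp add: pos_le_divide_eq mult.commute)
  qed
  have "(\<lambda>N. (K * wn N + \<bar>signed_integral \<sigma> g\<bar>) / sqrt (real N)) \<longlonglongrightarrow> 0"
  proof (rule real_tendsto_divide_at_top)
    show "(\<lambda>N. K * wn N + \<bar>signed_integral \<sigma> g\<bar>) \<longlonglongrightarrow> K * 0 + \<bar>signed_integral \<sigma> g\<bar>"
      by (intro tendsto_intros wn)
    show "filterlim (\<lambda>N. sqrt (real N)) at_top sequentially"
      by (intro filterlim_compose[OF sqrt_at_top] filterlim_real_sequentially)
  qed
  moreover have "\<forall>\<^sub>F N in sequentially. norm ((LINT x|nubar N. g x) - (LINT x|\<mu>. g x))
      \<le> (K * wn N + \<bar>signed_integral \<sigma> g\<bar>) / sqrt (real N)"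
    using eventually_gt_at_top[of 0] by eventually_elim (use b in simp)
  ultimately have "(\<lambda>N. (LINT x|nubar N. g x) - (LINT x|\<mu>. g x)) \<longlonglongrightarrow> 0"
    by (rule Lim_null_comparison[rotated])
  then show ?thesis by (rule LIM_zero_cancel)
qed

lemma f_measurable: "\<mu> \<in> wball \<Longrightarrow> f \<in> borel_measurable borel"
  unfolding f_def by (rule D_measurable)

section \<open>Neighbourhoods of \<mu> in terms of cells and tails\<close>

definition "cells_close C K \<delta> m \<longleftrightarrow> (\<forall>k<K. \<bar>measure m (C k) - measure \<mu> (C k)\<bar> \<le> \<delta>)"
  for C :: "nat \<Rightarrow> 'a set" and K :: nat
definition "tail C K x = norm_pow l x * indicator (- (\<Union>k<K. C k)) x"
  for C :: "nat \<Rightarrow> 'a set" and K :: nat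
text \<open>Takes the place of a Wasserstein ball: a condition on finitely many integrals, hence
  stable under mixtures and measurable along a random path of measures.\<close>

definition "good C K \<delta> \<theta> m \<longleftrightarrow> cells_close C K \<delta> m \<and> (LINT x|m. tail C K x) \<le> \<theta>"

lemma tail_props:
  assumes "\<And>k. C k \<in> sets borel"
  shows "tail C K \<in> borel_measurable borel" "\<bar>tail C K x\<bar> \<le> 1 * (1 + norm_pow l x)" "0 \<le> tail C K x"
proof -
  have "- (\<Union>k<K. C k) \<in> sets borel" using assms by (intro borel_comp sets.finite_UN) auto
  then show "tail C K \<in> borel_measurable borel" unfolding tail_def[abs_def] by measurable
qed (auto simp: tail_def indicator_def)

text \<open>That \<mu> has distance less than \<open>r\<close> from itself is read off from the cell
  criterion with \<kappa> = \<theta>.\<close>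

lemma \<mu>_wball: "\<mu> \<in> wball"
proof -
  obtain \<theta> where \<theta>: "0 < \<theta>" and *:
    "\<And>\<kappa>. 0 < \<kappa> \<Longrightarrow> \<exists>K C \<delta>. 0 < \<delta> \<and> (\<forall>k. C k \<in> sets borel) \<and>
       (LINT x|\<mu>. norm_pow l x * indicator (- (\<Union>k<K::nat. C k)) x) \<le> \<kappa> \<and>
       (\<forall>m\<in>prob_moment l.
          (\<forall>k<K. \<bar>measure m (C k) - measure \<mu> (C k)\<bar> \<le> \<delta>) \<longrightarrow>
          (LINT x|m. norm_pow l x * indicator (- (\<Union>k<K. C k)) x) \<le> \<theta> \<longrightarrow>
          wasserstein l m \<mu> < r)"
    using wasserstein_small[OF l \<mu> r] by blast
  have "wasserstein l \<mu> \<mu> < r" using *[OF \<theta>] \<mu> by fastforce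
  then show ?thesis using \<mu> by (simp add: wball_def wasserstein_ball_def)
qed

text \<open>Combines membership in the ball with the continuity of \<open>D\<close> at \<mu>. The
  growth bound shows that the supremum in the continuity hypothesis is over a bounded set, so that
  it really bounds each value. The freedom to choose \<kappa> after \<theta> is passed on.\<close>

lemma neighbourhood:
  assumes \<epsilon>: "0 < \<epsilon>"
  obtains \<theta> where "0 < \<theta>" and
    "\<And>\<kappa>. 0 < \<kappa> \<Longrightarrow> \<exists>K C \<delta>. 0 < \<delta> \<and> (\<forall>k. C k \<in> sets borel) \<and> (LINT x|\<mu>. tail C K x) \<le> \<kappa> \<and>
       (\<forall>m\<in>prob_moment l. good C K \<delta> \<theta> m \<longrightarrow>
          m \<in> wball \<and> (\<forall>x. \<bar>D m x - f x\<bar> \<le> \<epsilon> * (1 + norm_pow (l / 2) x)))"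
proof -
  obtain \<delta>0 where \<delta>0: "0 < \<delta>0" "\<And>m. m \<in> wball \<Longrightarrow> wasserstein l m \<mu> < \<delta>0 \<Longrightarrow>
         (SUP x. \<bar>D m x - D \<mu> x\<bar> / (1 + norm_pow (l / 2) x)) < \<epsilon>"
    using cont_at_\<mu> \<epsilon> unfolding wball_def by metis
  have m0: "0 < min r \<delta>0" using r \<delta>0 by simp
  have close: "m \<in> wball \<and> (\<forall>x. \<bar>D m x - f x\<bar> \<le> \<epsilon> * (1 + norm_pow (l / 2) x))"
    if m: "m \<in> prob_moment l" and W: "wasserstein l m \<mu> < min r \<delta>0" for m
  proof -
    have mb: "m \<in> wball" using m W by (simp add: wball_def wasserstein_ball_def)
    have pos: "0 < 1 + norm_pow (l / 2) x" for x :: 'a by (simp add: add_pos_nonneg)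
    have "bdd_above (range (\<lambda>x. \<bar>D m x - D \<mu> x\<bar> / (1 + norm_pow (l / 2) x)))"
    proof (rule bdd_aboveI2[where M = "2 * Cg"])
      fix x
      have "\<bar>D m x - D \<mu> x\<bar> \<le> 2 * Cg * (1 + norm_pow (l / 2) x)"
        using growth[of m x] growth[of \<mu> x] mb \<mu>_wball unfolding wball_def by linarith
      then show "\<bar>D m x - D \<mu> x\<bar> / (1 + norm_pow (l / 2) x) \<le> 2 * Cg"
        using pos[of x] by (simp add: pos_divide_le_eq)
    qed
    then have "\<bar>D m x - D \<mu> x\<bar> / (1 + norm_pow (l / 2) x) \<le> \<epsilon>" for x
      using cSUP_upper[OF UNIV_I, of "\<lambda>x. \<bar>D m x - D \<mu> x\<bar> / (1 + norm_pow (l / 2) x)" x] \<delta>0(2)[OF mb] W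
      by fastforce
    then show ?thesis using mb pos by (simp add: pos_divide_le_eq f_def)
  qed
  obtain \<theta> where \<theta>: "0 < \<theta>" and *:
    "\<And>\<kappa>. 0 < \<kappa> \<Longrightarrow> \<exists>K C \<delta>. 0 < \<delta> \<and> (\<forall>k. C k \<in> sets borel) \<and>
       (LINT x|\<mu>. norm_pow l x * indicator (- (\<Union>k<K::nat. C k)) x) \<le> \<kappa> \<and>
       (\<forall>m\<in>prob_moment l.
          (\<forall>k<K. \<bar>measure m (C k) - measure \<mu> (C k)\<bar> \<le> \<delta>) \<longrightarrow>
          (LINT x|m. norm_pow l x * indicator (- (\<Union>k<K. C k)) x) \<le> \<theta> \<longrightarrow>
          wasserstein l m \<mu> < min r \<delta>0)"
    using wasserstein_small[OF l \<mu> m0] by blast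
  show ?thesis
  proof (rule that[OF \<theta>])
    fix \<kappa> :: real assume "0 < \<kappa>"
    from *[OF this] obtain K C \<delta> where **: "0 < \<delta>" "\<forall>k. C k \<in> sets borel"
       "(LINT x|\<mu>. norm_pow l x * indicator (- (\<Union>k<K::nat. C k)) x) \<le> \<kappa>"
       "\<And>m. m\<in>prob_moment l \<Longrightarrow>
          (\<forall>k<K. \<bar>measure m (C k) - measure \<mu> (C k)\<bar> \<le> \<delta>) \<Longrightarrow>
          (LINT x|m. norm_pow l x * indicator (- (\<Union>k<K. C k)) x) \<le> \<theta> \<Longrightarrow>
          wasserstein l m \<mu> < min r \<delta>0" by blast
    show "\<exists>K C \<delta>. 0 < \<delta> \<and> (\<forall>k. C k \<in> sets borel) \<and> (LINT x|\<mu>. tail C K x) \<le> \<kappa> \<and>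
       (\<forall>m\<in>prob_moment l. good C K \<delta> \<theta> m \<longrightarrow>
          m \<in> wball \<and> (\<forall>x. \<bar>D m x - f x\<bar> \<le> \<epsilon> * (1 + norm_pow (l / 2) x)))"
    proof (intro exI conjI ballI impI allI)
      fix m assume "m \<in> prob_moment l" "good C K \<delta> \<theta> m"
      then show "m \<in> wball" "\<And>x. \<bar>D m x - f x\<bar> \<le> \<epsilon> * (1 + norm_pow (l / 2) x)"
        using close **(4) unfolding good_def cells_close_def tail_def by blast+
    qed (use ** in \<open>auto simp: tail_def\<close>)
  qed
qed

text \<open>Both conditions are convex in the measure. This keeps the whole segment of the mean
  value theorem in the region where \<open>D\<close> is controlled.\<close>

lemma good_mix:
  assumes C: "\<And>k. C k \<in> sets borel" and m: "m \<in> prob_moment l" "good C K \<delta> \<theta> m"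
    and n: "n \<in> prob_moment l" "good C K \<delta> \<theta> n" and s: "0 \<le> s" "s \<le> 1"
  shows "good C K \<delta> \<theta> (mix_measure s m n)"
proof -
  have conv: "(1 - s) * a + s * b \<le> c" if "a \<le> c" "b \<le> c" for a b c :: real
    using convex_bound_le[OF that, of "1 - s" s] s by simp
  have "\<bar>measure (mix_measure s m n) (C k) - measure \<mu> (C k)\<bar> \<le> \<delta>" if k: "k < K" for k
  proof -
    have "measure (mix_measure s m n) (C k) - measure \<mu> (C k)
      = (1 - s) * (measure m (C k) - measure \<mu> (C k)) + s * (measure n (C k) - measure \<mu> (C k))"
      using C m n s by (simp add: measure_mix_measure[where l=l] algebra_simps)
    also have "\<bar>\<dots>\<bar> \<le> (1 - s) * \<bar>measure m (C k) - measure \<mu> (C k)\<bar> + s * \<bar>measure n (C k) - measure \<mu> (C k)\<bar>"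
      using s by (intro order_trans[OF abs_triangle_ineq]) (simp add: abs_mult)
    also have "\<dots> \<le> \<delta>" using m n k by (intro conv) (auto simp: good_def cells_close_def)
    finally show ?thesis .
  qed
  moreover have "(LINT x|mix_measure s m n. tail C K x) \<le> \<theta>"
    using m n s tail_props[OF C]
    by (subst integral_mix_measure[where l=l and K=1]) (auto simp: good_def intro!: conv)
  ultimately show ?thesis by (simp add: good_def cells_close_def)
qed

lemma good_\<mu>: "0 \<le> \<delta> \<Longrightarrow> (LINT x|\<mu>. tail C K x) \<le> \<theta> \<Longrightarrow> good C K \<delta> \<theta> \<mu>"
  by (simp add: good_def cells_close_def)

lemma nubar_cells:
  assumes C: "\<And>k. C k \<in> sets borel" and \<delta>: "0 < \<delta>"
  shows "\<forall>\<^sub>F N in sequentially. cells_close C K \<delta> (nubar N)"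
proof -
  have "\<forall>\<^sub>F N in sequentially. \<forall>k\<in>{..<K}. \<bar>measure (nubar N) (C k) - measure \<mu> (C k)\<bar> < \<delta>"
  proof (intro eventually_ball_finite ballI)
    fix k assume "k \<in> {..<K}"
    have "(\<lambda>N. LINT x|nubar N. indicat_real (C k) x) \<longlonglongrightarrow> (LINT x|\<mu>. indicat_real (C k) x)"
      using C by (intro nubar_tendsto[where K=1]) (auto simp: indicator_def)
    then have "(\<lambda>N. measure (nubar N) (C k)) \<longlonglongrightarrow> measure \<mu> (C k)"
      unfolding nubar_def average_measure_def borel_measure_def
      using sets_eq_imp_space_eq[OF prob_momentD(2)[OF \<mu>]] by simp
    then show "\<forall>\<^sub>F N in sequentially. \<bar>measure (nubar N) (C k) - measure \<mu> (C k)\<bar> < \<delta>"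
      using \<delta> by (auto dest!: tendstoD[where e=\<delta>] simp: dist_real_def)
  qed simp
  then show ?thesis by eventually_elim (auto simp: cells_close_def intro: less_imp_le)
qed

lemma nubar_good:
  assumes C: "\<And>k. C k \<in> sets borel" and \<delta>: "0 < \<delta>" and t: "(LINT x|\<mu>. tail C K x) < \<theta>"
  shows "\<forall>\<^sub>F N in sequentially. good C K \<delta> \<theta> (nubar N)"
proof -
  have "(\<lambda>N. LINT x|nubar N. tail C K x) \<longlonglongrightarrow> (LINT x|\<mu>. tail C K x)"
    using tail_props[OF C] by (intro nubar_tendsto[where K=1]) auto
  from order_tendstoD(2)[OF this t] nubar_cells[OF C \<delta>, where K=K]
  show ?thesis by eventually_elim (simp add: good_def)
qed

text \<open>The mean value theorem on the segment from \<mu> to the averaged law produces a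
  derivative \<open>g\<close> that depends on \<open>N\<close>. Since \<open>nubar_bound\<close> is
  uniform in \<open>g\<close>, the scaled difference is close to the \<sigma>-integral of
  \<open>g\<close>; and \<open>g\<close> is close to \<open>f\<close> in the weighted supremum norm,
  so the \<sigma>-integrals of both are close.\<close>

lemma bias: "(\<lambda>N. sqrt (real N) * (U (nubar N) - U \<mu>)) \<longlonglongrightarrow> signed_integral \<sigma> f"
proof (rule LIMSEQ_I)
  fix e :: real assume e: "0 < e"
  note s = signed_momentD[OF \<sigma>]
  note p = sets_pos_variation[OF s(1)] finite_pos_variation[OF s(1)]
  note n = neg_variation[OF s(1)]
  let ?a = "\<lambda>x::'a. 1 + norm_pow (l / 2) x"
  have aK: "\<bar>?a x\<bar> \<le> 2 * (1 + norm_pow l x)" for x using growth_l[of 1 "?a x" x] by simp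
  have am: "?a \<in> borel_measurable borel" by measurable
  note ia = integrable_growth[OF p(2,1) s(2) am aK] integrable_growth[OF n(2,1) s(3) am aK]
  \<comment> \<open>The integral of the weight against the total variation of \<sigma>; the choice
    of \<epsilon> keeps \<open>\<epsilon> * T\<close> below \<open>e / 2\<close>.\<close>
  define T where "T = (LINT x|pos_variation \<sigma>. ?a x) + (LINT x|neg_variation \<sigma>. ?a x)"
  have T0: "0 \<le> T" unfolding T_def by (auto intro!: add_nonneg_nonneg integral_nonneg_AE)
  define \<epsilon> where "\<epsilon> = e / (4 * (T + 1))"
  have \<epsilon>: "0 < \<epsilon>" using e T0 by (simp add: \<epsilon>_def)
  obtain \<theta> where \<theta>: "0 < \<theta>" and nb:
    "\<And>\<kappa>. 0 < \<kappa> \<Longrightarrow> \<exists>K C \<delta>. 0 < \<delta> \<and> (\<forall>k. C k \<in> sets borel) \<and> (LINT x|\<mu>. tail C K x) \<le> \<kappa> \<and>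
       (\<forall>m\<in>prob_moment l. good C K \<delta> \<theta> m \<longrightarrow>
          m \<in> wball \<and> (\<forall>x. \<bar>D m x - f x\<bar> \<le> \<epsilon> * (1 + norm_pow (l / 2) x)))"
    using neighbourhood[OF \<epsilon>] by blast
  obtain K C \<delta> where C: "\<And>k. C k \<in> sets borel" and \<delta>: "0 < \<delta>"
    and t: "(LINT x|\<mu>. tail C K x) \<le> \<theta> / 2"
    and gd: "\<And>m. m \<in> prob_moment l \<Longrightarrow> good C K \<delta> \<theta> m \<Longrightarrow> m \<in> wball"
      "\<And>m x. m \<in> prob_moment l \<Longrightarrow> good C K \<delta> \<theta> m \<Longrightarrow> \<bar>D m x - f x\<bar> \<le> \<epsilon> * ?a x"
    using nb[OF half_gt_zero[OF \<theta>]] by metis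
  have t': "(LINT x|\<mu>. tail C K x) < \<theta>" using t \<theta> by simp
  have "(\<lambda>N. 2 * Cg * wn N) \<longlonglongrightarrow> 2 * Cg * 0" by (intro tendsto_intros wn)
  then have "\<forall>\<^sub>F N in sequentially. 2 * Cg * wn N < e / 2" using e by (intro order_tendstoD) auto
  then have "\<forall>\<^sub>F N in sequentially. norm (sqrt (real N) * (U (nubar N) - U \<mu>) - signed_integral \<sigma> f) < e"
    using nubar_good[OF C \<delta> t'] eventually_gt_at_top[of 0]
  proof eventually_elim
    case (elim N)
    note nN = nubar[OF elim(3)]
    have mixg: "mix_measure s \<mu> (nubar N) \<in> prob_moment l" "good C K \<delta> \<theta> (mix_measure s \<mu> (nubar N))"
      if "0 \<le> s" "s \<le> 1" for s
      using that mix_measure_prob_moment[OF \<mu> nN] good_mix[OF C \<mu> good_\<mu> nN elim(2)] \<delta> t' by auto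
    obtain s where s': "0 < s" "s < 1" and
      mv: "U (nubar N) - U \<mu> = (LINT x|nubar N. D (mix_measure s \<mu> (nubar N)) x) - (LINT x|\<mu>. D (mix_measure s \<mu> (nubar N)) x)"
      using functional_mvt[OF \<mu> nN, of U D] deriv gd(1)[OF mixg] unfolding wball_def by metis
    define g where "g = D (mix_measure s \<mu> (nubar N))"
    have mb: "mix_measure s \<mu> (nubar N) \<in> wball" using gd(1) mixg s' by simp
    have gm: "g \<in> borel_measurable borel" unfolding g_def by (rule D_measurable[OF mb])
    have gK: "\<bar>g x\<bar> \<le> 2 * Cg * (1 + norm_pow l x)" for x unfolding g_def by (rule D_growth[OF mb])
    note fm = f_measurable[OF \<mu>_wball]
    have fK: "\<bar>f x\<bar> \<le> 2 * Cg * (1 + norm_pow l x)" for x unfolding f_def by (rule D_growth[OF \<mu>_wball])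
    have gf: "\<bar>g x - f x\<bar> \<le> \<epsilon> * ?a x" for x unfolding g_def using gd(2) mixg s' by simp
    have 1: "\<bar>sqrt (real N) * (U (nubar N) - U \<mu>) - signed_integral \<sigma> g\<bar> \<le> 2 * Cg * wn N"
      using nubar_bound[OF elim(3) gm _ gK] Cg unfolding mv g_def by simp
    have le: "\<bar>(LINT x|R. g x) - (LINT x|R. f x)\<bar> \<le> \<epsilon> * (LINT x|R. ?a x)"
      if R: "finite_measure R" "sets R = sets borel" "integrable R (norm_pow l)" for R
    proof -
      note i = integrable_growth[OF R gm gK] integrable_growth[OF R fm fK] integrable_growth[OF R am aK]
      have "\<bar>(LINT x|R. g x) - (LINT x|R. f x)\<bar> = \<bar>LINT x|R. g x - f x\<bar>" using i by simp
      also have "\<dots> \<le> (LINT x|R. \<bar>g x - f x\<bar>)" by (rule integral_abs_bound)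
      also have "\<dots> \<le> (LINT x|R. \<epsilon> * ?a x)"
        using i gf by (intro integral_mono integrable_mult_right) auto
      finally show ?thesis by simp
    qed
    have "\<bar>signed_integral \<sigma> g - signed_integral \<sigma> f\<bar> \<le> \<epsilon> * T"
      using le[OF p(2,1) s(2)] le[OF n(2,1) s(3)]
      unfolding signed_integral_def T_def distrib_left by linarith
    also have "\<epsilon> * T < e / 2"
      using e T0 by (simp add: \<epsilon>_def pos_divide_less_eq algebra_simps add_pos_nonneg)
    finally show ?case using 1 elim(1) unfolding real_norm_def by linarith
  qed
  then show "\<exists>no. \<forall>N\<ge>no. norm (sqrt (real N) * (U (nubar N) - U \<mu>) - signed_integral \<sigma> f) < e"
    by (simp add: eventually_sequentially)
qed

end

section \<open>The linear part: limiting variance and Lindeberg's condition\<close>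

lemma integral_excess_tendsto_0:
  fixes h g :: "'a \<Rightarrow> real"
  assumes g: "integrable m g" and h: "h \<in> borel_measurable m" "\<And>x. \<bar>h x\<bar> \<le> g x"
    and k: "\<And>A. k A \<in> borel_measurable m" "\<And>A x. \<bar>k A x\<bar> \<le> g x"
    and k0: "\<And>A x. \<bar>h x\<bar> \<le> A \<Longrightarrow> k A x = 0"
  shows "(\<lambda>n. LINT x|m. k (real n) x) \<longlonglongrightarrow> 0"
proof -
  have "(\<lambda>n. LINT x|m. k (real n) x) \<longlonglongrightarrow> (LINT x|m. 0)"
  proof (rule integral_dominated_convergence[OF _ _ g])
    show "AE x in m. (\<lambda>n. k (real n) x) \<longlonglongrightarrow> 0"
    proof (rule AE_I2, rule tendsto_eventually)
      fix x
      obtain n where n: "\<bar>h x\<bar> \<le> real n" using real_arch_simple by blast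
      then show "\<forall>\<^sub>F n in sequentially. k (real n) x = 0"
        unfolding eventually_sequentially by (intro exI[of _ n] allI impI k0) (meson of_nat_le_iff order_trans)
    qed
  qed (use k in auto)
  then show ?thesis by simp
qed

context nonlinear_clt
begin

lemmas fm = f_measurable[OF \<mu>_wball]

lemma f_growth: "\<bar>f x\<bar> \<le> Cg * (1 + norm_pow (l / 2) x)"
  using growth \<mu>_wball by (simp add: f_def wball_def)

lemma f_growth_l: "\<bar>f x\<bar> \<le> 2 * Cg * (1 + norm_pow l x)"
  unfolding f_def by (rule D_growth[OF \<mu>_wball])

lemma f_square_growth: "(f x)\<^sup>2 \<le> 2 * Cg\<^sup>2 * (1 + norm_pow l x)"
proof -
  have "\<bar>f x\<bar>\<^sup>2 \<le> (Cg * (1 + norm_pow (l / 2) x))\<^sup>2"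
    by (intro power_mono f_growth) simp
  also have "\<dots> \<le> Cg\<^sup>2 * (2 * (1 + norm_pow l x))"
    unfolding power_mult_distrib by (intro mult_left_mono growth_square l) simp
  finally show ?thesis by (simp add: algebra_simps)
qed

lemma Xm [measurable]: "1 \<le> i \<Longrightarrow> X i \<in> P \<rightarrow>\<^sub>M borel"
  using indep by (simp add: indep_vars_def2)

lemma law_integral:
  assumes "1 \<le> i" "g \<in> borel_measurable borel"
  shows "(LINT \<omega>|P. g (X i \<omega>)) = (LINT x|\<nu> i. g x :: real)"
    "integrable P (\<lambda>\<omega>. g (X i \<omega>)) \<longleftrightarrow> integrable (\<nu> i) g"
  using integral_distr[OF Xm[OF assms(1)] assms(2)] integrable_distr_eq[OF Xm[OF assms(1)] assms(2)]
  by (simp_all add: law[OF assms(1)])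

lemma \<nu>_integrable:
  "1 \<le> i \<Longrightarrow> g \<in> borel_measurable borel \<Longrightarrow> (\<And>x. \<bar>g x\<bar> \<le> K * (1 + norm_pow l x)) \<Longrightarrow> integrable (\<nu> i) g"
  using prob_moment_integrable[OF \<nu>] by blast

text \<open>The product \<open>f x * f y\<close> may be unbounded, so Wasserstein convergence is
  applied to its truncations. The truncation error is controlled by the marginals, through the
  excess of \<open>(f x)\<^sup>2\<close> over a level, and is uniformly small for large
  \<open>N\<close> because the averaged laws converge against every measurable function of growth
  \<open>l\<close>.\<close>

lemma product_integral_tendsto:
  "(\<lambda>N. (\<Sum>i=1..N. (LINT x|\<nu> i. f x)\<^sup>2) / real N) \<longlonglongrightarrow> (LINT z|\<eta>. f (fst z) * f (snd z))"
proof -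
  define h where "h z = f (fst z) * f (snd z)" for z :: "'a \<times> 'a"
  define \<pi> where "\<pi> N = average_measure N (\<lambda>i. \<nu> i \<Otimes>\<^sub>M \<nu> i)" for N
  define hA where "hA A z = max (- A) (min A (h z))" for A z
  define \<psi> where "\<psi> A x = max 0 ((f x)\<^sup>2 - A)" for A and x :: 'a
  have fst_m: "(\<lambda>z::'a \<times> 'a. f (fst z)) \<in> borel_measurable borel" "(\<lambda>z::'a \<times> 'a. f (snd z)) \<in> borel_measurable borel"
    using measurable_compose[OF measurable_fst fm] measurable_compose[OF measurable_snd fm]
    unfolding borel_prod[symmetric] by auto
  have hm: "h \<in> borel_measurable borel" unfolding h_def using fst_m by (rule borel_measurable_times)
  have hAm: "hA A \<in> borel_measurable borel" for A unfolding hA_def using hm by measurable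
  have \<psi>m: "\<psi> A \<in> borel_measurable borel" for A unfolding \<psi>_def using fm by measurable
  have \<psi>0: "0 \<le> \<psi> A x" for A x by (simp add: \<psi>_def)
  have \<psi>le: "\<psi> A x \<le> (f x)\<^sup>2" if "0 \<le> A" for A x using that by (simp add: \<psi>_def)
  have \<psi>K: "\<bar>\<psi> A x\<bar> \<le> 2 * Cg\<^sup>2 * (1 + norm_pow l x)" if "0 \<le> A" for A x
    using \<psi>le[OF that] \<psi>0[of A x] f_square_growth[of x] by (metis abs_of_nonneg order_trans)
  have h2: "\<bar>h z\<bar> \<le> ((f (fst z))\<^sup>2 + (f (snd z))\<^sup>2) / 2" for z
    using sum_squares_bound[of "\<bar>f (fst z)\<bar>" "\<bar>f (snd z)\<bar>"] by (simp add: h_def abs_mult)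
  \<comment> \<open>The excess of \<open>\<bar>h\<bar>\<close> over \<open>A\<close> is at most the
    mean of the excesses of the two squares, by the inequality between geometric and arithmetic
    means; each of these depends on one coordinate only.\<close>
  have hd: "\<bar>h z - hA A z\<bar> \<le> (\<psi> A (fst z) + \<psi> A (snd z)) / 2" if "0 \<le> A" for A z
  proof -
    have "\<bar>h z - hA A z\<bar> \<le> max 0 (\<bar>h z\<bar> - A)"
      using that unfolding hA_def by (auto simp: max_def min_def)
    also have "\<dots> \<le> max 0 (((f (fst z))\<^sup>2 - A) / 2 + ((f (snd z))\<^sup>2 - A) / 2)"
      using h2[of z] by (intro max.mono) (auto simp: field_simps)
    also have "\<dots> \<le> (\<psi> A (fst z) + \<psi> A (snd z)) / 2"
      by (auto simp: \<psi>_def max_def field_simps)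
    finally show ?thesis .
  qed
  have \<nu>\<nu>: "\<nu> i \<Otimes>\<^sub>M \<nu> i \<in> prob_moment l" if "i \<in> {1..N}" for i N
    using that pair_measure_prob_moment[OF l \<nu> \<nu>] by simp
  have \<pi>: "\<pi> N \<in> prob_moment l" if "0 < N" for N
    unfolding \<pi>_def using \<nu>\<nu> that by (intro average_measure_prob_moment) auto
  have hA_bound: "\<bar>hA A z\<bar> \<le> A * (1 + norm_pow l z)" if "0 \<le> A" for A z
  proof -
    have "\<bar>hA A z\<bar> \<le> A" using that by (auto simp: hA_def)
    also have "A \<le> A * (1 + norm_pow l z)" using that by (simp add: distrib_left)
    finally show ?thesis .
  qed
  have diff: "\<bar>(LINT z|\<rho>. h z) - (LINT z|\<rho>. hA A z)\<bar> \<le> (LINT x|m. \<psi> A x)"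
    and hint: "integrable \<rho> h"
    if \<rho>: "\<rho> \<in> couplings m m" "\<rho> \<in> prob_moment l" and m: "m \<in> prob_moment l" and A: "0 \<le> A" for \<rho> m A
  proof -
    have f2: "integrable m (\<lambda>x. (f x)\<^sup>2)"
      using fm f_square_growth by (intro prob_moment_integrable[OF m, where K="2 * Cg\<^sup>2"]) auto
    have f2m: "(\<lambda>x. (f x)\<^sup>2) \<in> borel_measurable borel" using fm by measurable
    show hi: "integrable \<rho> h"
    proof (rule Bochner_Integration.integrable_bound)
      show "integrable \<rho> (\<lambda>z. ((f (fst z))\<^sup>2 + (f (snd z))\<^sup>2) / 2)"
        using coupling_integral[OF \<rho>(1) f2m] f2 by simp
      show "h \<in> borel_measurable \<rho>"
        using hm prob_momentD(2)[OF \<rho>(2)] by (simp cong: measurable_cong_sets)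
      show "AE z in \<rho>. norm (h z) \<le> norm (((f (fst z))\<^sup>2 + (f (snd z))\<^sup>2) / 2)"
        using h2 by (intro AE_I2) simp
    qed
    have hAi: "integrable \<rho> (hA A)" by (rule prob_moment_integrable[OF \<rho>(2) hAm hA_bound[OF A]])
    have pi: "integrable m (\<psi> A)" by (rule prob_moment_integrable[OF m \<psi>m \<psi>K[OF A]])
    have "\<bar>(LINT z|\<rho>. h z) - (LINT z|\<rho>. hA A z)\<bar> = \<bar>LINT z|\<rho>. h z - hA A z\<bar>" using hi hAi by simp
    also have "\<dots> \<le> (LINT z|\<rho>. \<bar>h z - hA A z\<bar>)" by (rule integral_abs_bound)
    also have "\<dots> \<le> (LINT z|\<rho>. (\<psi> A (fst z) + \<psi> A (snd z)) / 2)"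
      using hi hAi hd[OF A] coupling_integral[OF \<rho>(1) \<psi>m] pi by (intro integral_mono) auto
    also have "\<dots> = (LINT x|m. \<psi> A x)"
      using coupling_integral[OF \<rho>(1) \<psi>m, of A] pi by simp
    finally show "\<bar>(LINT z|\<rho>. h z) - (LINT z|\<rho>. hA A z)\<bar> \<le> (LINT x|m. \<psi> A x)" .
  qed
  have c\<eta>: "\<eta> \<in> couplings \<mu> \<mu>"
    using \<eta> \<eta>_fst \<eta>_snd by (auto simp: couplings_def prob_momentD)
  have hprod: "(LINT z|(\<nu> i \<Otimes>\<^sub>M \<nu> i). h z) = (LINT x|\<nu> i. f x)\<^sup>2" if i: "1 \<le> i" for i
  proof -
    interpret n: prob_space "\<nu> i" using \<nu>[OF i] by (simp add: prob_momentD)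
    interpret nn: pair_prob_space "\<nu> i" "\<nu> i" ..
    have "integrable (\<nu> i \<Otimes>\<^sub>M \<nu> i) h"
      using hint[OF pair_measure_coupling[OF \<nu>[OF i] \<nu>[OF i]] pair_measure_prob_moment[OF l \<nu>[OF i] \<nu>[OF i]] \<nu>[OF i], of 0]
      by simp
    from nn.integral_fst'[OF this]
    have "(LINT z|(\<nu> i \<Otimes>\<^sub>M \<nu> i). h z) = (LINT x|\<nu> i. LINT y|\<nu> i. h (x, y))" by (simp only:)
    then show ?thesis
      by (simp only: h_def fst_conv snd_conv) (simp add: power2_eq_square)
  qed
  have hAB: "\<bar>hA A z\<bar> \<le> \<bar>A\<bar>" for A z by (auto simp: hA_def max_def min_def)
  have lim: "(\<lambda>N. LINT z|\<pi> N. hA A z) \<longlonglongrightarrow> (LINT z|\<eta>. hA A z)" for A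
  proof (rule wasserstein_integral_tendsto[OF l \<pi> \<eta> _ hAB hAm])
    show "(\<lambda>N. wasserstein l (\<pi> N) \<eta>) \<longlonglongrightarrow> 0" using conv_\<eta> by (simp add: \<pi>_def)
    have s\<eta>: "sets \<eta> = sets (borel \<Otimes>\<^sub>M borel)" using prob_momentD(2)[OF \<eta>] unfolding borel_prod .
    have fs: "fst \<in> \<eta> \<rightarrow>\<^sub>M borel" "snd \<in> \<eta> \<rightarrow>\<^sub>M borel" using s\<eta> by (simp_all cong: measurable_cong_sets)
    \<comment> \<open>Both marginals of \<eta> are \<mu>, so discontinuities in either coordinate
      form a null set.\<close>
    have "AE z in \<eta>. isCont f (fst z)" "AE z in \<eta>. isCont f (snd z)"
      unfolding f_def using AE_distrD[OF fs(1), unfolded \<eta>_fst, OF cont_ae]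
        AE_distrD[OF fs(2), unfolded \<eta>_snd, OF cont_ae] by blast+
    then show "AE z in \<eta>. isCont (hA A) z"
    proof eventually_elim
      case (elim z)
      have "isCont h z"
        unfolding h_def using elim by (intro isCont_mult isCont_o2[OF isCont_fst] isCont_o2[OF isCont_snd]) auto
      then show ?case unfolding hA_def by (intro continuous_max continuous_min continuous_const)
    qed
  qed
  have "(\<lambda>N. LINT z|\<pi> N. h z) \<longlonglongrightarrow> (LINT z|\<eta>. h z)"
  proof (rule LIMSEQ_I)
    fix e :: real assume e: "0 < e"
    have f2: "integrable \<mu> (\<lambda>x. (f x)\<^sup>2)"
      using fm f_square_growth by (intro prob_moment_integrable[OF \<mu>, where K="2 * Cg\<^sup>2"]) auto
    \<comment> \<open>The case distinction and the \<open>max\<close> make the family satisfy the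
      assumptions of \<open>integral_excess_tendsto_0\<close> at all real levels; at the levels
      \<open>real n\<close> they do not change the value.\<close>
    have "(\<lambda>n. LINT x|\<mu>. (if (f x)\<^sup>2 \<le> real n then 0 else \<psi> (max 0 (real n)) x)) \<longlonglongrightarrow> 0"
    proof (rule integral_excess_tendsto_0[OF f2, where h="\<lambda>x. (f x)\<^sup>2"])
      show "(\<lambda>x. (f x)\<^sup>2) \<in> borel_measurable \<mu>"
        using fm prob_momentD(2)[OF \<mu>] by (simp cong: measurable_cong_sets)
      show "(\<lambda>x. if (f x)\<^sup>2 \<le> A then 0 else \<psi> (max 0 A) x) \<in> borel_measurable \<mu>" for A
        using fm \<psi>m[of "max 0 A"] prob_momentD(2)[OF \<mu>] by (simp cong: measurable_cong_sets)
      show "\<bar>if (f x)\<^sup>2 \<le> A then 0 else \<psi> (max 0 A) x\<bar> \<le> (f x)\<^sup>2" for A x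
        using \<psi>le[of "max 0 A" x] \<psi>0[of "max 0 A" x] by simp
    qed auto
    moreover have "(if (f x)\<^sup>2 \<le> real n then 0 else \<psi> (max 0 (real n)) x) = \<psi> (real n) x" for n x
      by (auto simp: \<psi>_def)
    ultimately have "(\<lambda>n. LINT x|\<mu>. \<psi> (real n) x) \<longlonglongrightarrow> 0" by simp
    then have "\<forall>\<^sub>F n in sequentially. (LINT x|\<mu>. \<psi> (real n) x) < e / 4"
      using e by (intro order_tendstoD(2)) auto
    then obtain n where n: "(LINT x|\<mu>. \<psi> (real n) x) < e / 4"
      using eventually_happens by fastforce
    have "(\<lambda>N. LINT x|nubar N. \<psi> (real n) x) \<longlonglongrightarrow> (LINT x|\<mu>. \<psi> (real n) x)"
      using \<psi>m \<psi>K by (intro nubar_tendsto[where K="2 * Cg\<^sup>2"]) auto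
    from order_tendstoD(2)[OF this n]
    have 1: "\<forall>\<^sub>F N in sequentially. (LINT x|nubar N. \<psi> (real n) x) < e / 4" .
    have "\<forall>\<^sub>F N in sequentially. \<bar>(LINT z|\<pi> N. hA (real n) z) - (LINT z|\<eta>. hA (real n) z)\<bar> < e / 4"
      using tendstoD[OF lim, of "e / 4" "real n"] e by (simp add: dist_real_def)
    then have "\<forall>\<^sub>F N in sequentially. norm ((LINT z|\<pi> N. h z) - (LINT z|\<eta>. h z)) < e"
      using 1 eventually_gt_at_top[of 0]
    proof eventually_elim
      case (elim N)
      \<comment> \<open>Averaging commutes with taking marginals, so the averaged products couple
        the averaged law with itself and the truncation bound applies.\<close>
      have "\<pi> N \<in> couplings (nubar N) (nubar N)"
      proof -
        have c: "\<nu> i \<Otimes>\<^sub>M \<nu> i \<in> couplings (\<nu> i) (\<nu> i)" if "i \<in> {1..N}" for i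
          using that pair_measure_coupling[OF \<nu> \<nu>] by auto
        have s\<pi>: "sets (\<pi> N) = sets (borel \<Otimes>\<^sub>M borel)"
          using prob_momentD(2)[OF \<pi>[OF elim(3)]] unfolding borel_prod .
        have fs: "fst \<in> \<pi> N \<rightarrow>\<^sub>M borel" "snd \<in> \<pi> N \<rightarrow>\<^sub>M borel" using s\<pi> by (simp_all cong: measurable_cong_sets)
        have sp: "space (\<pi> N) = UNIV" by (rule prob_momentD(3)[OF \<pi>[OF elim(3)]])
        interpret pN: prob_space "\<pi> N" using \<pi>[OF elim(3)] by (simp add: prob_momentD)
        interpret nN: prob_space "nubar N" using nubar[OF elim(3)] by (simp add: prob_momentD)
        have key: "distr (\<pi> N) borel p = nubar N"
          if p: "p = fst \<or> p = snd" for p :: "'a \<times> 'a \<Rightarrow> 'a"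
        proof (rule measure_eqI)
          have pm: "p \<in> \<pi> N \<rightarrow>\<^sub>M borel" using p fs by auto
          show "sets (distr (\<pi> N) borel p) = sets (nubar N)"
            using prob_momentD(2)[OF nubar[OF elim(3)]] by simp
          fix A assume "A \<in> sets (distr (\<pi> N) borel p)"
          then have A: "A \<in> sets borel" by simp
          have pA: "p -` A \<in> sets borel" using measurable_sets[OF pm A] prob_momentD(2,3)[OF \<pi>[OF elim(3)]] by simp
          have "measure (\<nu> i \<Otimes>\<^sub>M \<nu> i) (p -` A) = measure (\<nu> i) A" if i: "i \<in> {1..N}" for i
          proof -
            have s: "sets (\<nu> i \<Otimes>\<^sub>M \<nu> i) = sets (borel \<Otimes>\<^sub>M borel)"
              using prob_momentD(2)[OF \<nu>\<nu>[OF i]] unfolding borel_prod .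
            have "fst \<in> \<nu> i \<Otimes>\<^sub>M \<nu> i \<rightarrow>\<^sub>M borel" "snd \<in> \<nu> i \<Otimes>\<^sub>M \<nu> i \<rightarrow>\<^sub>M borel"
              using s by (simp_all cong: measurable_cong_sets)
            then have "p \<in> \<nu> i \<Otimes>\<^sub>M \<nu> i \<rightarrow>\<^sub>M borel" using p by auto
            from measure_distr[OF this A] show ?thesis
              using c[OF i] p prob_momentD(3)[OF \<nu>\<nu>[OF i]] by (auto simp: couplings_def)
          qed
          then have "measure (\<pi> N) (p -` A) = measure (nubar N) A"
            unfolding \<pi>_def nubar_def using \<nu>\<nu> \<nu> A pA by (subst (1 2) measure_average_measure[where l=l]) auto
          then show "emeasure (distr (\<pi> N) borel p) A = emeasure (nubar N) A"
            using pm A by (simp add: emeasure_distr sp pN.emeasure_eq_measure nN.emeasure_eq_measure)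
        qed
        show ?thesis
          using key[of fst] key[of snd] \<pi>[OF elim(3)] by (simp add: couplings_def prob_momentD)
      qed
      from diff[OF this \<pi>[OF elim(3)] nubar[OF elim(3)], of "real n"]
      have "\<bar>(LINT z|\<pi> N. h z) - (LINT z|\<pi> N. hA (real n) z)\<bar> < e / 4" using elim(2) by simp
      moreover have "\<bar>(LINT z|\<eta>. h z) - (LINT z|\<eta>. hA (real n) z)\<bar> < e / 4"
        using diff[OF c\<eta> \<eta> \<mu>, of "real n"] n by simp
      ultimately show ?case using elim(1) unfolding real_norm_def by linarith
    qed
    then show "\<exists>no. \<forall>N\<ge>no. norm ((LINT z|\<pi> N. h z) - (LINT z|\<eta>. h z)) < e"
      by (simp add: eventually_sequentially)
  qed
  moreover have "\<forall>\<^sub>F N in sequentially. (LINT z|\<pi> N. h z) = (\<Sum>i=1..N. (LINT x|\<nu> i. f x)\<^sup>2) / real N"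
    using eventually_gt_at_top[of 0]
  proof eventually_elim
    case (elim N)
    have hK: "\<bar>h z\<bar> \<le> 2 * Cg\<^sup>2 * (1 + norm_pow l z)" for z
    proof -
      have "norm_pow l (fst z) \<le> norm_pow l z" "norm_pow l (snd z) \<le> norm_pow l z"
        using l norm_fst_le[of "fst z" "snd z"] norm_snd_le[of "snd z" "fst z"]
        by (auto simp: norm_pow_def intro!: powr_mono2)
      then have "(f (fst z))\<^sup>2 \<le> 2 * Cg\<^sup>2 * (1 + norm_pow l z)"
        "(f (snd z))\<^sup>2 \<le> 2 * Cg\<^sup>2 * (1 + norm_pow l z)"
        by (auto intro!: mult_left_mono order_trans[OF f_square_growth])
      then have "((f (fst z))\<^sup>2 + (f (snd z))\<^sup>2) / 2 \<le> 2 * Cg\<^sup>2 * (1 + norm_pow l z)"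
        using add_mono by (fastforce simp: pos_divide_le_eq)
      then show ?thesis using h2[of z] by (rule order_trans[rotated])
    qed
    have "(LINT z|\<pi> N. h z) = (\<Sum>i=1..N. LINT z|(\<nu> i \<Otimes>\<^sub>M \<nu> i). h z) / real N"
      unfolding \<pi>_def by (rule integral_average_measure[OF \<nu>\<nu> hm hK])
    then show ?case using hprod by simp
  qed
  ultimately show ?thesis
    unfolding h_def[symmetric] by (rule Lim_transform_eventually)
qed

definition "Y i \<omega> = f (X i \<omega>) - (LINT x|\<nu> i. f x)"
definition "asym_var = (LINT x|\<mu>. (f x)\<^sup>2) - (LINT z|\<eta>. f (fst z) * f (snd z))"

lemma Y_measurable [measurable]: "1 \<le> i \<Longrightarrow> Y i \<in> borel_measurable P"
  unfolding Y_def using measurable_compose[OF Xm fm] by measurable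

lemma f2_integrable: "1 \<le> i \<Longrightarrow> integrable (\<nu> i) (\<lambda>x. (f x)\<^sup>2)" "1 \<le> i \<Longrightarrow> integrable (\<nu> i) f"
  using fm f_square_growth \<nu>_integrable[OF _ fm f_growth_l]
  by (auto intro!: \<nu>_integrable[where K="2 * Cg\<^sup>2"])

lemma Y_moments:
  assumes i: "1 \<le> i"
  shows "integrable P (\<lambda>\<omega>. (Y i \<omega>)\<^sup>2)" "(LINT \<omega>|P. Y i \<omega>) = 0"
    "(LINT \<omega>|P. (Y i \<omega>)\<^sup>2) = (LINT x|\<nu> i. (f x)\<^sup>2) - (LINT x|\<nu> i. f x)\<^sup>2"
proof -
  have f2m: "(\<lambda>x. (f x)\<^sup>2) \<in> borel_measurable borel" using fm by measurable
  note I = law_integral[OF i fm] law_integral[OF i f2m] f2_integrable[OF i]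
  show "integrable P (\<lambda>\<omega>. (Y i \<omega>)\<^sup>2)" "(LINT \<omega>|P. Y i \<omega>) = 0"
    "(LINT \<omega>|P. (Y i \<omega>)\<^sup>2) = (LINT x|\<nu> i. (f x)\<^sup>2) - (LINT x|\<nu> i. f x)\<^sup>2"
    unfolding Y_def using I by (simp_all add: power2_diff prob_space) (simp add: power2_eq_square)
qed

lemma variance_tendsto: "(\<lambda>N. (\<Sum>i=1..N. LINT \<omega>|P. (Y i \<omega>)\<^sup>2) / real N) \<longlonglongrightarrow> asym_var"
proof -
  have f2K: "\<bar>(f x)\<^sup>2\<bar> \<le> 2 * Cg\<^sup>2 * (1 + norm_pow l x)" for x using f_square_growth by simp
  have f2m: "(\<lambda>x. (f x)\<^sup>2) \<in> borel_measurable borel" using fm by measurable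
  have "(\<lambda>N. (LINT x|nubar N. (f x)\<^sup>2) - (\<Sum>i=1..N. (LINT x|\<nu> i. f x)\<^sup>2) / real N) \<longlonglongrightarrow> asym_var"
    unfolding asym_var_def
    by (intro tendsto_diff product_integral_tendsto nubar_tendsto[OF f2m _ f2K]) simp
  moreover have "(LINT x|nubar N. (f x)\<^sup>2) - (\<Sum>i=1..N. (LINT x|\<nu> i. f x)\<^sup>2) / real N
      = (\<Sum>i=1..N. LINT \<omega>|P. (Y i \<omega>)\<^sup>2) / real N" for N
    using integral_nubar[OF f2m f2K, of N] Y_moments(3)
    by (simp add: sum_subtractf diff_divide_distrib)
  ultimately show ?thesis by simp
qed

text \<open>Inherited from the averaged variances, of which it is the limit.\<close>

lemma asym_var_nonneg: "0 \<le> asym_var"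
  by (rule LIMSEQ_le_const[OF variance_tendsto]) (auto intro!: divide_nonneg_nonneg sum_nonneg)

text \<open>The level is found for \<mu> by dominated convergence and transferred to the averaged
  laws by \<open>nubar_tendsto\<close>, which covers the discontinuous truncation. Passing from
  \<open>f (X i)\<close> to the centred \<open>Y i\<close> costs a factor 4 in the level and in the
  bound, whence \<open>e / 4\<close>.\<close>

lemma lindeberg_condition:
  assumes e: "0 < e"
  shows "\<exists>A\<ge>0. \<forall>\<^sub>F N in sequentially.
    (\<Sum>i=1..N. LINT \<omega>|P. (Y i \<omega>)\<^sup>2 * indicator {\<omega>. A < \<bar>Y i \<omega>\<bar>} \<omega>) / real N \<le> e"
proof -
  define k where "k A x = (f x)\<^sup>2 * indicator {x. A < \<bar>f x\<bar>} x" for A x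
  have km: "k A \<in> borel_measurable borel" for A unfolding k_def using fm by measurable
  have k2: "\<bar>k A x\<bar> \<le> (f x)\<^sup>2" for A x by (auto simp: k_def indicator_def)
  have kK: "\<bar>k A x\<bar> \<le> 2 * Cg\<^sup>2 * (1 + norm_pow l x)" for A x
    using k2 f_square_growth order_trans by blast
  have f2: "integrable \<mu> (\<lambda>x. (f x)\<^sup>2)"
    using fm f_square_growth by (intro prob_moment_integrable[OF \<mu>, where K="2 * Cg\<^sup>2"]) auto
  have "(\<lambda>n. LINT x|\<mu>. (if (f x)\<^sup>2 \<le> real n then 0 else k (sqrt (real n)) x)) \<longlonglongrightarrow> 0"
  proof (rule integral_excess_tendsto_0[OF f2, where h="\<lambda>x. (f x)\<^sup>2"])
    show "(\<lambda>x. (f x)\<^sup>2) \<in> borel_measurable \<mu>"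
      using fm prob_momentD(2)[OF \<mu>] by (simp cong: measurable_cong_sets)
    show "(\<lambda>x. if (f x)\<^sup>2 \<le> A then 0 else k (sqrt A) x) \<in> borel_measurable \<mu>" for A
      using fm km[of "sqrt A"] prob_momentD(2)[OF \<mu>] by (simp cong: measurable_cong_sets)
    show "\<bar>if (f x)\<^sup>2 \<le> A then 0 else k (sqrt A) x\<bar> \<le> (f x)\<^sup>2" for A x
      using k2[of "sqrt A" x] by simp
  qed auto
  moreover have "(if (f x)\<^sup>2 \<le> real n then 0 else k (sqrt (real n)) x) = k (sqrt (real n)) x" for n x
    using real_le_rsqrt[of "\<bar>f x\<bar>" "real n"] by (auto simp: k_def indicator_def)
  ultimately have "(\<lambda>n. LINT x|\<mu>. k (sqrt (real n)) x) \<longlonglongrightarrow> 0" by simp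
  then have "\<forall>\<^sub>F n in sequentially. (LINT x|\<mu>. k (sqrt (real n)) x) < e / 4"
    using e by (intro order_tendstoD(2)) auto
  then obtain n where n: "(LINT x|\<mu>. k (sqrt (real n)) x) < e / 4"
    using eventually_happens by fastforce
  define A where "A = sqrt (real n)"
  have A: "0 \<le> A" by (simp add: A_def)
  have "(\<lambda>N. LINT x|nubar N. k A x) \<longlonglongrightarrow> (LINT x|\<mu>. k A x)"
    using km kK by (intro nubar_tendsto[where K="2 * Cg\<^sup>2"]) auto
  from order_tendstoD(2)[OF this n[folded A_def]]
  have "\<forall>\<^sub>F N in sequentially.
    (\<Sum>i=1..N. LINT \<omega>|P. (Y i \<omega>)\<^sup>2 * indicator {\<omega>. 4 * A < \<bar>Y i \<omega>\<bar>} \<omega>) / real N \<le> e"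
  proof eventually_elim
    case (elim N)
    have "(\<Sum>i=1..N. LINT \<omega>|P. (Y i \<omega>)\<^sup>2 * indicator {\<omega>. 4 * A < \<bar>Y i \<omega>\<bar>} \<omega>) / real N
        \<le> (\<Sum>i=1..N. 4 * (LINT x|\<nu> i. k A x)) / real N"
    proof (intro divide_right_mono sum_mono)
      fix i assume "i \<in> {1..N}"
      then have i: "1 \<le> i" by simp
      have f2m: "(\<lambda>x. (f x)\<^sup>2) \<in> borel_measurable borel" using fm by measurable
      have "(LINT \<omega>|P. (f (X i \<omega>) - (LINT \<omega>|P. f (X i \<omega>)))\<^sup>2 * indicator {\<omega>. 4 * A < \<bar>f (X i \<omega>) - (LINT \<omega>|P. f (X i \<omega>))\<bar>} \<omega>)
        \<le> 4 * (LINT \<omega>|P. (f (X i \<omega>))\<^sup>2 * indicator {\<omega>. A < \<bar>f (X i \<omega>)\<bar>} \<omega>)"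
        using measurable_compose[OF Xm[OF i] fm] law_integral(2)[OF i f2m] f2_integrable(1)[OF i] A
        by (intro centered_truncation prob_space_axioms) auto
      moreover have "(LINT \<omega>|P. (f (X i \<omega>))\<^sup>2 * indicator {\<omega>. A < \<bar>f (X i \<omega>)\<bar>} \<omega>) = (LINT \<omega>|P. k A (X i \<omega>))"
        by (simp add: k_def indicator_def)
      ultimately show "(LINT \<omega>|P. (Y i \<omega>)\<^sup>2 * indicator {\<omega>. 4 * A < \<bar>Y i \<omega>\<bar>} \<omega>) \<le> 4 * (LINT x|\<nu> i. k A x)"
        using law_integral(1)[OF i fm] law_integral(1)[OF i km] by (simp add: Y_def)
    qed simp
    also have "\<dots> = 4 * (LINT x|nubar N. k A x)"
      using integral_nubar[OF km kK, of N] by (simp add: sum_distrib_left)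
    finally show ?case using elim by simp
  qed
  then show ?thesis using A by (intro exI[of _ "4 * A"]) auto
qed

lemma linear_part_char:
  "(\<lambda>N. char (distr P borel (\<lambda>\<omega>. (\<Sum>i=1..N. Y i \<omega>) / sqrt (real N))) t)
    \<longlonglongrightarrow> complex_of_real (exp (- (t\<^sup>2 * asym_var / 2)))"
proof (rule lindeberg_char)
  show "indep_vars (\<lambda>_. borel) Y {1..}"
    unfolding Y_def using indep by (rule indep_vars_compose2) (use fm in measurable)
qed (use Y_moments variance_tendsto lindeberg_condition prob_space_axioms in auto)

end

section \<open>The path of intermediate measures: single steps and orthogonal increments\<close>

context nonlinear_clt
begin

text \<open>A map into probability measures is measurable as soon as the masses of all Borel sets
  are; this reduces random arguments of \<open>U\<close> to real random variables.\<close>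

lemma U_comp_measurable:
  assumes K: "\<And>z. z \<in> space M \<Longrightarrow> K z \<in> prob_moment l"
    and m: "\<And>A. A \<in> sets borel \<Longrightarrow> (\<lambda>z. measure (K z) A) \<in> borel_measurable M"
  shows "(\<lambda>z. U (K z)) \<in> borel_measurable M"
proof (rule measurable_compose[OF _ U_measurable])
  have "K \<in> M \<rightarrow>\<^sub>M subprob_algebra borel"
  proof (rule measurable_subprob_algebra)
    fix A :: "'a set" assume A: "A \<in> sets borel"
    have "emeasure (K z) A = ennreal (measure (K z) A)" if "z \<in> space M" for z
    proof -
      interpret Kz: prob_space "K z" using K[OF that] by (rule prob_momentD)
      show ?thesis by (rule Kz.emeasure_eq_measure)
    qed
    then show "(\<lambda>z. emeasure (K z) A) \<in> borel_measurable M"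
      using m[OF A] by (simp cong: measurable_cong)
  qed (use K in \<open>auto dest: prob_momentD intro!: prob_space_imp_subprob_space\<close>)
  then have "K \<in> M \<rightarrow>\<^sub>M prob_algebra borel"
    using K by (intro measurable_prob_algebraI) (auto dest: prob_momentD)
  then show "K \<in> M \<rightarrow>\<^sub>M prob_moment_space l"
    unfolding prob_moment_space_def using K by (intro measurable_restrict_space2) auto
qed

text \<open>The empirical measures are reached from the averages of the laws by replacing one law at a
  time by the Dirac mass at the corresponding sample point; \<open>path N i x\<close> uses the points \<open>x j\<close>
  with \<open>j < i\<close> only.\<close>

definition path :: "nat \<Rightarrow> nat \<Rightarrow> (nat \<Rightarrow> 'a) \<Rightarrow> 'a measure" where
  "path N i x = average_measure N (\<lambda>j. if j < i then return borel (x j) else \<nu> j)"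

lemma path_prob_moment: "0 < N \<Longrightarrow> path N i x \<in> prob_moment l"
  unfolding path_def using \<nu> return_prob_moment by (intro average_measure_prob_moment) auto

text \<open>Lets the vector restricted to the past stand in for the whole sample.\<close>

lemma path_cong: "(\<And>j. 1 \<le> j \<Longrightarrow> j < i \<Longrightarrow> x j = y j) \<Longrightarrow> path N i x = path N i y"
  unfolding path_def average_measure_def
  by (intro arg_cong[where f=borel_measure] ext arg_cong2[where f="(/)"] sum.cong refl) auto

lemma path_first: "path N 1 x = nubar N"
  unfolding path_def nubar_def average_measure_def
  by (intro arg_cong[where f=borel_measure] ext arg_cong2[where f="(/)"] sum.cong refl) auto

lemma path_last: "path N (Suc N) x = average_measure N (\<lambda>j. return borel (x j))"
  unfolding path_def average_measure_def
  by (intro arg_cong[where f=borel_measure] ext arg_cong2[where f="(/)"] sum.cong refl) auto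

lemma path_integral:
  assumes "g \<in> borel_measurable borel" "\<And>x. \<bar>g x\<bar> \<le> K * (1 + norm_pow l x)"
  shows "(LINT y|path N i x. g y) = (\<Sum>j=1..N. if j < i then g (x j) else (LINT y|\<nu> j. g y)) / real N"
proof -
  have "(LINT y|path N i x. g y) = (\<Sum>j=1..N. LINT y|(if j < i then return borel (x j) else \<nu> j). g y) / real N"
    unfolding path_def using \<nu> return_prob_moment assms by (intro integral_average_measure) auto
  also have "(\<Sum>j=1..N. LINT y|(if j < i then return borel (x j) else \<nu> j). g y)
      = (\<Sum>j=1..N. if j < i then g (x j) else (LINT y|\<nu> j. g y))"
    using assms(1) by (intro sum.cong) (auto simp: integral_return)
  finally show ?thesis .
qed

lemma path_measure:
  assumes A: "A \<in> sets borel" and N: "0 < N"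
  shows "measure (path N i x) A = (\<Sum>j=1..N. if j < i then indicator A (x j) else measure (\<nu> j) A) / real N"
proof -
  have "measure (path N i x) A = (LINT y|path N i x. indicator A y)"
    using path_prob_moment[OF N, of i x] by (simp add: prob_momentD)
  also have "\<dots> = (\<Sum>j=1..N. if j < i then indicator A (x j) else (LINT y|\<nu> j. indicat_real A y)) / real N"
    using A by (intro path_integral[where K=1]) (auto simp: indicator_def)
  also have "(\<Sum>j=1..N. if j < i then indicator A (x j) else (LINT y|\<nu> j. indicat_real A y))
      = (\<Sum>j=1..N. if j < i then indicator A (x j) else measure (\<nu> j) A)"
    by (intro sum.cong) (auto simp: prob_momentD(3)[OF \<nu>])
  finally show ?thesis .
qed

lemma path_sum_step:
  assumes "i \<in> {1..N}"
  shows "(\<Sum>j=1..N. if j < Suc i then a j else b j) - (\<Sum>j=1..N. if j < i then a j else b j) = a i - (b i :: real)"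
proof -
  have "(\<Sum>j=1..N. if j < Suc i then a j else b j) - (\<Sum>j=1..N. if j < i then a j else b j)
      = (\<Sum>j=1..N. if j = i then a i - b i else 0)"
    unfolding sum_subtractf[symmetric] by (intro sum.cong) auto
  then show ?thesis using assms by simp
qed

text \<open>With indicators for \<open>a\<close> and their means for \<open>b\<close>, the path
  differs from the averaged law by the centred partial sum up to \<open>i - 1\<close>, the quantity
  that \<open>uniform_weak_law\<close> controls.\<close>

lemma path_sum_eq:
  assumes "i \<le> Suc N"
  shows "(\<Sum>j=1..N. if j < i then a j else b j) = (\<Sum>j=1..N. b j) + (\<Sum>j=1..i-1. a j - (b j :: real))"
proof -
  have "(\<Sum>j=1..N. if j < i then a j else b j) = (\<Sum>j=1..N. b j + (if j < i then a j - b j else 0))"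
    by (intro sum.cong) auto
  also have "\<dots> = (\<Sum>j=1..N. b j) + (\<Sum>j\<in>{1..N} \<inter> {j. j < i}. a j - b j)"
    by (simp add: sum.distrib sum.inter_restrict)
  also have "{1..N} \<inter> {j. j < i} = {1..i-1}" using assms by auto
  finally show ?thesis .
qed

lemma path_integral_step:
  assumes i: "i \<in> {1..N}" and g: "g \<in> borel_measurable borel" "\<And>x. \<bar>g x\<bar> \<le> K * (1 + norm_pow l x)"
  shows "(LINT y|path N (Suc i) x. g y) - (LINT y|path N i x. g y) = (g (x i) - (LINT y|\<nu> i. g y)) / real N"
  unfolding path_integral[OF g] diff_divide_distrib[symmetric] path_sum_step[OF i] ..

lemma path_measure_step:
  assumes i: "i \<in> {1..N}" and A: "A \<in> sets borel"
  shows "measure (path N (Suc i) x) A - measure (path N i x) A = (indicator A (x i) - measure (\<nu> i) A) / real N"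
proof -
  have N: "0 < N" using i by auto
  show ?thesis
    unfolding path_measure[OF A N] diff_divide_distrib[symmetric] path_sum_step[OF i] ..
qed

definition "moment i = (LINT x|\<nu> i. norm_pow l x)"

lemma moment_nonneg: "0 \<le> moment i"
  unfolding moment_def by (intro integral_nonneg_AE) auto

lemma norm_pow_growth: "\<bar>norm_pow l x\<bar> \<le> 1 * (1 + norm_pow l x)" by simp

text \<open>Interpolation between the exponents \<open>1 - \<alpha>\<close> and \<alpha> with a
  common majorant \<open>M\<close>. The exponent \<open>l * (1 - \<alpha>)\<close> may vanish, where
  \<open>norm_pow\<close> is 1 by convention; hence the separate case and a majorant of at least
  1.\<close>

lemma norm_pow_young:
  assumes q: "0 \<le> q"
  shows "norm_pow (l * (1 - \<alpha>)) y * q powr \<alpha> \<le> 2 + norm_pow l y + q"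
proof -
  define M where "M = 2 + norm_pow l y + q"
  have M: "1 + norm_pow l y \<le> M" "q \<le> M" "0 < M" using q norm_pow_nonneg[of l y] by (auto simp: M_def add_pos_nonneg)
  have "norm_pow (l * (1 - \<alpha>)) y \<le> M powr (1 - \<alpha>)"
  proof (cases "l * (1 - \<alpha>) = 0")
    case True
    then have "norm_pow (l * (1 - \<alpha>)) y = 1" by (simp add: norm_pow_def)
    also have "1 \<le> M powr (1 - \<alpha>)" using M(1) \<alpha> norm_pow_nonneg[of l y] by (intro ge_one_powr_ge_zero) linarith+
    finally show ?thesis .
  next
    case False
    then have "norm_pow (l * (1 - \<alpha>)) y = norm_pow l y powr (1 - \<alpha>)"
      by (auto simp: norm_pow_def powr_powr)
    also have "\<dots> \<le> M powr (1 - \<alpha>)" using M \<alpha> by (intro powr_mono2) auto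
    finally show ?thesis .
  qed
  moreover have "q powr \<alpha> \<le> M powr \<alpha>" using M q \<alpha> by (intro powr_mono2) auto
  ultimately have "norm_pow (l * (1 - \<alpha>)) y * q powr \<alpha> \<le> M powr (1 - \<alpha>) * M powr \<alpha>"
    by (intro mult_mono) auto
  also have "\<dots> = M" using M(3) by (simp add: powr_add[symmetric])
  finally show ?thesis by (simp add: M_def)
qed

context
  fixes C :: "nat \<Rightarrow> 'a set" and K :: nat and \<delta> \<theta> \<epsilon> :: real
  assumes C: "\<And>k. C k \<in> sets borel"
    and gd: "\<forall>m\<in>prob_moment l. good C K \<delta> \<theta> m \<longrightarrow>
      m \<in> wball \<and> (\<forall>x. \<bar>D m x - f x\<bar> \<le> \<epsilon> * (1 + norm_pow (l / 2) x))"
    and \<epsilon>: "0 < \<epsilon>"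
begin

private lemma wball_of_good: "m \<in> prob_moment l \<Longrightarrow> good C K \<delta> \<theta> m \<Longrightarrow> m \<in> wball"
  and D_close: "m \<in> prob_moment l \<Longrightarrow> good C K \<delta> \<theta> m \<Longrightarrow> \<bar>D m x - f x\<bar> \<le> \<epsilon> * (1 + norm_pow (l / 2) x)"
  using gd by auto

text \<open>The measure \<open>M\<close> of the mean value theorem depends on \<open>x i\<close>;
  the Hoelder condition replaces it by \<open>path N i x\<close>. The two differ by
  \<open>s / N\<close> times the difference of a Dirac mass and \<open>\<nu> i\<close>, so the total
  variation is at most \<open>2 / N\<close> and the moment of order \<open>l\<close> of the
  variation at most \<open>q / N\<close>. Each step, scaled by \<open>N\<close>, thus errs by order
  N to the power - \<alpha>.\<close>

lemma step_bound:
  fixes x :: "nat \<Rightarrow> 'a"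
  assumes i: "i \<in> {1..N}" and G: "good C K \<delta> \<theta> (path N i x)" "good C K \<delta> \<theta> (path N (Suc i) x)"
  shows "\<bar>real N * (U (path N (Suc i) x) - U (path N i x))
      - (D (path N i x) (x i) - (LINT y|\<nu> i. D (path N i x) y))\<bar>
    \<le> Ch * real N powr (- \<alpha>) * (10 + 7 * (norm_pow l (x i) + moment i))"
proof -
  have N: "0 < N" and i1: "1 \<le> i" using i by auto
  define m where "m = path N i x"
  define m' where "m' = path N (Suc i) x"
  define q where "q = norm_pow l (x i) + moment i"
  have q0: "0 \<le> q" by (simp add: q_def moment_nonneg)
  note pm = path_prob_moment[OF N, of i x, folded m_def] path_prob_moment[OF N, of "Suc i" x, folded m'_def]
  note G' = G[folded m_def m'_def]
  have mixb: "mix_measure s m m' \<in> wball" if "0 \<le> s" "s \<le> 1" for s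
    using wball_of_good[OF mix_measure_prob_moment[OF pm that] good_mix[OF C pm(1) G'(1) pm(2) G'(2) that]] .
  obtain s where s: "0 < s" "s < 1" and
    mv: "U m' - U m = (LINT y|m'. D (mix_measure s m m') y) - (LINT y|m. D (mix_measure s m m') y)"
    using functional_mvt[OF pm, of U D] deriv mixb unfolding wball_def by metis
  define M where "M = mix_measure s m m'"
  have Mb: "M \<in> wball" unfolding M_def using mixb s by simp
  have mb: "m \<in> wball" using wball_of_good[OF pm(1) G'(1)] .
  have mv': "real N * (U m' - U m) = D M (x i) - (LINT y|\<nu> i. D M y)"
    unfolding mv M_def[symmetric] using path_integral_step[OF i D_measurable[OF Mb] D_growth[OF Mb], of x] N
    by (simp add: m_def m'_def)
  \<comment> \<open>A weighted sum with a single summand serves as a scalar multiple of a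
    measure.\<close>
  define Pp where "Pp = weighted_sum_measure {0::nat} (\<lambda>_. s / real N) (\<lambda>_. return borel (x i))"
  define Q where "Q = weighted_sum_measure {0::nat} (\<lambda>_. s / real N) (\<lambda>_. \<nu> i)"
  note r = prob_momentD[OF return_prob_moment[of "x i" l]] and n = prob_momentD[OF \<nu>[OF i1]]
  have fP: "finite_measure Pp" "sets Pp = sets borel" "finite_measure Q" "sets Q = sets borel"
    unfolding Pp_def Q_def using r n by (auto intro!: finite_weighted_sum_measure)
  have sN: "0 \<le> s / real N" "s / real N \<le> 1 / real N" using s N by (auto intro: divide_right_mono)
  have mP: "measure Pp A = s / real N * indicator A (x i)" if "A \<in> sets borel" for A
    unfolding Pp_def using r sN that by (subst measure_weighted_sum_measure) (auto simp: measure_return)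
  have mQ: "measure Q A = s / real N * measure (\<nu> i) A" if "A \<in> sets borel" for A
    unfolding Q_def using n sN that by (subst measure_weighted_sum_measure) auto
  have \<tau>: "\<forall>A\<in>sets borel. measure_diff M m A = measure Pp A - measure Q A"
  proof
    fix A :: "'a set" assume A: "A \<in> sets borel"
    have "measure_diff M m A = s * (measure m' A - measure m A)"
      using measure_mix_measure[OF pm, of s A] s A by (simp add: measure_diff_def M_def algebra_simps)
    also have "\<dots> = s * ((indicator A (x i) - measure (\<nu> i) A) / real N)"
      unfolding m_def m'_def path_measure_step[OF i A] ..
    also have "\<dots> = measure Pp A - measure Q A" by (simp add: mP[OF A] mQ[OF A] algebra_simps diff_divide_distrib)
    finally show "measure_diff M m A = measure Pp A - measure Q A" .
  qed
  have "tv_norm (measure_diff M m) \<le> s / real N + s / real N"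
    using tv_norm_le[OF fP \<tau>] measure_prob_moment_UNIV[OF \<nu>[OF i1]] by (simp add: mP mQ)
  then have tv: "tv_norm (measure_diff M m) \<le> 2 / real N" using sN by simp
  have iP: "integrable Pp (norm_pow l)" "(LINT y|Pp. norm_pow l y) = s / real N * norm_pow l (x i)"
    unfolding Pp_def using r sN
    by (auto intro!: integrable_weighted_sum_measure simp: integral_weighted_sum_measure integral_return)
  have iQ: "integrable Q (norm_pow l)" "(LINT y|Q. norm_pow l y) = s / real N * moment i"
    unfolding Q_def using n sN
    by (auto intro!: integrable_weighted_sum_measure simp: integral_weighted_sum_measure moment_def)
  have "(LINT y|total_variation (measure_diff M m). norm_pow l y) \<le> s / real N * q"
    using integral_total_variation_le[OF fP \<tau> iP(1) iQ(1)] by (simp add: iP iQ q_def algebra_simps)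
  also have "\<dots> \<le> 1 / real N * q" using sN q0 by (intro mult_right_mono)
  finally have lt: "(LINT y|total_variation (measure_diff M m). norm_pow l y) \<le> q / real N" by simp
  define Na where "Na = real N powr (- \<alpha>)"
  have Na0: "0 \<le> Na" by (simp add: Na_def)
  have "tv_norm (measure_diff M m) powr \<alpha> \<le> (2 / real N) powr \<alpha>"
    using tv \<alpha> by (intro powr_mono2) (auto simp: tv_norm_def)
  also have "\<dots> = 2 powr \<alpha> * Na" using N by (simp add: powr_divide powr_minus_divide Na_def)
  also have "\<dots> \<le> 2 * Na" using \<alpha> powr_mono[of \<alpha> 1 2] Na0 by (intro mult_right_mono) auto
  finally have tva: "tv_norm (measure_diff M m) powr \<alpha> \<le> 2 * Na" .
  have "(LINT y|total_variation (measure_diff M m). norm_pow l y) powr \<alpha> \<le> (q / real N) powr \<alpha>"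
    using lt \<alpha> by (intro powr_mono2) (auto intro!: integral_nonneg_AE)
  also have "\<dots> = q powr \<alpha> * Na" using N q0 by (simp add: powr_divide powr_minus_divide Na_def)
  finally have lta: "(LINT y|total_variation (measure_diff M m). norm_pow l y) powr \<alpha> \<le> q powr \<alpha> * Na" .
  have qa: "q powr \<alpha> \<le> 1 + q"
  proof -
    have "q powr \<alpha> \<le> (1 + q) powr \<alpha>" using q0 \<alpha> by (intro powr_mono2) auto
    also have "\<dots> \<le> (1 + q) powr 1" using q0 \<alpha> by (intro powr_mono) auto
    finally show ?thesis using q0 by simp
  qed
  \<comment> \<open>With \<open>z\<close> for \<open>norm_pow l y\<close>, the bound collects
    \<open>2 * (1 + z)\<close>, \<open>1 + q\<close> and \<open>2 + z + q\<close>. Evaluated at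
    \<open>x i\<close> and integrated over \<open>\<nu> i\<close>, it yields the constants 10 = 5 +
    5 and 7 = 3 + 2 + 2 of the statement.\<close>
  have pw: "\<bar>D M y - D m y\<bar> \<le> Ch * Na * (5 + 3 * norm_pow l y + 2 * q)" for y
  proof -
    have "\<bar>D M y - D m y\<bar> \<le> Ch * ((1 + norm_pow l y) * tv_norm (measure_diff M m) powr \<alpha>
        + (1 + norm_pow (l * (1 - \<alpha>)) y) * (LINT y|total_variation (measure_diff M m). norm_pow l y) powr \<alpha>)"
      using hoelder mb Mb unfolding wball_def by blast
    also have "\<dots> \<le> Ch * ((1 + norm_pow l y) * (2 * Na) + (1 + norm_pow (l * (1 - \<alpha>)) y) * (q powr \<alpha> * Na))"
      using tva lta Ch by (intro mult_left_mono add_mono) auto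
    also have "\<dots> = Ch * Na * (2 * (1 + norm_pow l y) + q powr \<alpha> + norm_pow (l * (1 - \<alpha>)) y * q powr \<alpha>)"
      by (simp add: algebra_simps)
    also have "\<dots> \<le> Ch * Na * (5 + 3 * norm_pow l y + 2 * q)"
    proof (rule mult_left_mono)
      show "2 * (1 + norm_pow l y) + q powr \<alpha> + norm_pow (l * (1 - \<alpha>)) y * q powr \<alpha> \<le> 5 + 3 * norm_pow l y + 2 * q"
        using qa norm_pow_young[OF q0, of y] by simp
    qed (use Ch Na0 in simp)
    finally show ?thesis .
  qed
  note iM = D_integrable[OF Mb \<nu>[OF i1]] and im = D_integrable[OF mb \<nu>[OF i1]]
  interpret n: prob_space "\<nu> i" by (fact n(1))
  have "\<bar>(LINT y|\<nu> i. D M y) - (LINT y|\<nu> i. D m y)\<bar> = \<bar>LINT y|\<nu> i. D M y - D m y\<bar>"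
    using iM im by simp
  also have "\<dots> \<le> (LINT y|\<nu> i. \<bar>D M y - D m y\<bar>)" by (rule integral_abs_bound)
  also have "\<dots> \<le> (LINT y|\<nu> i. Ch * Na * (5 + 3 * norm_pow l y + 2 * q))"
    using iM im n pw by (intro integral_mono) auto
  also have "\<dots> = Ch * Na * (5 + 3 * moment i + 2 * q)"
    using n(4) by (simp add: moment_def n.prob_space)
  finally have 1: "\<bar>(LINT y|\<nu> i. D M y) - (LINT y|\<nu> i. D m y)\<bar> \<le> Ch * Na * (5 + 3 * moment i + 2 * q)" .
  have "\<bar>(D M (x i) - (LINT y|\<nu> i. D M y)) - (D m (x i) - (LINT y|\<nu> i. D m y))\<bar>
      \<le> Ch * Na * (5 + 3 * norm_pow l (x i) + 2 * q) + Ch * Na * (5 + 3 * moment i + 2 * q)"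
    using pw[of "x i"] 1 by linarith
  also have "\<dots> = Ch * Na * (10 + 7 * q)" by (simp add: q_def algebra_simps)
  finally show ?thesis
    unfolding mv'[symmetric] by (simp add: Na_def q_def m_def m'_def)
qed

text \<open>The increment is set to 0 off the good region, so that its second moment is small on the
  whole space. Goodness is tested on the path before the step, a function of the past alone, so the
  integral over the present still vanishes.\<close>

definition phi :: "nat \<Rightarrow> nat \<Rightarrow> (nat \<Rightarrow> 'a) \<times> 'a \<Rightarrow> real" where
  "phi N i p = (if good C K \<delta> \<theta> (path N i (fst p))
     then (D (path N i (fst p)) (snd p) - (LINT y|\<nu> i. D (path N i (fst p)) y)) - (f (snd p) - (LINT y|\<nu> i. f y))
     else 0)"

text \<open>Joint measurability of \<open>D\<close> is not assumed: up to a term that does not depend on the point,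
  \<open>D m y\<close> is a limit of difference quotients of \<open>U\<close>.\<close>

lemma phi_measurable:
  assumes i: "1 \<le> i" and N: "0 < N"
  shows "phi N i \<in> borel_measurable (PiM {1..<i} (\<lambda>_. borel) \<Otimes>\<^sub>M borel)"
proof -
  let ?S = "PiM {1..<i} (\<lambda>_. borel :: 'a measure) \<Otimes>\<^sub>M (borel :: 'a measure)"
  let ?m = "\<lambda>p. path N i (fst p)"
  have comp: "(\<lambda>p. g (fst p j)) \<in> borel_measurable ?S" if "j \<in> {1..<i}" "g \<in> borel_measurable borel"
    for j and g :: "'a \<Rightarrow> real"
    using that by (intro measurable_compose[OF _ that(2)] measurable_compose[OF measurable_fst]
      measurable_component_singleton)
  have snd_m: "(\<lambda>p. g (snd p)) \<in> borel_measurable ?S" if "g \<in> borel_measurable borel" for g :: "'a \<Rightarrow> real"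
    using measurable_compose[OF measurable_snd that] .
  have int_m: "(\<lambda>p. LINT y|?m p. g y) \<in> borel_measurable ?S"
    if "g \<in> borel_measurable borel" "\<And>x. \<bar>g x\<bar> \<le> K' * (1 + norm_pow l x)" for g K'
    unfolding path_integral[OF that]
  proof (intro borel_measurable_divide borel_measurable_const borel_measurable_sum)
    fix j assume "j \<in> {1..N}"
    then show "(\<lambda>p. if j < i then g (fst p j) else LINT y|\<nu> j. g y) \<in> borel_measurable ?S"
      using comp[of j g] that by (cases "j < i") auto
  qed
  have meas_m: "(\<lambda>p. measure (?m p) A) \<in> borel_measurable ?S" if A: "A \<in> sets borel" for A
    unfolding path_measure[OF A N]
  proof (intro borel_measurable_divide borel_measurable_const borel_measurable_sum)
    fix j assume "j \<in> {1..N}"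
    then show "(\<lambda>p. if j < i then indicat_real A (fst p j) else measure (\<nu> j) A) \<in> borel_measurable ?S"
      using comp[of j "indicator A"] A by (cases "j < i") auto
  qed
  have good_m: "{p \<in> space ?S. good C K \<delta> \<theta> (?m p)} \<in> sets ?S"
  proof -
    have a: "(\<lambda>p. measure (?m p) (C k)) \<in> borel_measurable ?S" for k by (rule meas_m[OF C])
    have b: "(\<lambda>p. LINT y|?m p. tail C K y) \<in> borel_measurable ?S"
      by (rule int_m[OF tail_props(1,2)[OF C]])
    show ?thesis
      unfolding good_def cells_close_def using a b by measurable
  qed
  \<comment> \<open>Difference quotients of \<open>U\<close> towards the Dirac mass at the present
    point and towards \<open>\<nu> i\<close>. Both limits contain the integral of \<open>D m\<close>
    against \<open>m\<close> itself, which cancels in the difference.\<close>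
  define u where "u n p = (if good C K \<delta> \<theta> (?m p)
     then real (Suc n) * (U (mix_measure (inverse (real (Suc n))) (?m p) (return borel (snd p)))
         - U (mix_measure (inverse (real (Suc n))) (?m p) (\<nu> i))) - (f (snd p) - (LINT y|\<nu> i. f y))
     else 0)" for n p
  show ?thesis
  proof (rule borel_measurable_LIMSEQ_real)
    fix n
    define e where "e = inverse (real (Suc n))"
    have e: "0 \<le> e" "e \<le> 1" by (auto simp: e_def field_simps)
    have 1: "(\<lambda>p. U (mix_measure e (?m p) (return borel (snd p)))) \<in> borel_measurable ?S"
    proof (rule U_comp_measurable)
      show "mix_measure e (?m p) (return borel (snd p)) \<in> prob_moment l" for p
        by (intro mix_measure_prob_moment path_prob_moment N return_prob_moment e)
      fix A :: "'a set" assume A: "A \<in> sets borel"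
      have eq: "measure (mix_measure e (?m p) (return borel (snd p))) A = (1 - e) * measure (?m p) A + e * indicator A (snd p)" for p
        using A by (subst measure_mix_measure[OF path_prob_moment[OF N] return_prob_moment e]) (simp_all add: measure_return)
      show "(\<lambda>p. measure (mix_measure e (?m p) (return borel (snd p))) A) \<in> borel_measurable ?S"
        unfolding eq using meas_m[OF A] snd_m[of "indicator A"] A by (intro borel_measurable_add borel_measurable_times) auto
    qed
    have 2: "(\<lambda>p. U (mix_measure e (?m p) (\<nu> i))) \<in> borel_measurable ?S"
    proof (rule U_comp_measurable)
      show "mix_measure e (?m p) (\<nu> i) \<in> prob_moment l" for p
        by (intro mix_measure_prob_moment path_prob_moment N \<nu> i e)
      fix A :: "'a set" assume A: "A \<in> sets borel"
      have eq: "measure (mix_measure e (?m p) (\<nu> i)) A = (1 - e) * measure (?m p) A + e * measure (\<nu> i) A" for p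
        using A by (subst measure_mix_measure[OF path_prob_moment[OF N] \<nu>[OF i] e]) simp_all
      show "(\<lambda>p. measure (mix_measure e (?m p) (\<nu> i)) A) \<in> borel_measurable ?S"
        unfolding eq using meas_m[OF A] by (intro borel_measurable_add borel_measurable_times) auto
    qed
    show "u n \<in> borel_measurable ?S"
      unfolding u_def e_def[symmetric] using 1 2 good_m snd_m[OF fm]
      by (intro measurable_If borel_measurable_diff borel_measurable_times) auto
  next
    fix p
    show "(\<lambda>n. u n p) \<longlonglongrightarrow> phi N i p"
    proof (cases "good C K \<delta> \<theta> (?m p)")
      case True
      note pm = path_prob_moment[OF N, of i "fst p"]
      have mb: "?m p \<in> wball" by (rule wball_of_good[OF pm True])
      have lim: "(\<lambda>n. real (Suc n) * (U (mix_measure (inverse (real (Suc n))) (?m p) \<zeta>) - U (?m p)))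
          \<longlonglongrightarrow> (LINT y|\<zeta>. D (?m p) y) - (LINT y|?m p. D (?m p) y)" if \<zeta>: "\<zeta> \<in> prob_moment l" for \<zeta>
      proof -
        have "((\<lambda>e. U (mix_measure e (?m p) \<zeta>)) has_real_derivative
            signed_integral (measure_diff \<zeta> (?m p)) (D (?m p))) (at_right 0)"
          using deriv mb \<zeta> unfolding wball_def has_linear_functional_derivative_def by blast
        then have "((\<lambda>e. (U (mix_measure e (?m p) \<zeta>) - U (?m p)) / (e - 0)) \<longlongrightarrow>
            signed_integral (measure_diff \<zeta> (?m p)) (D (?m p))) (at_right 0)"
          by (simp add: has_field_derivative_iff mix_measure_0[OF pm \<zeta>])
        moreover have "filterlim (\<lambda>n. inverse (real (Suc n))) (at_right 0) sequentially"
          using LIMSEQ_inverse_real_of_nat by (auto simp: filterlim_at)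
        ultimately have "(\<lambda>n. (U (mix_measure (inverse (real (Suc n))) (?m p) \<zeta>) - U (?m p)) / (inverse (real (Suc n)) - 0))
            \<longlonglongrightarrow> signed_integral (measure_diff \<zeta> (?m p)) (D (?m p))"
          by (rule filterlim_compose)
        then show ?thesis
          using signed_integral_measure_diff[OF pm \<zeta> D_measurable[OF mb] D_growth[OF mb]]
          by (simp add: divide_inverse mult.commute)
      qed
      have "(LINT y|return borel (snd p). D (?m p) y) = D (?m p) (snd p)"
        using D_measurable[OF mb] by (simp add: integral_return)
      then have "(\<lambda>n. real (Suc n) * (U (mix_measure (inverse (real (Suc n))) (?m p) (return borel (snd p))) - U (?m p))
          - real (Suc n) * (U (mix_measure (inverse (real (Suc n))) (?m p) (\<nu> i)) - U (?m p)) - (f (snd p) - (LINT y|\<nu> i. f y)))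
          \<longlonglongrightarrow> (D (?m p) (snd p) - (LINT y|?m p. D (?m p) y)) - ((LINT y|\<nu> i. D (?m p) y) - (LINT y|?m p. D (?m p) y))
            - (f (snd p) - (LINT y|\<nu> i. f y))"
        using lim[OF return_prob_moment[of "snd p"]] lim[OF \<nu>[OF i]] by (intro tendsto_diff tendsto_const) auto
      also have "(D (?m p) (snd p) - (LINT y|?m p. D (?m p) y)) - ((LINT y|\<nu> i. D (?m p) y) - (LINT y|?m p. D (?m p) y))
            - (f (snd p) - (LINT y|\<nu> i. f y)) = phi N i p"
        using True by (simp add: phi_def)
      also have "(\<lambda>n. real (Suc n) * (U (mix_measure (inverse (real (Suc n))) (?m p) (return borel (snd p))) - U (?m p))
          - real (Suc n) * (U (mix_measure (inverse (real (Suc n))) (?m p) (\<nu> i)) - U (?m p)) - (f (snd p) - (LINT y|\<nu> i. f y)))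
          = (\<lambda>n. u n p)"
        using True by (simp add: u_def right_diff_distrib)
      finally show ?thesis .
    qed (simp add: u_def phi_def)
  qed
qed

lemma phi_mean:
  assumes i: "1 \<le> i" and N: "0 < N"
  shows "(LINT y|\<nu> i. phi N i (x, y)) = 0"
proof (cases "good C K \<delta> \<theta> (path N i x)")
  case True
  interpret n: prob_space "\<nu> i" using \<nu>[OF i] by (rule prob_momentD)
  note I = D_integrable[OF wball_of_good[OF path_prob_moment[OF N] True] \<nu>[OF i]] f2_integrable(2)[OF i]
  show ?thesis using True I by (simp add: phi_def n.prob_space)
qed (simp add: phi_def)

text \<open>In the good region \<open>D\<close> is within \<epsilon> times the weight of
  \<open>f\<close>, so the increment is at most \<epsilon> times the weight at the present point
  plus its mean. The weight is of order \<open>l / 2\<close>, so its square is bounded by the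
  integrable weight of order \<open>l\<close>.\<close>

lemma phi_square_bound:
  assumes i: "1 \<le> i" and N: "0 < N"
  shows "(phi N i p)\<^sup>2 \<le> 4 * \<epsilon>\<^sup>2 * ((1 + norm_pow l (snd p)) + (1 + moment i))"
proof (cases "good C K \<delta> \<theta> (path N i (fst p))")
  case True
  let ?m = "path N i (fst p)"
  let ?a = "\<lambda>y::'a. 1 + norm_pow (l / 2) y"
  interpret n: prob_space "\<nu> i" using \<nu>[OF i] by (rule prob_momentD)
  note c = D_close[OF path_prob_moment[OF N] True]
  note I = D_integrable[OF wball_of_good[OF path_prob_moment[OF N] True] \<nu>[OF i]] f2_integrable(2)[OF i]
  have aK: "\<bar>?a x\<bar> \<le> 2 * (1 + norm_pow l x)" for x using growth_l[of 1 "?a x" x] by simp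
  have ia: "integrable (\<nu> i) ?a" by (rule \<nu>_integrable[OF i _ aK]) measurable
  have "\<bar>(?a x)\<^sup>2\<bar> \<le> 2 * (1 + norm_pow l x)" for x using growth_square[OF l, of x] by simp
  then have ia2: "integrable (\<nu> i) (\<lambda>x. (?a x)\<^sup>2)" by (intro \<nu>_integrable[OF i]) measurable
  define b where "b = (LINT y|\<nu> i. ?a y)"
  \<comment> \<open>Jensen's inequality, in the form that a variance is nonnegative.\<close>
  have b2: "b\<^sup>2 \<le> 2 * (1 + moment i)"
  proof -
    have "0 \<le> n.variance ?a" by (rule n.variance_positive)
    then have "b\<^sup>2 \<le> (LINT y|\<nu> i. (?a y)\<^sup>2)" using n.variance_eq[OF ia ia2] by (simp add: b_def)
    also have "\<dots> \<le> (LINT y|\<nu> i. 2 * (1 + norm_pow l y))"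
      using ia2 growth_square[OF l] prob_momentD(4)[OF \<nu>[OF i]] by (intro integral_mono) auto
    also have "\<dots> = 2 * (1 + moment i)"
      using prob_momentD(4)[OF \<nu>[OF i]] by (simp add: moment_def n.prob_space)
    finally show ?thesis .
  qed
  have "\<bar>(LINT y|\<nu> i. D ?m y) - (LINT y|\<nu> i. f y)\<bar> = \<bar>LINT y|\<nu> i. D ?m y - f y\<bar>" using I by simp
  also have "\<dots> \<le> (LINT y|\<nu> i. \<bar>D ?m y - f y\<bar>)" by (rule integral_abs_bound)
  also have "\<dots> \<le> (LINT y|\<nu> i. \<epsilon> * ?a y)"
    using I ia c by (intro integral_mono integrable_mult_right) auto
  also have "\<dots> = \<epsilon> * b" by (simp add: b_def)
  finally have "\<bar>phi N i p\<bar> \<le> \<epsilon> * (?a (snd p) + b)"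
    using c[of "snd p"] True unfolding distrib_left phi_def by (simp add: algebra_simps)
  then have "\<bar>phi N i p\<bar>\<^sup>2 \<le> (\<epsilon> * (?a (snd p) + b))\<^sup>2" by (intro power_mono) auto
  also have "\<dots> = \<epsilon>\<^sup>2 * (?a (snd p) + b)\<^sup>2" by (simp add: power_mult_distrib)
  also have "\<dots> \<le> \<epsilon>\<^sup>2 * (4 * ((1 + norm_pow l (snd p)) + (1 + moment i)))"
  proof (rule mult_left_mono)
    have "(?a (snd p) + b)\<^sup>2 \<le> 2 * (?a (snd p))\<^sup>2 + 2 * b\<^sup>2"
      using sum_squares_bound[of "?a (snd p)" b] by (simp add: power2_sum)
    then show "(?a (snd p) + b)\<^sup>2 \<le> 4 * ((1 + norm_pow l (snd p)) + (1 + moment i))"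
      using growth_square[OF l, of "snd p"] b2 by simp
  qed simp
  finally show ?thesis by (simp add: algebra_simps)
qed (auto simp: phi_def moment_nonneg intro!: mult_nonneg_nonneg add_nonneg_nonneg)

definition "martingale N \<omega> = (\<Sum>j=1..N. phi N j (restrict (\<lambda>i. X i \<omega>) {1..<j}, X j \<omega>))"

text \<open>Orthogonality leaves a sum of \<open>N\<close> second moments. After division by
  \<open>sqrt N\<close> the second moment is of order \<open>\<epsilon>\<^sup>2\<close> uniformly in
  \<open>N\<close>, the averaged moments being convergent.\<close>

lemma martingale_bound:
  assumes N: "0 < N"
  shows "martingale N \<in> borel_measurable P" "integrable P (\<lambda>\<omega>. (martingale N \<omega>)\<^sup>2)"
    "(LINT \<omega>|P. (martingale N \<omega>)\<^sup>2) \<le> 8 * \<epsilon>\<^sup>2 * real N * (1 + (LINT x|nubar N. norm_pow l x))"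
proof -
  have m: "(\<lambda>\<omega>. phi N j (restrict (\<lambda>i. X i \<omega>) {1..<j}, X j \<omega>)) \<in> borel_measurable P" if "1 \<le> j" for j
    using indep_past_present(2,3)[OF prob_space_axioms indep that]
    by (intro measurable_compose[OF _ phi_measurable[OF that N]] measurable_Pair) auto
  have ib: "integrable P (\<lambda>\<omega>. 4 * \<epsilon>\<^sup>2 * ((1 + norm_pow l (X j \<omega>)) + (1 + moment j)))" if j: "1 \<le> j" for j
    using law_integral(2)[OF j norm_pow_measurable] prob_momentD(4)[OF \<nu>[OF j]] by simp
  have sq: "integrable P (\<lambda>\<omega>. (phi N j (restrict (\<lambda>i. X i \<omega>) {1..<j}, X j \<omega>))\<^sup>2)" if j: "1 \<le> j" for j
  proof (rule Bochner_Integration.integrable_bound[OF ib[OF j]])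
    show "AE \<omega> in P. norm ((phi N j (restrict (\<lambda>i. X i \<omega>) {1..<j}, X j \<omega>))\<^sup>2)
        \<le> norm (4 * \<epsilon>\<^sup>2 * ((1 + norm_pow l (X j \<omega>)) + (1 + moment j)))"
      using phi_square_bound[OF j N] by (intro AE_I2) (fastforce intro: order_trans[OF _ abs_ge_self])
  qed (use m[OF j] in measurable)
  show "martingale N \<in> borel_measurable P"
    unfolding martingale_def using m by (intro borel_measurable_sum) auto
  have zero: "(LINT y|distr P borel (X j). phi N j (x, y)) = 0" if "1 \<le> j" for j x
    unfolding law[OF that] by (rule phi_mean[OF that N])
  note o = orthogonal_increments[OF prob_space_axioms indep, of N "phi N", OF phi_measurable[OF _ N] zero sq]
  show "integrable P (\<lambda>\<omega>. (martingale N \<omega>)\<^sup>2)"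
    unfolding martingale_def by (rule o(1))
  have "(LINT \<omega>|P. (martingale N \<omega>)\<^sup>2) = (\<Sum>j=1..N. LINT \<omega>|P. (phi N j (restrict (\<lambda>i. X i \<omega>) {1..<j}, X j \<omega>))\<^sup>2)"
    unfolding martingale_def by (rule o(2))
  also have "\<dots> \<le> (\<Sum>j=1..N. 8 * \<epsilon>\<^sup>2 * (1 + moment j))"
  proof (rule sum_mono)
    fix j assume "j \<in> {1..N}"
    then have j: "1 \<le> j" by simp
    have "(LINT \<omega>|P. (phi N j (restrict (\<lambda>i. X i \<omega>) {1..<j}, X j \<omega>))\<^sup>2)
        \<le> (LINT \<omega>|P. 4 * \<epsilon>\<^sup>2 * ((1 + norm_pow l (X j \<omega>)) + (1 + moment j)))"
      using sq[OF j] ib[OF j] phi_square_bound[OF j N] by (intro integral_mono) (auto simp del: atLeastLessThan_iff)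
    also have "\<dots> = 8 * \<epsilon>\<^sup>2 * (1 + moment j)"
      using law_integral[OF j norm_pow_measurable, of l] prob_momentD(4)[OF \<nu>[OF j]]
      by (simp add: moment_def prob_space algebra_simps)
    finally show "(LINT \<omega>|P. (phi N j (restrict (\<lambda>i. X i \<omega>) {1..<j}, X j \<omega>))\<^sup>2) \<le> 8 * \<epsilon>\<^sup>2 * (1 + moment j)" .
  qed
  also have "\<dots> = 8 * \<epsilon>\<^sup>2 * (real N + (\<Sum>j=1..N. moment j))"
    by (simp add: sum_distrib_left[symmetric] sum.distrib)
  also have "(\<Sum>j=1..N. moment j) = real N * (LINT x|nubar N. norm_pow l x)"
    using integral_nubar[OF norm_pow_measurable norm_pow_growth, of N] N by (simp add: moment_def)
  also have "8 * \<epsilon>\<^sup>2 * (real N + real N * (LINT x|nubar N. norm_pow l x)) = 8 * \<epsilon>\<^sup>2 * real N * (1 + (LINT x|nubar N. norm_pow l x))"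
    by (simp add: algebra_simps)
  finally show "(LINT \<omega>|P. (martingale N \<omega>)\<^sup>2) \<le> 8 * \<epsilon>\<^sup>2 * real N * (1 + (LINT x|nubar N. norm_pow l x))" .
qed

text \<open>The sum of the bounds of \<open>step_bound\<close>, with the factor
  \<open>sqrt N / N\<close> that remains after scaling.\<close>

definition "error N \<omega> = Ch * real N powr (- \<alpha>) * (\<Sum>i=1..N. 10 + 7 * (norm_pow l (X i \<omega>) + moment i)) / sqrt (real N)"

text \<open>Telescoping along the path. Goodness of all \<open>N + 1\<close> path measures puts
  every \<open>phi\<close> into its first branch and makes \<open>step_bound\<close> available at
  each step; the part of the increment subtracted in \<open>phi\<close> is the independent summand
  \<open>Y i\<close>.\<close>

lemma decomposition:
  assumes N: "0 < N" and G: "\<And>i. i \<in> {1..Suc N} \<Longrightarrow> good C K \<delta> \<theta> (path N i (\<lambda>j. X j \<omega>))"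
  shows "\<bar>sqrt (real N) * (U (average_measure N (\<lambda>j. return borel (X j \<omega>))) - U (nubar N))
      - (\<Sum>i=1..N. Y i \<omega>) / sqrt (real N)\<bar> \<le> \<bar>martingale N \<omega> / sqrt (real N)\<bar> + error N \<omega>"
proof -
  let ?x = "\<lambda>j. X j \<omega>"
  let ?u = "\<lambda>i. U (path N i ?x)"
  have res: "path N i (restrict ?x {1..<i}) = path N i ?x" for i by (intro path_cong) auto
  define d where "d i = real N * (?u (Suc i) - ?u i) - (D (path N i ?x) (X i \<omega>) - (LINT y|\<nu> i. D (path N i ?x) y))" for i
  have d: "\<bar>d i\<bar> \<le> Ch * real N powr (- \<alpha>) * (10 + 7 * (norm_pow l (X i \<omega>) + moment i))" if "i \<in> {1..N}" for i
    unfolding d_def using step_bound[OF that, of ?x] G that by simp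
  have eq: "real N * (?u (Suc i) - ?u i) = phi N i (restrict ?x {1..<i}, X i \<omega>) + Y i \<omega> + d i" if "i \<in> {1..N}" for i
    using G[of i] that by (simp only: phi_def fst_conv snd_conv res) (simp add: Y_def d_def)
  have "U (average_measure N (\<lambda>j. return borel (X j \<omega>))) - U (nubar N) = ?u (Suc N) - ?u 1"
    using path_last[of N ?x] path_first[of N ?x] by simp
  also have "\<dots> = (\<Sum>i=1..N. ?u (Suc i) - ?u i)" by (rule sum_Suc_diff[symmetric]) simp
  finally have "real N * (U (average_measure N (\<lambda>j. return borel (X j \<omega>))) - U (nubar N))
      = (\<Sum>i=1..N. real N * (?u (Suc i) - ?u i))" by (simp only: sum_distrib_left)
  also have "\<dots> = (\<Sum>i=1..N. phi N i (restrict ?x {1..<i}, X i \<omega>) + Y i \<omega> + d i)"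
    by (rule sum.cong[OF refl eq])
  also have "\<dots> = martingale N \<omega> + (\<Sum>i=1..N. Y i \<omega>) + (\<Sum>i=1..N. d i)"
    by (simp only: martingale_def sum.distrib)
  finally have e1: "real N * (U (average_measure N (\<lambda>j. return borel (X j \<omega>))) - U (nubar N))
      = martingale N \<omega> + (\<Sum>i=1..N. Y i \<omega>) + (\<Sum>i=1..N. d i)" .
  have "sqrt (real N) * (U (average_measure N (\<lambda>j. return borel (X j \<omega>))) - U (nubar N))
      = real N * (U (average_measure N (\<lambda>j. return borel (X j \<omega>))) - U (nubar N)) / sqrt (real N)"
    using real_div_sqrt[of "real N"] by (metis of_nat_0_le_iff times_divide_eq_left)
  also have "\<dots> = martingale N \<omega> / sqrt (real N) + (\<Sum>i=1..N. Y i \<omega>) / sqrt (real N) + (\<Sum>i=1..N. d i) / sqrt (real N)"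
    unfolding e1 by (simp add: add_divide_distrib)
  finally have e2: "sqrt (real N) * (U (average_measure N (\<lambda>j. return borel (X j \<omega>))) - U (nubar N))
      - (\<Sum>i=1..N. Y i \<omega>) / sqrt (real N) = martingale N \<omega> / sqrt (real N) + (\<Sum>i=1..N. d i) / sqrt (real N)" by simp
  have "\<bar>\<Sum>i=1..N. d i\<bar> \<le> (\<Sum>i=1..N. Ch * real N powr (- \<alpha>) * (10 + 7 * (norm_pow l (X i \<omega>) + moment i)))"
    using d by (intro order_trans[OF sum_abs] sum_mono) auto
  then have "\<bar>(\<Sum>i=1..N. d i) / sqrt (real N)\<bar> \<le> error N \<omega>"
    unfolding error_def sum_distrib_left by (simp add: divide_right_mono)
  then show ?thesis unfolding e2 by linarith
qed

text \<open>The exponent \<open>1 / 2 - \<alpha>\<close> collects the \<open>N\<close> steps, the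
  Hoelder factor and the division by \<open>sqrt N\<close>. It is negative, so the mean of the error
  vanishes in the limit as the averaged moments stay bounded.\<close>

lemma error_props:
  assumes N: "0 < N"
  shows "integrable P (error N)" "0 \<le> error N \<omega>"
    "(LINT \<omega>|P. error N \<omega>) = Ch * (real N powr (1 / 2 - \<alpha>) * (10 + 14 * (LINT x|nubar N. norm_pow l x)))"
proof -
  have i: "integrable P (\<lambda>\<omega>. norm_pow l (X i \<omega>))" "(LINT \<omega>|P. norm_pow l (X i \<omega>)) = moment i" if "1 \<le> i" for i
    using law_integral[OF that norm_pow_measurable, of l] prob_momentD(4)[OF \<nu>[OF that]] by (auto simp: moment_def)
  show "integrable P (error N)"
    unfolding error_def using i
    by (intro integrable_divide integrable_mult_right Bochner_Integration.integrable_sum Bochner_Integration.integrable_add) auto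
  show "0 \<le> error N \<omega>"
    unfolding error_def using Ch moment_nonneg
    by (intro divide_nonneg_nonneg mult_nonneg_nonneg sum_nonneg add_nonneg_nonneg) auto
  have "(LINT \<omega>|P. error N \<omega>) = Ch * real N powr (- \<alpha>) * (\<Sum>j=1..N. LINT \<omega>|P. 10 + 7 * (norm_pow l (X j \<omega>) + moment j)) / sqrt (real N)"
    unfolding error_def using i by (subst Bochner_Integration.integral_sum[symmetric]) auto
  also have "(\<Sum>j=1..N. LINT \<omega>|P. 10 + 7 * (norm_pow l (X j \<omega>) + moment j)) = (\<Sum>j=1..N. 10 + 14 * moment j)"
    using i by (intro sum.cong) (auto simp: prob_space)
  also have "\<dots> = 10 * real N + 14 * (\<Sum>j=1..N. moment j)"
    by (simp add: sum.distrib sum_distrib_left[symmetric])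
  also have "(\<Sum>j=1..N. moment j) = real N * (LINT x|nubar N. norm_pow l x)"
    using integral_nubar[OF norm_pow_measurable norm_pow_growth, of N] N by (simp add: moment_def)
  also have "Ch * real N powr (- \<alpha>) * (10 * real N + 14 * (real N * (LINT x|nubar N. norm_pow l x))) / sqrt (real N)
      = Ch * ((real N powr (- \<alpha>) * (real N / sqrt (real N))) * (10 + 14 * (LINT x|nubar N. norm_pow l x)))"
    by (simp add: algebra_simps add_divide_distrib)
  also have "real N / sqrt (real N) = real N powr (1 / 2)"
    using N by (simp add: powr_half_sqrt real_div_sqrt)
  also have "real N powr (- \<alpha>) * real N powr (1 / 2) = real N powr (1 / 2 - \<alpha>)"
    by (simp add: powr_add[symmetric])
  finally show "(LINT \<omega>|P. error N \<omega>) = Ch * (real N powr (1 / 2 - \<alpha>) * (10 + 14 * (LINT x|nubar N. norm_pow l x)))" .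
qed

end

end

section \<open>Negligibility of the remainder and the limit law\<close>

context nonlinear_clt
begin

definition "empirical N \<omega> = average_measure N (\<lambda>j. return borel (X j \<omega>))"

lemma U_empirical_measurable:
  assumes N: "0 < N"
  shows "(\<lambda>\<omega>. U (empirical N \<omega>)) \<in> borel_measurable P"
proof (rule U_comp_measurable)
  show "empirical N \<omega> \<in> prob_moment l" for \<omega>
    unfolding empirical_def using N return_prob_moment by (intro average_measure_prob_moment) auto
  fix A :: "'a set" assume A: "A \<in> sets borel"
  have eq: "measure (empirical N \<omega>) A = (\<Sum>j=1..N. indicator A (X j \<omega>)) / real N" for \<omega>
    unfolding empirical_def using A return_prob_moment
    by (subst measure_average_measure[where l=l]) (auto simp: measure_return)
  have "(\<lambda>\<omega>. indicat_real A (X j \<omega>)) \<in> borel_measurable P" if "1 \<le> j" for j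
    using measurable_compose[OF Xm[OF that] borel_measurable_indicator[OF A]] .
  then show "(\<lambda>\<omega>. measure (empirical N \<omega>) A) \<in> borel_measurable P"
    unfolding eq by (intro borel_measurable_divide borel_measurable_sum) auto
qed

definition "remainder N \<omega> = sqrt (real N) * (U (empirical N \<omega>) - U (nubar N)) - (\<Sum>i=1..N. Y i \<omega>) / sqrt (real N)"

text \<open>Cell masses of the path measures are controlled through partial sums. For the tail
  integrals positivity is used: each summand is either a sample value or its mean, so the sum of
  both full averages dominates the tails of all path measures at once.\<close>

lemma path_good:
  assumes N: "0 < N" and C: "\<And>k. C k \<in> sets borel" and nb: "cells_close C K (\<delta> / 2) (nubar N)"
    and cells: "\<And>k i. k < K \<Longrightarrow> i \<le> N \<Longrightarrow>
      \<bar>\<Sum>j=1..i. indicator (C k) (X j \<omega>) - measure (\<nu> j) (C k)\<bar> \<le> \<delta> / 2 * real N"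
    and tl: "(\<Sum>j=1..N. tail C K (X j \<omega>)) / real N + (LINT x|nubar N. tail C K x) \<le> \<theta>"
    and i: "i \<in> {1..Suc N}"
  shows "good C K \<delta> \<theta> (path N i (\<lambda>j. X j \<omega>))"
  unfolding good_def cells_close_def
proof (intro conjI allI impI)
  fix k assume k: "k < K"
  have "measure (path N i (\<lambda>j. X j \<omega>)) (C k)
      = ((\<Sum>j=1..N. measure (\<nu> j) (C k)) + (\<Sum>j=1..i-1. indicator (C k) (X j \<omega>) - measure (\<nu> j) (C k))) / real N"
    unfolding path_measure[OF C N] using i by (subst path_sum_eq) auto
  also have "\<dots> = measure (nubar N) (C k) + (\<Sum>j=1..i-1. indicator (C k) (X j \<omega>) - measure (\<nu> j) (C k)) / real N"
    unfolding nubar_def using \<nu> C by (subst measure_average_measure[where l=l]) (auto simp: add_divide_distrib)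
  finally have "measure (path N i (\<lambda>j. X j \<omega>)) (C k) - measure \<mu> (C k) = (measure (nubar N) (C k) - measure \<mu> (C k))
      + (\<Sum>j=1..i-1. indicator (C k) (X j \<omega>) - measure (\<nu> j) (C k)) / real N" by simp
  moreover have "\<bar>(\<Sum>j=1..i-1. indicator (C k) (X j \<omega>) - measure (\<nu> j) (C k)) / real N\<bar> \<le> \<delta> / 2"
  proof -
    have "i - 1 \<le> N" using i by auto
    from cells[OF k this] show ?thesis using N by (simp add: abs_divide pos_divide_le_eq)
  qed
  moreover have "\<bar>measure (nubar N) (C k) - measure \<mu> (C k)\<bar> \<le> \<delta> / 2"
    using nb k by (auto simp: cells_close_def)
  ultimately show "\<bar>measure (path N i (\<lambda>j. X j \<omega>)) (C k) - measure \<mu> (C k)\<bar> \<le> \<delta>" by linarith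
next
  note t = tail_props(1,2)[OF C]
  have "(LINT x|path N i (\<lambda>j. X j \<omega>). tail C K x)
      = (\<Sum>j=1..N. if j < i then tail C K (X j \<omega>) else (LINT y|\<nu> j. tail C K y)) / real N"
    by (rule path_integral[OF t])
  also have "\<dots> \<le> (\<Sum>j=1..N. tail C K (X j \<omega>) + (LINT y|\<nu> j. tail C K y)) / real N"
    using tail_props(3)[OF C]
    by (intro divide_right_mono sum_mono) (auto intro!: integral_nonneg_AE)
  also have "\<dots> = (\<Sum>j=1..N. tail C K (X j \<omega>)) / real N + (LINT x|nubar N. tail C K x)"
    unfolding integral_nubar[OF t] by (simp add: sum.distrib add_divide_distrib)
  finally show "(LINT x|path N i (\<lambda>j. X j \<omega>). tail C K x) \<le> \<theta>" using tl by simp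
qed

lemma remainder_measurable: "0 < N \<Longrightarrow> remainder N \<in> borel_measurable P"
  unfolding remainder_def using U_empirical_measurable Y_measurable
  by (intro borel_measurable_diff borel_measurable_times borel_measurable_divide borel_measurable_sum) auto

text \<open>The parameters are chosen in the order \<epsilon>, \<theta>, \<kappa>, cells: \<epsilon>
  limits the martingale part, \<theta> results from \<epsilon>, and \<kappa> limits the probability
  that a tail exceeds \<theta>. With all of them fixed, the failure of the cell masses and the
  Hoelder error vanish as \<open>N\<close> grows.\<close>

lemma remainder_tendsto:
  assumes e: "0 < e"
  shows "(\<lambda>N. prob {\<omega>\<in>space P. e < \<bar>remainder N \<omega>\<bar>}) \<longlonglongrightarrow> 0"
proof (rule LIMSEQ_I)
  fix \<rho> :: real assume \<rho>: "0 < \<rho>"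
  define M where "M = (LINT x|\<mu>. norm_pow l x)"
  have M0: "0 \<le> M" unfolding M_def by (intro integral_nonneg_AE) auto
  \<comment> \<open>Makes Chebyshev's bound for the martingale part at level \<open>e / 2\<close>
    tend to \<open>\<rho> / 8\<close>.\<close>
  define \<epsilon> where "\<epsilon> = sqrt (\<rho> * e\<^sup>2 / (256 * (1 + M)))"
  have \<epsilon>: "0 < \<epsilon>" using \<rho> e M0 by (simp add: \<epsilon>_def add_pos_nonneg)
  have \<epsilon>2: "8 * \<epsilon>\<^sup>2 * (1 + M) / (e / 2)\<^sup>2 = \<rho> / 8"
  proof -
    define c where "c = 1 + M"
    have "0 < c" using M0 by (simp add: c_def)
    then show ?thesis using \<rho> e unfolding \<epsilon>_def c_def[symmetric] by (simp add: power_divide)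
  qed
  obtain \<theta> where \<theta>: "0 < \<theta>" and nb:
    "\<And>\<kappa>. 0 < \<kappa> \<Longrightarrow> \<exists>K C \<delta>. 0 < \<delta> \<and> (\<forall>k. C k \<in> sets borel) \<and> (LINT x|\<mu>. tail C K x) \<le> \<kappa> \<and>
       (\<forall>m\<in>prob_moment l. good C K \<delta> \<theta> m \<longrightarrow>
          m \<in> wball \<and> (\<forall>x. \<bar>D m x - f x\<bar> \<le> \<epsilon> * (1 + norm_pow (l / 2) x)))"
    using neighbourhood[OF \<epsilon>] by blast
  \<comment> \<open>Markov's bound for the tails is at most
    \<open>2 * \<kappa> / \<theta> = \<rho> / 8\<close> in the limit; the 2 comes from
    \<open>W\<close>, whose mean contains the averaged tail twice.\<close>
  define \<kappa> where "\<kappa> = \<rho> * \<theta> / 16"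
  have \<kappa>: "0 < \<kappa>" using \<rho> \<theta> by (simp add: \<kappa>_def)
  obtain K C \<delta> where C: "\<And>k. C k \<in> sets borel" and \<delta>: "0 < \<delta>"
    and t\<mu>: "(LINT x|\<mu>. tail C K x) \<le> \<kappa>"
    and gd: "\<forall>m\<in>prob_moment l. good C K \<delta> \<theta> m \<longrightarrow>
      m \<in> wball \<and> (\<forall>x. \<bar>D m x - f x\<bar> \<le> \<epsilon> * (1 + norm_pow (l / 2) x))"
    using nb[OF \<kappa>] by metis
  note mart = martingale_bound[of C K \<delta> \<theta> \<epsilon>, OF C gd \<epsilon>]
  note dec = decomposition[of C K \<delta> \<theta> \<epsilon>, OF C gd \<epsilon>]
  note err = error_props[of C K \<delta> \<theta> \<epsilon>, OF C gd \<epsilon>]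
  let ?mart = "martingale C K \<delta> \<theta>"
  note t = tail_props(1,2)[OF C]
  define W where "W N \<omega> = (\<Sum>j=1..N. tail C K (X j \<omega>)) / real N + (LINT x|nubar N. tail C K x)" for N \<omega>
  define E where "E N k = {\<omega>\<in>space P. \<exists>i\<le>N.
      \<delta> / 2 * real N \<le> \<bar>\<Sum>j=1..i. indicat_real (C k) (X j \<omega>) - (LINT \<omega>|P. indicat_real (C k) (X j \<omega>))\<bar>}" for N k
  define T where "T N = {\<omega>\<in>space P. \<theta> \<le> W N \<omega>}" for N
  define S where "S N = {\<omega>\<in>space P. e / 2 \<le> \<bar>?mart N \<omega> / sqrt (real N)\<bar>}" for N
  define Q where "Q N = {\<omega>\<in>space P. e / 2 \<le> error N \<omega>}" for N
  have indm: "(\<lambda>\<omega>. indicat_real (C k) (X j \<omega>)) \<in> borel_measurable P" if "1 \<le> j" for j k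
    using measurable_compose[OF Xm[OF that] borel_measurable_indicator[OF C]] .
  have Em: "E N k \<in> events" for N k
  proof -
    have "(\<lambda>\<omega>. \<Sum>j=1..i. indicat_real (C k) (X j \<omega>) - (LINT \<omega>|P. indicat_real (C k) (X j \<omega>))) \<in> borel_measurable P" for i
      using indm by (intro borel_measurable_sum borel_measurable_diff) auto
    then show ?thesis unfolding E_def by measurable
  qed
  have Wi: "integrable P (W N)" "(LINT \<omega>|P. W N \<omega>) = 2 * (LINT x|nubar N. tail C K x)" if "0 < N" for N
  proof -
    have i: "integrable P (\<lambda>\<omega>. tail C K (X j \<omega>))" "(LINT \<omega>|P. tail C K (X j \<omega>)) = (LINT x|\<nu> j. tail C K x)" if "1 \<le> j" for j
      using law_integral[OF that t(1)] \<nu>_integrable[OF that t] by auto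
    show "integrable P (W N)" unfolding W_def using i
      by (intro Bochner_Integration.integrable_add integrable_divide Bochner_Integration.integrable_sum) auto
    have "(LINT \<omega>|P. W N \<omega>) = (\<Sum>j=1..N. LINT x|\<nu> j. tail C K x) / real N + (LINT x|nubar N. tail C K x)"
      unfolding W_def using i
      by (subst Bochner_Integration.integral_add)
         (auto simp: prob_space intro!: integrable_divide Bochner_Integration.integrable_sum)
    then show "(LINT \<omega>|P. W N \<omega>) = 2 * (LINT x|nubar N. tail C K x)"
      using integral_nubar[OF t, of N] by simp
  qed
  have tail0: "0 \<le> (LINT x|m. tail C K x)" for m
    using tail_props(3)[OF C] by (intro integral_nonneg_AE) auto
  have W0: "0 \<le> W N \<omega>" for N \<omega>
    unfolding W_def using tail_props(3)[OF C] tail0 by (intro add_nonneg_nonneg divide_nonneg_nonneg sum_nonneg) auto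
  have Tm: "T N \<in> events" if "0 < N" for N
    unfolding T_def using borel_measurable_integrable[OF Wi(1)[OF that]] by measurable
  have Sm: "S N \<in> events" if "0 < N" for N
    unfolding S_def using mart(1)[OF that] by measurable
  have Qm: "Q N \<in> events" if "0 < N" for N
    unfolding Q_def using borel_measurable_integrable[OF err(1)[OF that]] by measurable
  have PT: "prob (T N) \<le> 2 * (LINT x|nubar N. tail C K x) / \<theta>" if "0 < N" for N
    unfolding T_def Wi(2)[OF that, symmetric]
    using Wi(1)[OF that] W0 \<theta> by (intro integral_Markov_inequality_measure[where A="{}"]) auto
  have PQ: "prob (Q N) \<le> Ch * (real N powr (1 / 2 - \<alpha>) * (10 + 14 * (LINT x|nubar N. norm_pow l x))) / (e / 2)" if "0 < N" for N
    unfolding Q_def err(3)[OF that, symmetric]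
    using err(1,2)[OF that] e by (intro integral_Markov_inequality_measure[where A="{}"]) auto
  have PS: "prob (S N) \<le> 8 * \<epsilon>\<^sup>2 * (1 + (LINT x|nubar N. norm_pow l x)) / (e / 2)\<^sup>2" if N: "0 < N" for N
  proof -
    have "prob (S N) \<le> (LINT \<omega>|P. (?mart N \<omega> / sqrt (real N))\<^sup>2) / (e / 2)\<^sup>2"
      unfolding S_def using mart(1,2)[OF N] e by (intro second_moment_method) (auto simp: power_divide)
    also have "(LINT \<omega>|P. (?mart N \<omega> / sqrt (real N))\<^sup>2) = (LINT \<omega>|P. (?mart N \<omega>)\<^sup>2) / real N"
      by (simp add: power_divide)
    also have "\<dots> \<le> 8 * \<epsilon>\<^sup>2 * (1 + (LINT x|nubar N. norm_pow l x))"
      using mart(3)[OF N] N by (simp add: pos_divide_le_eq mult_ac)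
    finally show ?thesis by (simp add: divide_right_mono)
  qed
  \<comment> \<open>Off these events all path measures are good and both error terms are below
    \<open>e / 2\<close>. The admissible deviation \<delta> of a cell mass is shared equally between
    the averaged law and the sample.\<close>
  have sub: "{\<omega>\<in>space P. e < \<bar>remainder N \<omega>\<bar>} \<subseteq> (\<Union>k<K. E N k) \<union> T N \<union> (S N \<union> Q N)"
    if N: "0 < N" and close: "cells_close C K (\<delta> / 2) (nubar N)" for N
  proof
    fix \<omega> assume \<omega>: "\<omega> \<in> {\<omega>\<in>space P. e < \<bar>remainder N \<omega>\<bar>}"
    show "\<omega> \<in> (\<Union>k<K. E N k) \<union> T N \<union> (S N \<union> Q N)"
    proof (rule ccontr)
      assume n: "\<omega> \<notin> (\<Union>k<K. E N k) \<union> T N \<union> (S N \<union> Q N)"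
      have G: "good C K \<delta> \<theta> (path N i (\<lambda>j. X j \<omega>))" if i: "i \<in> {1..Suc N}" for i
      proof (rule path_good[OF N C close _ _ i])
        fix k i assume k: "k < K" and i: "i \<le> N"
        have ind: "(LINT \<omega>|P. indicat_real (C k) (X j \<omega>)) = measure (\<nu> j) (C k)" if "1 \<le> j" for j
          using law_integral(1)[OF that, of "indicator (C k)"] C \<nu>[OF that] by (simp add: prob_momentD)
        have "(\<Sum>j=1..i. indicat_real (C k) (X j \<omega>) - (LINT \<omega>|P. indicat_real (C k) (X j \<omega>)))
            = (\<Sum>j=1..i. indicat_real (C k) (X j \<omega>) - measure (\<nu> j) (C k))"
          using ind by (intro sum.cong) auto
        moreover have "\<omega> \<notin> E N k" using n k by blast
        then have "\<bar>\<Sum>j=1..i. indicat_real (C k) (X j \<omega>) - (LINT \<omega>|P. indicat_real (C k) (X j \<omega>))\<bar> < \<delta> / 2 * real N"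
          using \<omega> i unfolding E_def not_le[symmetric] by blast
        ultimately show "\<bar>\<Sum>j=1..i. indicator (C k) (X j \<omega>) - measure (\<nu> j) (C k)\<bar> \<le> \<delta> / 2 * real N"
          by (simp only: less_imp_le)
      next
        show "(\<Sum>j=1..N. tail C K (X j \<omega>)) / real N + (LINT x|nubar N. tail C K x) \<le> \<theta>"
          using n \<omega> by (auto simp: T_def W_def)
      qed
      have "\<bar>remainder N \<omega>\<bar> \<le> \<bar>?mart N \<omega> / sqrt (real N)\<bar> + error N \<omega>"
        unfolding remainder_def empirical_def by (rule dec[OF N G])
      moreover have "\<bar>?mart N \<omega> / sqrt (real N)\<bar> < e / 2" "error N \<omega> < e / 2"
        using n \<omega> by (auto simp: S_def Q_def not_le simp del: abs_divide)
      moreover have "e < \<bar>remainder N \<omega>\<bar>" using \<omega> by simp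
      ultimately show False by linarith
    qed
  qed
  define B where "B N = (\<Sum>k<K. prob (E N k)) + 2 * (LINT x|nubar N. tail C K x) / \<theta>
      + (8 * \<epsilon>\<^sup>2 * (1 + (LINT x|nubar N. norm_pow l x)) / (e / 2)\<^sup>2
        + Ch * (real N powr (1 / 2 - \<alpha>) * (10 + 14 * (LINT x|nubar N. norm_pow l x))) / (e / 2))" for N
  have bound: "prob {\<omega>\<in>space P. e < \<bar>remainder N \<omega>\<bar>} \<le> B N"
    if N: "0 < N" and close: "cells_close C K (\<delta> / 2) (nubar N)" for N
  proof -
    have "(\<Union>k<K. E N k) \<in> events" using Em by auto
    note ev = this Tm[OF N] Sm[OF N] Qm[OF N]
    have "prob {\<omega>\<in>space P. e < \<bar>remainder N \<omega>\<bar>} \<le> prob ((\<Union>k<K. E N k) \<union> T N \<union> (S N \<union> Q N))"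
      using sub[OF N close] ev by (intro finite_measure_mono) auto
    also have "\<dots> \<le> prob ((\<Union>k<K. E N k) \<union> T N) + prob (S N \<union> Q N)"
      using ev by (intro measure_Un_le) auto
    also have "prob ((\<Union>k<K. E N k) \<union> T N) \<le> prob (\<Union>k<K. E N k) + prob (T N)"
      using ev by (intro measure_Un_le) auto
    also have "prob (S N \<union> Q N) \<le> prob (S N) + prob (Q N)"
      using ev by (intro measure_Un_le) auto
    also have "prob (\<Union>k<K. E N k) \<le> (\<Sum>k<K. prob (E N k))"
      using Em by (intro finite_measure_subadditive_finite) auto
    finally show ?thesis
      unfolding B_def using PT[OF N] PS[OF N] PQ[OF N] by linarith
  qed
  \<comment> \<open>Of the four terms the first and the last tend to 0, while the two middle ones
    have limits of at most \<open>\<rho> / 8\<close>.\<close>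
  have "B \<longlonglongrightarrow> (\<Sum>k<K. 0) + 2 * (LINT x|\<mu>. tail C K x) / \<theta>
      + (8 * \<epsilon>\<^sup>2 * (1 + M) / (e / 2)\<^sup>2 + Ch * (0 * (10 + 14 * M)) / (e / 2))"
    unfolding B_def
  proof (intro tendsto_intros)
    show "(\<lambda>N. prob (E N k)) \<longlonglongrightarrow> 0" for k
      unfolding E_def using C \<delta>
      by (intro uniform_weak_law prob_space_axioms indep) (auto simp: indicator_def)
    show "(\<lambda>N. LINT x|nubar N. tail C K x) \<longlonglongrightarrow> (LINT x|\<mu>. tail C K x)"
      by (rule nubar_tendsto[OF t(1) _ t(2)]) simp
    show "(\<lambda>N. LINT x|nubar N. norm_pow l x) \<longlonglongrightarrow> M" "(\<lambda>N. LINT x|nubar N. norm_pow l x) \<longlonglongrightarrow> M"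
      unfolding M_def by (rule nubar_tendsto[OF norm_pow_measurable _ norm_pow_growth], simp)+
    show "(\<lambda>N. real N powr (1 / 2 - \<alpha>)) \<longlonglongrightarrow> 0"
      using \<alpha> by (intro tendsto_neg_powr filterlim_real_sequentially) simp
  qed (use e \<theta> in auto)
  moreover have "(\<Sum>k<K. 0) + 2 * (LINT x|\<mu>. tail C K x) / \<theta>
      + (8 * \<epsilon>\<^sup>2 * (1 + M) / (e / 2)\<^sup>2 + Ch * (0 * (10 + 14 * M)) / (e / 2)) < \<rho>"
  proof -
    have "2 * (LINT x|\<mu>. tail C K x) / \<theta> \<le> 2 * \<kappa> / \<theta>"
      using t\<mu> \<theta> by (intro divide_right_mono mult_left_mono) auto
    also have "\<dots> = \<rho> / 8" using \<theta> by (simp add: \<kappa>_def)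
    finally show ?thesis unfolding \<epsilon>2 using \<rho> by simp
  qed
  ultimately have "\<forall>\<^sub>F N in sequentially. B N < \<rho>" by (rule order_tendstoD)
  moreover have "\<forall>\<^sub>F N in sequentially. cells_close C K (\<delta> / 2) (nubar N)"
    using \<delta> by (intro nubar_cells C) simp
  ultimately have "\<forall>\<^sub>F N in sequentially. norm (prob {\<omega>\<in>space P. e < \<bar>remainder N \<omega>\<bar>} - 0) < \<rho>"
    using eventually_gt_at_top[of 0]
  proof eventually_elim
    case (elim N)
    then show ?case using bound[OF elim(3) elim(2)] by simp
  qed
  then show "\<exists>no. \<forall>N\<ge>no. norm (prob {\<omega>\<in>space P. e < \<bar>remainder N \<omega>\<bar>} - 0) < \<rho>"
    by (simp add: eventually_sequentially)
qed

definition "fluctuation N \<omega> = sqrt (real N) * (U (empirical N \<omega>) - U \<mu>)"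

text \<open>For \<open>N = 0\<close> the empirical measure is not a probability measure, but the
  factor \<open>sqrt 0\<close> makes the variable constant.\<close>

lemma fluctuation_measurable: "fluctuation N \<in> borel_measurable P"
proof (cases "N = 0")
  case False
  then show ?thesis
    unfolding fluctuation_def using U_empirical_measurable[of N]
    by (intro borel_measurable_times borel_measurable_diff) auto
qed (simp add: fluctuation_def[abs_def])

text \<open>Levy's continuity theorem reduces the claim to characteristic functions. What is left
  after removal of the linear part is the remainder, which tends to 0 in probability, plus the
  deterministic bias, which converges to the mean; \<open>slutsky_char\<close> turns this constant
  into a phase factor.\<close>

lemma weak_convergence:
  "weak_conv_m (\<lambda>N. distr P borel (fluctuation N)) (gaussian_law (signed_integral \<sigma> f) asym_var)"
proof (rule levy_continuity)
  show "real_distribution (distr P borel (fluctuation N))" for N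
    by (rule real_distribution_distr[OF fluctuation_measurable])
  show "real_distribution (gaussian_law (signed_integral \<sigma> f) asym_var)"
    by (rule gaussian_law_char(1)[OF asym_var_nonneg])
  fix t
  define A where "A N \<omega> = (\<Sum>i=1..N. Y i \<omega>) / sqrt (real N)" for N \<omega>
  define R where "R N \<omega> = fluctuation N \<omega> - A N \<omega>" for N \<omega>
  define c where "c = signed_integral \<sigma> f"
  have Am: "A N \<in> borel_measurable P" for N
    unfolding A_def using Y_measurable by (intro borel_measurable_divide borel_measurable_sum) auto
  have Rm: "R N \<in> borel_measurable P" for N
    unfolding R_def using Am fluctuation_measurable by (intro borel_measurable_diff) auto
  have conv: "(\<lambda>N. prob {\<omega>\<in>space P. e < \<bar>R N \<omega> - c\<bar>}) \<longlonglongrightarrow> 0" if e: "0 < e" for e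
  proof (rule tendsto_sandwich[OF _ _ tendsto_const remainder_tendsto[OF half_gt_zero[OF e]]])
    have "\<forall>\<^sub>F N in sequentially. \<bar>sqrt (real N) * (U (nubar N) - U \<mu>) - c\<bar> < e / 2"
      using tendstoD[OF bias half_gt_zero[OF e]] by (simp add: dist_real_def c_def)
    then show "\<forall>\<^sub>F N in sequentially. prob {\<omega>\<in>space P. e < \<bar>R N \<omega> - c\<bar>} \<le> prob {\<omega>\<in>space P. e / 2 < \<bar>remainder N \<omega>\<bar>}"
      using eventually_gt_at_top[of 0]
    proof eventually_elim
      case (elim N)
      have eq: "R N \<omega> = remainder N \<omega> + sqrt (real N) * (U (nubar N) - U \<mu>)" for \<omega>
        by (simp add: R_def A_def remainder_def fluctuation_def algebra_simps)
      have "{\<omega>\<in>space P. e < \<bar>R N \<omega> - c\<bar>} \<subseteq> {\<omega>\<in>space P. e / 2 < \<bar>remainder N \<omega>\<bar>}"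
      proof safe
        fix \<omega> assume "e < \<bar>R N \<omega> - c\<bar>"
        then show "e / 2 < \<bar>remainder N \<omega>\<bar>" using elim(1) unfolding eq by linarith
      qed
      moreover have "{\<omega>\<in>space P. e / 2 < \<bar>remainder N \<omega>\<bar>} \<in> events"
        using remainder_measurable[OF elim(2)] by measurable
      ultimately show ?case by (rule finite_measure_mono)
    qed
  qed auto
  have "(\<lambda>N. char (distr P borel (\<lambda>\<omega>. A N \<omega> + R N \<omega>)) t) \<longlonglongrightarrow> iexp (t * c) * complex_of_real (exp (- (t\<^sup>2 * asym_var / 2)))"
    by (rule slutsky_char[OF prob_space_axioms Am Rm linear_part_char[folded A_def] conv])
  then show "(\<lambda>N. char (distr P borel (fluctuation N)) t) \<longlonglongrightarrow> char (gaussian_law (signed_integral \<sigma> f) asym_var) t"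
    by (simp add: R_def gaussian_law_char(2)[OF asym_var_nonneg] c_def)
qed

end

theorem theorem2:
  fixes l r :: real
    and P :: "'o measure"
    and X :: "nat \<Rightarrow> 'o \<Rightarrow> 'a::euclidean_space"
    and \<nu> :: "nat \<Rightarrow> 'a measure"
    and \<mu> :: "'a measure"
    and \<eta> :: "('a \<times> 'a) measure"
    and \<sigma> :: "'a set \<Rightarrow> real"
    and U :: "'a measure \<Rightarrow> real"
    and D :: "'a measure \<Rightarrow> 'a \<Rightarrow> real"
  assumes l: "0 \<le> l"
    and P: "prob_space P"
    and indep: "prob_space.indep_vars P (\<lambda>_. borel) X {1..}"
    and law: "\<And>i. 1 \<le> i \<Longrightarrow> distr P borel (X i) = \<nu> i"
    and \<nu>: "\<And>i. 1 \<le> i \<Longrightarrow> \<nu> i \<in> prob_moment l"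
    and \<mu>: "\<mu> \<in> prob_moment l"
    and U_measurable: "U \<in> borel_measurable (prob_moment_space l)"
    and \<eta>: "\<eta> \<in> prob_moment l"
    and \<eta>_fst: "distr \<eta> borel fst = \<mu>"
    and \<eta>_snd: "distr \<eta> borel snd = \<mu>"
    and conv_\<eta>:
      "(\<lambda>N. wasserstein l (average_measure N (\<lambda>i. \<nu> i \<Otimes>\<^sub>M \<nu> i)) \<eta>) \<longlonglongrightarrow> 0"
    and \<sigma>: "\<sigma> \<in> signed_moment l"
    and conv_\<sigma>:
      "(\<lambda>N. weighted_norm l
          (\<lambda>A. sqrt (real N) * measure_diff (average_measure N \<nu>) \<mu> A - \<sigma> A)) \<longlonglongrightarrow> 0"
    and tails:
      "\<exists>\<beta>. 0 < \<beta> \<and> \<beta> < 1 \<and>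
         (\<lambda>i. 1 / real i *
            (LINT \<omega>|P. (norm_pow l (X i \<omega>) - real i powr \<beta>) *
               indicator {\<omega>. norm_pow l (X i \<omega>) > real i powr \<beta>} \<omega>)) summable_on {1..}"
    and r: "0 < r"
    and deriv:
      "\<And>m. m \<in> wasserstein_ball l \<mu> r \<Longrightarrow> has_linear_functional_derivative l U (D m) m"
    and growth:
      "\<exists>C. \<forall>m\<in>wasserstein_ball l \<mu> r. \<forall>x. \<bar>D m x\<bar> \<le> C * (1 + norm_pow (l / 2) x)"
    and cont_at_\<mu>:
      "\<forall>\<epsilon>>0. \<exists>\<delta>>0. \<forall>m\<in>wasserstein_ball l \<mu> r. wasserstein l m \<mu> < \<delta> \<longrightarrow>
         (SUP x. \<bar>D m x - D \<mu> x\<bar> / (1 + norm_pow (l / 2) x)) < \<epsilon>"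
    and cont_ae: "AE x in \<mu>. isCont (D \<mu>) x"
    and hoelder:
      "\<exists>\<alpha> C. 1 / 2 < \<alpha> \<and> \<alpha> \<le> 1 \<and>
         (\<forall>m\<^sub>1\<in>wasserstein_ball l \<mu> r. \<forall>m\<^sub>2\<in>wasserstein_ball l \<mu> r. \<forall>x.
            \<bar>D m\<^sub>2 x - D m\<^sub>1 x\<bar> \<le>
              C * ((1 + norm_pow l x) * tv_norm (measure_diff m\<^sub>2 m\<^sub>1) powr \<alpha> +
                   (1 + norm_pow (l * (1 - \<alpha>)) x) *
                     (LINT y|total_variation (measure_diff m\<^sub>2 m\<^sub>1). norm_pow l y) powr \<alpha>))"
  shows "weak_conv_m
           (\<lambda>N. distr P borel
              (\<lambda>\<omega>. sqrt (real N) *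
                 (U (average_measure N (\<lambda>i. return borel (X i \<omega>))) - U \<mu>)))
           (gaussian_law
              (signed_integral \<sigma> (D \<mu>))
              ((LINT x|\<mu>. (D \<mu> x)\<^sup>2) - (LINT z|\<eta>. D \<mu> (fst z) * D \<mu> (snd z))))"
proof -
  interpret P: prob_space P by (fact P)
  obtain C where C: "\<And>m x. m \<in> wasserstein_ball l \<mu> r \<Longrightarrow> \<bar>D m x\<bar> \<le> C * (1 + norm_pow (l / 2) x)"
    using growth by blast
  \<comment> \<open>The constants of the growth and Hoelder conditions are enlarged to have the
    signs that the locale asks for; the factors they multiply are nonnegative.\<close>
  have C': "\<bar>D m x\<bar> \<le> max 1 C * (1 + norm_pow (l / 2) x)" if "m \<in> wasserstein_ball l \<mu> r" for m x
    by (rule order_trans[OF C[OF that]]) (intro mult_right_mono, auto)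
  obtain \<alpha> Ch where \<alpha>: "1 / 2 < \<alpha>" "\<alpha> \<le> 1"
    and h: "\<And>m\<^sub>1 m\<^sub>2 x. m\<^sub>1 \<in> wasserstein_ball l \<mu> r \<Longrightarrow> m\<^sub>2 \<in> wasserstein_ball l \<mu> r \<Longrightarrow>
            \<bar>D m\<^sub>2 x - D m\<^sub>1 x\<bar> \<le>
              Ch * ((1 + norm_pow l x) * tv_norm (measure_diff m\<^sub>2 m\<^sub>1) powr \<alpha> +
                   (1 + norm_pow (l * (1 - \<alpha>)) x) *
                     (LINT y|total_variation (measure_diff m\<^sub>2 m\<^sub>1). norm_pow l y) powr \<alpha>)"
    using hoelder by blast
  have h': "\<bar>D m\<^sub>2 x - D m\<^sub>1 x\<bar> \<le>
              max 0 Ch * ((1 + norm_pow l x) * tv_norm (measure_diff m\<^sub>2 m\<^sub>1) powr \<alpha> +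
                   (1 + norm_pow (l * (1 - \<alpha>)) x) *
                     (LINT y|total_variation (measure_diff m\<^sub>2 m\<^sub>1). norm_pow l y) powr \<alpha>)"
    if "m\<^sub>1 \<in> wasserstein_ball l \<mu> r" "m\<^sub>2 \<in> wasserstein_ball l \<mu> r" for m\<^sub>1 m\<^sub>2 x
    by (rule order_trans[OF h[OF that]]) (intro mult_right_mono, auto)
  interpret nonlinear_clt P l r X \<nu> \<mu> \<eta> \<sigma> U D "max 1 C" \<alpha> "max 0 Ch"
    by unfold_locales
      (fact l indep law \<nu> \<mu> U_measurable \<eta> \<eta>_fst \<eta>_snd conv_\<eta> \<sigma> conv_\<sigma> r deriv C' cont_at_\<mu> cont_ae \<alpha> h' | simp)+
  show ?thesis
    using weak_convergence unfolding fluctuation_def empirical_def f_def asym_var_def .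
qed

end
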